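(* Let $A\in\operatorname{M}_n(\mathbb{Z})$ be non-singular with irreducible characteristic polynomial, assume $\mathcal{P}'(A)\ne\emptyset$, and assume there exists a prime $p\in\mathbb{N}$ with $\gcd(n,t_p)=1$. Let $\lambda\in\overline{\mathbb{Q}}$ be an eigenvalue of $A$ and let $\mathbf{u}=(u_1,\ldots,u_n)^t\in\overline{\mathbb{Q}}^n$ be an eigenvector of $A$ corresponding to $\lambda$. Let $Y$ be the $\mathbb{Z}[\lambda^{\pm1}]$-submodule of $\overline{\mathbb{Q}}$ generated by $u_1,\ldots,u_n$, endowed with the discrete topology. Then $\mathbb{S}_A$ is isomorphic to the Pontryagin dual $\widehat{Y}$. If $K=\mathbb{Q}(\lambda)$ and $\mathbf{u}\in(\mathcal{O}_K)^n$, then $Y\subseteq\mathcal{O}_{K,\lambda}$ and $$\operatorname{Span}_{\mathbb{Z}}(u_1,\ldots,u_n)\subseteq Y\subseteq \operatorname{Span}_{\mathcal{R}}(u_1,\ldots,u_n),$$ where $\mathcal{R}=\mathbb{Z}[1/\det A]$. Moreover, under the isomorphism, each continuous endomorphism $\alpha$ of $\mathbb{S}_A$ is dual to an endomorphism $\hat\alpha(y)=xy$ ($y\in Y$) of $Y$ for some $x\in\mathcal{O}_{K,\lambda}$.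
   Context: $h_A$ is the characteristic polynomial of $A$; $\mathcal{P}(A)$ is the set of primes dividing $\det A$; $\mathcal{P}'(A)=\{p\in\mathcal{P}(A)\mid h_A\not\equiv x^n\pmod p\}$; $t_p$ is the multiplicity of $0$ as a root of $h_A$ mod $p$. The toroidal solenoid is $\mathbb{S}_A=\{(z_j)_{j\ge1}\in\prod_{j\ge1}\mathbb{T}^n\mid A(z_{j+1})=z_j\ \forall j\}$, where $\mathbb{T}^n=\mathbb{R}^n/\mathbb{Z}^n$ and $A([\mathbf{x}])=[A\mathbf{x}]$, a compact abelian group with the topology induced by the product topology. $\mathcal{O}_K$ is the ring of integers of $K$ and $\mathcal{O}_{K,\lambda}=\mathcal{O}_K[\lambda^{-1}]$. *)

theory Defs
  imports
    "HOL-Algebra.Generated_Fields"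
    "HOL-Algebra.Product_Groups"
    "HOL-Number_Theory.Cong"
    "HOL-Computational_Algebra.Polynomial_Factorial"
    "HOL-Analysis.Analysis"
begin

section \<open>Characteristic polynomial and the associated primes\<close>

definition charpoly :: "int ^ 'n ^ 'n \<Rightarrow> int poly" where
  "charpoly A = det (mat [:0, 1:] - map_matrix (\<lambda>a. [:a:]) A)"

definition poly_cong :: "nat \<Rightarrow> int poly \<Rightarrow> int poly \<Rightarrow> bool" where
  "poly_cong p f g \<longleftrightarrow> (\<forall>i. [coeff f i = coeff g i] (mod int p))"

definition det_primes :: "int ^ 'n ^ 'n \<Rightarrow> nat set" where
  "det_primes A = {p. Factorial_Ring.prime p \<and> int p dvd det A}"

definition det_primes' :: "int ^ 'n ^ 'n \<Rightarrow> nat set" where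
  "det_primes' A = {p \<in> det_primes A. \<not> poly_cong p (charpoly A) (monom 1 CARD('n))}"

text \<open>
  The multiplicity \<open>t\<^sub>p\<close> of the root \<open>0\<close> of the characteristic polynomial modulo \<open>p\<close>: the largest
  \<open>k\<close> for which \<open>x\<^sup>k\<close> divides its reduction in \<open>\<F>\<^sub>p[x]\<close>. It is \<open>0\<close> if \<open>p\<close> does not divide the
  determinant.
\<close>

definition zero_mult :: "int ^ 'n ^ 'n \<Rightarrow> nat \<Rightarrow> nat" where
  "zero_mult A p = (GREATEST k. \<exists>g. poly_cong p (charpoly A) (monom 1 k * g))"


section \<open>Torus and solenoid\<close>

definition additive_group :: "'a set \<Rightarrow> 'a::ab_group_add monoid" where
  "additive_group S = \<lparr>carrier = S, monoid.mult = (+), one = 0\<rparr>"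

definition int_lattice :: "(real ^ 'n) set" where
  "int_lattice = {x. \<forall>i. x $ i \<in> \<int>}"

definition torus :: "(real ^ 'n) set monoid" where
  "torus = additive_group UNIV Mod int_lattice"

definition torus_class :: "real ^ 'n \<Rightarrow> (real ^ 'n) set" where
  "torus_class x = int_lattice #>\<^bsub>additive_group UNIV\<^esub> x"

text \<open>The quotient topology; see \<open>quotient_map_torus_class\<close> below.\<close>

definition torus_topology :: "(real ^ 'n) set topology" where
  "torus_topology = topology (\<lambda>U. U \<subseteq> carrier torus \<and> open (torus_class -` U))"

text \<open>The common value of \<open>[A x]\<close> over all representatives \<open>x\<close>; see \<open>torus_map_class\<close> below.\<close>

definition torus_map :: "int ^ 'n ^ 'n \<Rightarrow> (real ^ 'n) set \<Rightarrow> (real ^ 'n) set" where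
  "torus_map A c = the_elem ((\<lambda>x. torus_class (map_matrix of_int A *v x)) ` c)"

definition solenoid :: "int ^ 'n ^ 'n \<Rightarrow> (nat \<Rightarrow> (real ^ 'n) set) set" where
  "solenoid A = {z \<in> (\<Pi>\<^sub>E j\<in>{1..}. carrier torus). \<forall>j\<ge>1. torus_map A (z (j + 1)) = z j}"

definition solenoid_group :: "int ^ 'n ^ 'n \<Rightarrow> (nat \<Rightarrow> (real ^ 'n) set) monoid" where
  "solenoid_group A = (product_group {1..} (\<lambda>_. torus))\<lparr>carrier := solenoid A\<rparr>"

definition solenoid_topology :: "int ^ 'n ^ 'n \<Rightarrow> (nat \<Rightarrow> (real ^ 'n) set) topology" where
  "solenoid_topology A = subtopology (product_topology (\<lambda>_. torus_topology) {1..}) (solenoid A)"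


section \<open>Pontryagin duality\<close>

definition circle_group :: "complex monoid" where
  "circle_group = \<lparr>carrier = sphere 0 1, monoid.mult = (*), one = 1\<rparr>"

text \<open>Characters are made extensional, so that equality of characters is equality of functions.\<close>

definition characters :: "'a monoid \<Rightarrow> 'a topology \<Rightarrow> ('a \<Rightarrow> complex) set" where
  "characters G X = {\<phi> \<in> hom G circle_group \<inter> extensional (carrier G).
     continuous_map X (top_of_set (sphere 0 1)) \<phi>}"

definition dual_group :: "'a monoid \<Rightarrow> 'a topology \<Rightarrow> ('a \<Rightarrow> complex) monoid" where
  "dual_group G X = \<lparr>carrier = characters G X,
     monoid.mult = (\<lambda>\<phi> \<psi>. \<lambda>x\<in>carrier G. \<phi> x * \<psi> x),
     one = (\<lambda>x\<in>carrier G. 1)\<rparr>"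

text \<open>The compact-open topology.\<close>

definition dual_topology :: "'a monoid \<Rightarrow> 'a topology \<Rightarrow> ('a \<Rightarrow> complex) topology" where
  "dual_topology G X = topology_generated_by
     {{\<phi> \<in> characters G X. \<phi> ` C \<subseteq> U} | C U. compactin X C \<and> openin (top_of_set (sphere 0 1)) U}"

definition dual_hom :: "'a monoid \<Rightarrow> ('a \<Rightarrow> 'a) \<Rightarrow> ('a \<Rightarrow> complex) \<Rightarrow> 'a \<Rightarrow> complex" where
  "dual_hom G f \<phi> = (\<lambda>x\<in>carrier G. \<phi> (f x))"

definition top_group_iso ::
  "'a monoid \<Rightarrow> 'a topology \<Rightarrow> 'b monoid \<Rightarrow> 'b topology \<Rightarrow> ('a \<Rightarrow> 'b) \<Rightarrow> bool" where
  "top_group_iso G X H Y f \<longleftrightarrow> f \<in> iso G H \<and> homeomorphic_map X Y f"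


section \<open>Rings and modules inside the complex numbers\<close>

definition complex_ring :: "complex ring" where
  "complex_ring = \<lparr>carrier = UNIV, monoid.mult = (*), one = 1, zero = 0, add = (+)\<rparr>"

definition int_adjoin :: "complex set \<Rightarrow> complex set" where
  "int_adjoin S = generate_ring complex_ring S"

definition rat_adjoin_field :: "complex \<Rightarrow> complex set" where
  "rat_adjoin_field l = generate_field complex_ring {l}"

definition integers_of :: "complex set \<Rightarrow> complex set" where
  "integers_of K = {x \<in> K. algebraic_int x}"

text \<open>\<open>\<O>\<^sub>K[\<lambda>\<^sup>-\<^sup>1]\<close> for \<open>K = \<rat>(\<lambda>)\<close>.\<close>

definition S_integers :: "complex \<Rightarrow> complex set" where
  "S_integers l = int_adjoin (integers_of (rat_adjoin_field l) \<union> {inverse l})"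

definition span_over :: "complex set \<Rightarrow> complex ^ 'n \<Rightarrow> complex set" where
  "span_over R u = {\<Sum>i\<in>UNIV. c i * u $ i | c. \<forall>i. c i \<in> R}"

definition eigen_module :: "complex \<Rightarrow> complex ^ 'n \<Rightarrow> complex set" where
  "eigen_module l u = span_over (int_adjoin {l, inverse l}) u"


section \<open>Well-definedness\<close>

lemma torus_class_eq: "torus_class x = {y. y - x \<in> int_lattice}"
proof -
  have "y \<in> torus_class x \<longleftrightarrow> y - x \<in> int_lattice" for y
  proof -
    have "(\<exists>h\<in>int_lattice. y = h + x) \<longleftrightarrow> y - x \<in> int_lattice"
      by (metis add_diff_cancel_right' diff_add_cancel)
    thus ?thesis by (simp add: torus_class_def r_coset_def additive_group_def)
  qed
  thus ?thesis by blast
qed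

lemma int_lattice_diff: "x \<in> int_lattice \<Longrightarrow> y \<in> int_lattice \<Longrightarrow> x - y \<in> int_lattice"
  unfolding int_lattice_def by (simp add: Ints_diff)

lemma int_lattice_add: "x \<in> int_lattice \<Longrightarrow> y \<in> int_lattice \<Longrightarrow> x + y \<in> int_lattice"
  unfolding int_lattice_def by (simp add: Ints_add)

lemma torus_class_eq_iff: "torus_class x = torus_class y \<longleftrightarrow> x - y \<in> int_lattice"
proof
  assume "torus_class x = torus_class y"
  moreover have "x \<in> torus_class x" by (simp add: torus_class_eq int_lattice_def)
  ultimately show "x - y \<in> int_lattice" by (simp add: torus_class_eq)
next
  assume *: "x - y \<in> int_lattice"
  have "z - x \<in> int_lattice \<longleftrightarrow> z - y \<in> int_lattice" for z
    using int_lattice_add[OF _ *, of "z - x"] int_lattice_diff[OF _ *, of "z - y"] by auto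
  thus "torus_class x = torus_class y" by (simp add: torus_class_eq)
qed

lemma carrier_torus: "carrier torus = range torus_class"
  by (auto simp: torus_def carrier_FactGroup torus_class_def additive_group_def)

lemma torus_map_class:
  "torus_map A (torus_class x) = torus_class (map_matrix of_int A *v x)"
proof -
  have "torus_class (map_matrix of_int A *v y) = torus_class (map_matrix of_int A *v x)"
    if "y \<in> torus_class x" for y
  proof -
    have "y - x \<in> int_lattice" using that by (simp add: torus_class_eq)
    hence "map_matrix of_int A *v (y - x) \<in> int_lattice"
      by (auto simp: int_lattice_def matrix_vector_mult_def intro!: Ints_sum Ints_mult)
    thus ?thesis by (simp add: torus_class_eq_iff matrix_vector_mult_diff_distrib)
  qed
  moreover have "x \<in> torus_class x" by (simp add: torus_class_eq int_lattice_def)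
  ultimately have "(\<lambda>y. torus_class (map_matrix of_int A *v y)) ` torus_class x
      = {torus_class (map_matrix of_int A *v x)}" by blast
  thus ?thesis by (simp add: torus_map_def)
qed

lemma openin_torus_topology:
  fixes U :: "(real ^ 'n) set set"
  shows "openin torus_topology U \<longleftrightarrow> U \<subseteq> carrier torus \<and> open (torus_class -` U)"
proof -
  have "istopology (\<lambda>U :: (real ^ 'n) set set. U \<subseteq> carrier torus \<and> open (torus_class -` U))"
    unfolding istopology_def by (auto simp: vimage_Union)
  from topology_inverse'[OF this] show ?thesis by (simp add: torus_topology_def)
qed

lemma quotient_map_torus_class:
  "quotient_map euclidean torus_topology (torus_class :: real ^ 'n \<Rightarrow> _)"
proof -
  have "openin torus_topology (carrier (torus :: (real ^ 'n) set monoid))"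
    by (simp add: openin_torus_topology carrier_torus vimage_def)
  hence "topspace torus_topology = carrier (torus :: (real ^ 'n) set monoid)"
    by (meson openin_subset openin_topspace openin_torus_topology subset_antisym)
  thus ?thesis
    by (simp add: quotient_map_def carrier_torus openin_torus_topology vimage_def)
qed

lemma comm_group_torus: "comm_group (torus :: (real ^ 'n) set monoid)"
proof -
  have inv: "\<exists>y. x + y = 0" for x :: "real ^ 'n"
    by (rule exI[of _ "- x"]) simp
  have G: "comm_group (additive_group (UNIV :: (real ^ 'n) set))"
    by (rule comm_groupI) (auto simp: additive_group_def add_ac inv)
  then interpret comm_group "additive_group (UNIV :: (real ^ 'n) set)" .
  have "inv\<^bsub>additive_group UNIV\<^esub> x = - x" for x :: "real ^ 'n"
    by (rule inv_equality) (auto simp: additive_group_def)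
  moreover have zero_mem: "0 \<in> (int_lattice :: (real ^ 'n) set)"
    by (simp add: int_lattice_def)
  ultimately have "subgroup (int_lattice :: (real ^ 'n) set) (additive_group UNIV)"
    using int_lattice_add int_lattice_diff[of 0] zero_mem
    by (intro subgroupI) (auto simp: additive_group_def)
  thus ?thesis unfolding torus_def by (rule abelian_FactGroup)
qed

lemma field_complex_ring: "field complex_ring"
proof -
  have inv: "\<exists>y. x + y = 0" for x :: complex
    by (rule exI[of _ "- x"]) simp
  have "abelian_group complex_ring"
    by (rule abelian_groupI) (auto simp: complex_ring_def add_ac inv)
  moreover have "comm_monoid complex_ring"
    by (rule comm_monoidI) (auto simp: complex_ring_def mult_ac)
  ultimately have "cring complex_ring"
    by (rule cringI) (auto simp: complex_ring_def distrib_right)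
  moreover have "\<exists>y. x * y = 1" if "x \<noteq> 0" for x :: complex
    using that by (intro exI[of _ "inverse x"]) auto
  ultimately show ?thesis
    by (intro cring.cring_fieldI2) (auto simp: complex_ring_def)
qed

end

theory Submission
  imports Defs "HOL-Computational_Algebra.Field_as_Ring"
    "HOL-Computational_Algebra.Fundamental_Theorem_Algebra"
begin

text \<open>
  Since \<open>A u = \<lambda> u\<close> and the entries of \<open>u\<close> are linearly independent over \<open>\<rat>\<close>, the module \<open>Y\<close> is the
  union of the lattices \<open>\<lambda>\<^sup>-\<^sup>k Span(u)\<close>, that is, the direct limit of \<open>\<int>\<^sup>n\<close> under the transpose of \<open>A\<close>.
  A point \<open>z\<close> of the solenoid with \<open>z\<^sub>k\<^sub>+\<^sub>1 = [x]\<close> acts on \<open>Y\<close> by sending \<open>\<lambda>\<^sup>-\<^sup>k (c \<cdot> u)\<close> to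
  \<open>exp (2 \<pi> i (c \<cdot> x))\<close>, and this is the isomorphism with the dual. As the circle has no small subgroups,
  every character of the solenoid factors through a coordinate, so it is evaluation at a point of \<open>Y\<close>;
  hence every continuous endomorphism is dual to an additive endomorphism \<open>f\<close> of \<open>Y\<close>.

  Up to a power of \<open>\<lambda>\<close>, \<open>f\<close> is given by an integer matrix \<open>B\<close> such that for every \<open>k\<close> there are \<open>m\<close> and an
  integer matrix \<open>B'\<close> with \<open>B A\<^sup>m = A\<^sup>k B'\<close>. Let \<open>t\<^sub>i\<^sub>j\<close> be the entries of \<open>B\<close> in a basis of eigenvectors of
  \<open>A\<close>; then \<open>t\<^sub>i\<^sub>j \<lambda>\<^sub>j\<^sup>m\<close> is divisible by \<open>\<lambda>\<^sub>i\<^sup>k\<close> up to a fixed denominator. So for a prime ideal above \<open>p\<close>, if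
  \<open>t\<^sub>i\<^sub>j \<noteq> 0\<close> and the ideal contains \<open>\<lambda>\<^sub>i\<close>, it contains \<open>\<lambda>\<^sub>j\<close>. The relation \<open>t\<^sub>i\<^sub>j \<noteq> 0\<close> for some such \<open>B\<close>
  is reflexive and transitive, and all its successor sets have the same size \<open>b\<close>, so it is an equivalence
  relation with classes of size \<open>b\<close>. Then \<open>b\<close> divides \<open>n\<close> and also \<open>t\<^sub>p\<close>, the number of eigenvalues in the
  prime ideal, so \<open>b = 1\<close> and \<open>B\<close> is diagonal in the eigenbasis.
\<close>

section \<open>Characteristic polynomials\<close>

text \<open>A \<open>\<rat>\<close>-linear functional on \<open>\<complex>\<close> carries complex solutions of a rational system to rational ones.
  This descent takes the place of Galois theory in what follows.\<close>

lemma rational_solution: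
  fixes p :: "'i \<Rightarrow> complex" and EQ :: "('i \<Rightarrow> int) set"
  assumes i0: "p i0 \<noteq> 0"
    and eq: "\<And>c. c \<in> EQ \<Longrightarrow> (\<Sum>i\<in>I. of_int (c i) * p i) = 0"
  obtains q :: "'i \<Rightarrow> rat" where "q i0 \<noteq> 0"
    "\<And>c. c \<in> EQ \<Longrightarrow> (\<Sum>i\<in>I. of_int (c i) * q i) = 0"
proof -
  interpret C: vector_space "\<lambda>(r::rat) (z::complex). of_rat r * z"
    by unfold_locales (simp_all add: algebra_simps of_rat_add of_rat_mult)
  interpret Q: vector_space "\<lambda>(r::rat) (z::rat). r * z"
    by unfold_locales (simp_all add: algebra_simps)
  interpret CQ: vector_space_pair "\<lambda>(r::rat) (z::complex). of_rat r * z" "\<lambda>(r::rat) (z::rat). r * z" ..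
  have "\<not> C.dependent {p i0}" using i0 by simp
  from CQ.linear_independent_extend[OF this, of "\<lambda>_. 1"] obtain g
    where lin: "Vector_Spaces.linear (\<lambda>r z. of_rat r * z) (\<lambda>r z. r * z) g" and g1: "g (p i0) = 1"
    by auto
  interpret g: Vector_Spaces.linear "\<lambda>(r::rat) (z::complex). of_rat r * z" "\<lambda>(r::rat) (z::rat). r * z" g
    by (fact lin)
  show thesis
  proof (rule that[of "\<lambda>i. g (p i)"])
    show "g (p i0) \<noteq> 0" using g1 by simp
    fix c assume "c \<in> EQ"
    from eq[OF this] have "g (\<Sum>i\<in>I. of_rat (of_int (c i)) * p i) = 0" by (simp add: g.zero)
    also have "g (\<Sum>i\<in>I. of_rat (of_int (c i)) * p i) = (\<Sum>i\<in>I. of_int (c i) * g (p i))"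
      by (simp only: g.sum g.scale)
    finally show "(\<Sum>i\<in>I. of_int (c i) * g (p i)) = 0" .
  qed
qed

section \<open>Ring homomorphisms, determinants and polynomial evaluation\<close>

locale unital_ring_hom =
  fixes f :: "'a::comm_ring_1 \<Rightarrow> 'b::comm_ring_1"
  assumes f_add: "f (a + b) = f a + f b" and f_mult: "f (a * b) = f a * f b" and f_one: "f 1 = 1"
begin

lemma f_zero: "f 0 = 0"
  using f_add[of 0 0] by simp

lemma f_minus: "f (- a) = - f a"
  using f_add[of a "- a"] f_zero by (simp add: minus_unique)

lemma f_sum: "f (sum g X) = (\<Sum>x\<in>X. f (g x))"
  by (induction X rule: infinite_finite_induct) (auto simp: f_zero f_add)

lemma f_prod: "f (prod g X) = (\<Prod>x\<in>X. f (g x))"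
  by (induction X rule: infinite_finite_induct) (auto simp: f_one f_mult)

lemma f_of_int: "f (of_int k) = of_int k"
proof -
  have n: "f (of_nat m) = of_nat m" for m
    by (induction m) (auto simp: f_zero f_add f_one)
  show ?thesis
    by (cases k rule: int_cases2) (auto simp: n f_minus)
qed

lemma f_det:
  fixes M :: "'a ^ 'n ^ 'n"
  shows "f (det M) = det (map_matrix f M)"
  by (simp add: det_def f_sum f_prod f_mult f_of_int)

lemma map_poly_f_add: "map_poly f (p + q) = map_poly f p + map_poly f q"
  by (rule poly_eqI) (simp add: coeff_map_poly f_zero f_add)

lemma map_poly_f_mult: "map_poly f (p * q) = map_poly f p * map_poly f q"
  by (rule poly_eqI) (simp add: coeff_map_poly f_zero f_mult coeff_mult f_sum)

lemma unital_ring_hom_poly: "unital_ring_hom (\<lambda>p. poly (map_poly f p) x)"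
  by unfold_locales (auto simp: map_poly_f_add map_poly_f_mult map_poly_pCons f_one f_zero one_pCons)

end

lemma unital_ring_hom_of_int: "unital_ring_hom (of_int :: int \<Rightarrow> 'b::comm_ring_1)"
  by unfold_locales auto

lemma unital_ring_hom_of_rat: "unital_ring_hom (of_rat :: rat \<Rightarrow> 'b::field_char_0)"
  by unfold_locales (auto simp: of_rat_add of_rat_mult)

text \<open>Mapping the coefficients and evaluating at \<open>x\<close> is a ring homomorphism, so
  it commutes with the determinant.\<close>

lemma poly_charpoly:
  fixes A :: "int ^ 'n ^ 'n" and x :: "'b::comm_ring_1"
  shows "poly (map_poly of_int (charpoly A)) x = det (mat x - map_matrix of_int A)"
proof -
  interpret unital_ring_hom "\<lambda>p. poly (map_poly (of_int :: int \<Rightarrow> 'b) p) x"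
    by (rule unital_ring_hom.unital_ring_hom_poly[OF unital_ring_hom_of_int])
  have "map_matrix (\<lambda>p. poly (map_poly (of_int :: int \<Rightarrow> 'b) p) x) (mat [:0, 1:] - map_matrix (\<lambda>a. [:a:]) A)
     = mat x - map_matrix of_int A"
    by (simp add: vec_eq_iff mat_def map_poly_pCons)
  thus ?thesis unfolding charpoly_def f_det by simp
qed

lemma monic_prod_linear:
  fixes r :: "'i \<Rightarrow> 'a::idom"
  assumes "finite S"
  shows "degree (\<Prod>i\<in>S. [:- r i, 1:]) = card S" "lead_coeff (\<Prod>i\<in>S. [:- r i, 1:]) = 1"
proof -
  show deg: "degree (\<Prod>i\<in>S. [:- r i, 1:]) = card S"
    by (simp add: degree_prod_sum_eq assms)
  show "lead_coeff (\<Prod>i\<in>S. [:- r i, 1:]) = 1"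
    by (simp only: lead_coeff_prod) simp
qed

text \<open>In the permutation expansion the identity contributes a monic polynomial of degree n.
  Any other permutation meets an off-diagonal entry, which is constant, and so loses degree.\<close>

lemma charpoly_degree_monic:
  fixes A :: "int ^ 'n ^ 'n"
  shows "degree (charpoly A) = CARD('n)" "lead_coeff (charpoly A) = 1"
proof -
  define X where "X = mat [:0, 1:] - map_matrix (\<lambda>a. [:a:]) A"
  define D where "D = (\<Prod>i\<in>(UNIV::'n set). [:- (A $ i $ i), 1:])"
  define g where "g p = of_int (sign p) * (\<Prod>i\<in>UNIV. X $ i $ p i)" for p
  have Xii: "X $ i $ i = [:- (A $ i $ i), 1:]" for i
    by (simp add: X_def mat_def)
  have X_off: "X $ i $ j = [:- (A $ i $ j):]" if "i \<noteq> j" for i j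
    using that by (simp add: X_def mat_def)
  have gid: "g id = D" by (simp add: g_def D_def Xii sign_id)
  have D: "degree D = CARD('n)" "lead_coeff D = 1"
    unfolding D_def using monic_prod_linear[of "UNIV :: 'n set" "\<lambda>i. A $ i $ i"] by auto
  have small: "degree (g p) < CARD('n)" if p: "p permutes UNIV" "p \<noteq> id" for p
  proof -
    obtain i where i: "p i \<noteq> i" using p(2) by (auto simp: fun_eq_iff)
    have "degree (g p) \<le> degree (\<Prod>i\<in>UNIV. X $ i $ p i)"
      unfolding g_def by (cases "sign p = 1") (auto simp: sign_def)
    also have "\<dots> \<le> (\<Sum>i\<in>UNIV. degree (X $ i $ p i))"
      using degree_prod_sum_le[of "UNIV :: 'n set" "\<lambda>i. X $ i $ p i"] by (simp add: o_def)
    also have "\<dots> \<le> (\<Sum>j\<in>UNIV. if j = i then 0 else 1)"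
    proof (rule sum_mono)
      fix j show "degree (X $ j $ p j) \<le> (if j = i then 0 else 1)"
        using i by (cases "p j = j") (auto simp: Xii X_off)
    qed
    also have "\<dots> = card (UNIV - {i})"
      by (simp add: sum.If_cases Compl_eq_Diff_UNIV)
    also have "\<dots> < CARD('n)"
      by (simp add: card_Diff_singleton)
    finally show ?thesis .
  qed
  define E where "E = (\<Sum>p\<in>{p. p permutes (UNIV::'n set)} - {id}. g p)"
  have "charpoly A = (\<Sum>p\<in>{p. p permutes (UNIV::'n set)}. g p)"
    by (simp add: charpoly_def det_def g_def X_def)
  also have "\<dots> = g id + E"
    unfolding E_def by (rule sum.remove) (auto simp: finite_permutations permutes_id)
  finally have eq: "charpoly A = D + E" by (simp add: gid)
  have E: "degree E < degree D"
  proof (cases "{p. p permutes (UNIV::'n set)} - {id} = {}")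
    case True
    then show ?thesis unfolding E_def D(1) by (simp only: sum.empty) simp
  next
    case False
    have "degree E \<le> CARD('n) - 1" unfolding E_def
      by (rule degree_sum_le) (use small in \<open>fastforce simp: finite_permutations\<close>)+
    also have "\<dots> < CARD('n)" by simp
    finally show ?thesis using D by simp
  qed
  show "degree (charpoly A) = CARD('n)"
    unfolding eq using degree_add_eq_left[OF E] D by simp
  then show "lead_coeff (charpoly A) = 1"
    using D E by (simp add: eq coeff_eq_0)
qed

lemma coeff_0_charpoly:
  fixes A :: "int ^ 'n ^ 'n"
  shows "coeff (charpoly A) 0 = (- 1) ^ CARD('n) * det A"
proof -
  have [simp]: "map_poly (\<lambda>x. x) p = p" for p :: "int poly"
    by (simp add: map_poly_idI)
  have "coeff (charpoly A) 0 = det (- A)"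
    using poly_charpoly[of A "0::int"] by (simp add: poly_0_coeff_0 map_matrix_def)
  also have "\<dots> = (- 1) ^ CARD('n) * det A"
    by (simp add: det_def prod_uminus sum_distrib_left mult_ac)
  finally show ?thesis .
qed

lemma eigenvalue_charpoly_root:
  fixes B :: "int ^ 'm ^ 'm" and v :: "complex ^ 'm"
  assumes "v \<noteq> 0" "map_matrix of_int B *v v = x *s v"
  shows "poly (map_poly of_int (charpoly B)) x = 0"
proof -
  have "(mat x - map_matrix of_int B) *v v = 0"
    using assms(2)
    by (simp add: vec_eq_iff matrix_vector_mult_def mat_def left_diff_distrib sum_subtractf
        if_distrib[of "\<lambda>t. t * _"] cong: if_cong)
  hence "det (mat x - map_matrix of_int B :: complex ^ 'm ^ 'm) = 0"
    using assms(1) invertible_det_nz[of "mat x - map_matrix of_int B :: complex ^ 'm ^ 'm"]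
      matrix_left_invertible_ker[of "mat x - map_matrix of_int B :: complex ^ 'm ^ 'm"]
    unfolding invertible_def by blast
  thus ?thesis by (simp add: poly_charpoly)
qed

text \<open>The characteristic polynomial is a monic integer witness. The index type is left free
  because it is used both for \<open>'n\<close> and for the self-maps of \<open>'n\<close>.\<close>

lemma algebraic_int_eigenvalue:
  fixes B :: "int ^ 'm ^ 'm" and v :: "complex ^ 'm"
  assumes "v \<noteq> 0" "map_matrix of_int B *v v = x *s v"
  shows "algebraic_int x"
  unfolding algebraic_int_altdef_ipoly
  using eigenvalue_charpoly_root[OF assms] charpoly_degree_monic(2)[of B] by blast

text \<open>A nonzero \<open>q\<close> of smaller degree would be coprime to \<open>h\<close>, and a
  Bezout identity evaluated at the common root \<open>x\<close> would read 0 = 1.\<close>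

lemma irreducible_rat_root_degree:
  fixes h q :: "rat poly" and x :: "'b::field_char_0"
  assumes h: "Factorial_Ring.irreducible h" "poly (map_poly of_rat h) x = 0"
    and q: "poly (map_poly of_rat q) x = 0" "degree q < degree h"
  shows "q = 0"
proof (rule ccontr)
  assume "q \<noteq> 0"
  interpret unital_ring_hom "\<lambda>p. poly (map_poly (of_rat :: rat \<Rightarrow> 'b) p) x"
    by (rule unital_ring_hom.unital_ring_hom_poly[OF unital_ring_hom_of_rat])
  have "\<not> h dvd q" using q(2) \<open>q \<noteq> 0\<close> dvd_imp_degree_le[of h q] by linarith
  hence "coprime h q"
    using h(1) by (intro prime_elem_imp_coprime irreducible_imp_prime_elem)
  hence "fst (bezout_coefficients h q) * h + snd (bezout_coefficients h q) * q = 1"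
    by (simp add: bezout_coefficients_fst_snd)
  hence "poly (map_poly of_rat (fst (bezout_coefficients h q) * h + snd (bezout_coefficients h q) * q)) x
    = poly (map_poly of_rat 1) x" by simp
  thus False unfolding f_add f_mult using h(2) q(1) f_one by simp
qed

section \<open>Diagonalisation over the complex numbers\<close>

primrec matpow :: "'a::comm_ring_1 ^ 'n ^ 'n \<Rightarrow> nat \<Rightarrow> 'a ^ 'n ^ 'n" where
  "matpow M 0 = mat 1"
| "matpow M (Suc k) = M ** matpow M k"

lemma matpow_add: "matpow M (k + l) = matpow M k ** matpow M l"
  by (induction k) (simp_all add: matrix_mul_assoc)

lemma matpow_Suc_right: "matpow M (Suc k) = matpow M k ** M"
  using matpow_add[of M k 1] by simp

abbreviation (input) cmat :: "int ^ 'm ^ 'n \<Rightarrow> complex ^ 'm ^ 'n" where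
  "cmat \<equiv> map_matrix complex_of_int"

lemma cmat_mult: "cmat (B ** C) = cmat B ** cmat C"
  by (simp add: vec_eq_iff matrix_matrix_mult_def)

lemma cmat_mat_1: "cmat (mat 1) = mat 1"
  by (simp add: vec_eq_iff mat_def)

lemma poly_sum_lessThan:
  fixes p :: "'a::comm_semiring_1 poly"
  assumes "degree p < n"
  shows "poly p x = (\<Sum>k<n. coeff p k * x ^ k)"
  unfolding poly_altdef
  by (rule sum.mono_neutral_left) (use assms in \<open>auto simp: coeff_eq_0\<close>)

text \<open>A complex eigenbasis: the columns of \<open>P\<close> are eigenvectors of
  \<open>A\<close>, for pairwise distinct eigenvalues.\<close>

locale diagonalized =
  fixes A :: "int ^ 'n ^ 'n" and lm :: "'n \<Rightarrow> complex" and P W :: "complex ^ 'n ^ 'n"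
  assumes irred: "Factorial_Ring.irreducible (map_poly rat_of_int (charpoly A))"
    and lm_inj: "inj lm"
    and charpoly_prod: "map_poly of_int (charpoly A) = (\<Prod>i\<in>UNIV. [:- lm i, 1:])"
    and cmA_P: "cmat A ** P = P ** (\<chi> i j. if i = j then lm j else 0)"
    and PW: "P ** W = mat 1" and WP: "W ** P = mat 1"
begin

definition T :: "int ^ 'n ^ 'n \<Rightarrow> complex ^ 'n ^ 'n" where
  "T B = W ** cmat B ** P"

lemma T_mult: "T (B ** C) = T B ** T C"
proof -
  have "T B ** T C = W ** cmat B ** (P ** W) ** cmat C ** P"
    by (simp add: T_def matrix_mul_assoc)
  thus ?thesis by (simp add: PW T_def cmat_mult matrix_mul_assoc)
qed

lemma T_A: "T A = (\<chi> i j. if i = j then lm j else 0)"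
proof -
  have "T A = (W ** P) ** (\<chi> i j. if i = j then lm j else 0)"
    by (simp only: T_def matrix_mul_assoc[symmetric] cmA_P)
  thus ?thesis by (simp add: WP)
qed

lemma T_matpow: "T (matpow A k) = (\<chi> i j. if i = j then lm j ^ k else 0)"
proof (induction k)
  case 0
  then show ?case by (simp add: T_def cmat_mat_1 WP) (simp add: mat_def vec_eq_iff)
next
  case (Suc k)
  then show ?case
    by (simp only: matpow.simps T_mult T_A)
      (simp add: vec_eq_iff matrix_matrix_mult_def if_distrib[of "\<lambda>t. t * _"] cong: if_cong)
qed

text \<open>Powers of \<open>A\<close> on either side only rescale the entries of
  \<open>T B\<close>. Polynomials in \<open>A\<close> therefore act on the entry at
  \<open>i\<close>, \<open>j\<close> as polynomials in \<open>lm i\<close> and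
  \<open>lm j\<close>.\<close>

lemma T_sandwich: "T (matpow A k ** B ** matpow A l) $ i $ j = lm i ^ k * T B $ i $ j * lm j ^ l"
proof -
  have "T (matpow A k ** B) $ i $ j = lm i ^ k * T B $ i $ j" for j
    by (simp only: T_mult T_matpow)
      (simp add: matrix_matrix_mult_def if_distrib[of "\<lambda>t. t * _"] cong: if_cong)
  hence "(\<Sum>x\<in>UNIV. T (matpow A k ** B) $ i $ x * T (matpow A l) $ x $ j) = lm i ^ k * T B $ i $ j * lm j ^ l"
    by (simp add: T_matpow if_distrib[of "\<lambda>t. _ * t"] cong: if_cong)
  thus ?thesis
    unfolding T_mult[of _ "matpow A l"] by (simp add: matrix_matrix_mult_def[of "T _"])
qed

lemma cmat_eq: "cmat B = P ** T B ** W"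
proof -
  have "P ** T B ** W = (P ** W) ** cmat B ** (P ** W)"
    by (simp add: T_def matrix_mul_assoc)
  thus ?thesis by (simp add: PW)
qed

lemma cmat_entry: "of_int (B $ a $ b) = (\<Sum>x\<in>UNIV. \<Sum>y\<in>UNIV. P $ a $ x * T B $ x $ y * W $ y $ b)"
proof -
  have "of_int (B $ a $ b) = cmat B $ a $ b" by simp
  also have "\<dots> = (\<Sum>y\<in>UNIV. \<Sum>x\<in>UNIV. P $ a $ x * T B $ x $ y * W $ y $ b)"
    unfolding cmat_eq by (simp add: matrix_matrix_mult_def sum_distrib_right)
  also have "\<dots> = (\<Sum>x\<in>UNIV. \<Sum>y\<in>UNIV. P $ a $ x * T B $ x $ y * W $ y $ b)"
    by (rule sum.swap)
  finally show ?thesis .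
qed

lemma T_entry: "T B $ i $ j = (\<Sum>b\<in>UNIV. \<Sum>a\<in>UNIV. W $ i $ a * of_int (B $ a $ b) * P $ b $ j)"
  by (simp add: T_def matrix_matrix_mult_def sum_distrib_right)

text \<open>Together with \<open>linear_relation_T\<close> this translates between integer entries,
  where relations descend to the rationals, and entries in the eigenbasis, where zero patterns are
  visible.\<close>

lemma T_linear_relation:
  assumes "\<And>a b. (\<Sum>e\<in>I. q e * of_int (B e $ a $ b)) = 0"
  shows "(\<Sum>e\<in>I. q e * T (B e) $ i $ j) = 0"
proof -
  have "(\<Sum>e\<in>I. q e * T (B e) $ i $ j) =
     (\<Sum>e\<in>I. \<Sum>b\<in>UNIV. \<Sum>a\<in>UNIV. W $ i $ a * (q e * of_int (B e $ a $ b)) * P $ b $ j)"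
    by (simp add: T_entry sum_distrib_left mult_ac)
  also have "\<dots> = (\<Sum>b\<in>UNIV. \<Sum>a\<in>UNIV. \<Sum>e\<in>I. W $ i $ a * (q e * of_int (B e $ a $ b)) * P $ b $ j)"
    by (subst sum.swap, rule sum.cong[OF refl], rule sum.swap)
  also have "\<dots> = (\<Sum>b\<in>UNIV. \<Sum>a\<in>UNIV. W $ i $ a * (\<Sum>e\<in>I. q e * of_int (B e $ a $ b)) * P $ b $ j)"
    by (simp add: sum_distrib_left sum_distrib_right)
  also have "\<dots> = 0" by (simp add: assms)
  finally show ?thesis .
qed

lemma linear_relation_T:
  assumes "\<And>i j. (\<Sum>e\<in>I. q e * T (B e) $ i $ j) = 0"
  shows "(\<Sum>e\<in>I. q e * of_int (B e $ a $ b)) = 0"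
proof -
  have "(\<Sum>e\<in>I. q e * of_int (B e $ a $ b)) =
     (\<Sum>e\<in>I. \<Sum>x\<in>UNIV. \<Sum>y\<in>UNIV. P $ a $ x * (q e * T (B e) $ x $ y) * W $ y $ b)"
    by (simp add: cmat_entry sum_distrib_left mult_ac)
  also have "\<dots> = (\<Sum>x\<in>UNIV. \<Sum>y\<in>UNIV. \<Sum>e\<in>I. P $ a $ x * (q e * T (B e) $ x $ y) * W $ y $ b)"
    by (subst sum.swap, rule sum.cong[OF refl], rule sum.swap)
  also have "\<dots> = (\<Sum>x\<in>UNIV. \<Sum>y\<in>UNIV. P $ a $ x * (\<Sum>e\<in>I. q e * T (B e) $ x $ y) * W $ y $ b)"
    by (simp add: sum_distrib_left sum_distrib_right)
  also have "\<dots> = 0" by (simp add: assms)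
  finally show ?thesis .
qed

lemma charpoly_root: "poly (map_poly of_int (charpoly A)) (lm i) = 0"
  unfolding charpoly_prod by (auto simp: poly_prod)

text \<open>The \<open>q k\<close> are the coefficients of a polynomial of degree below n that
  vanishes at a root of an irreducible polynomial of degree n.\<close>

lemma rat_poly_root:
  fixes q :: "nat \<Rightarrow> rat"
  assumes "(\<Sum>k<CARD('n). of_rat (q k) * lm i ^ k) = 0" "k < CARD('n)"
  shows "q k = 0"
proof -
  define p where "p = (\<Sum>k<CARD('n). monom (q k) k)"
  have cp: "coeff p k = (if k < CARD('n) then q k else 0)" for k
    by (simp add: p_def coeff_sum)
  have deg: "degree p < CARD('n)"
    by (rule le_less_trans[OF degree_le[of "CARD('n) - 1"]]) (auto simp: cp)
  have h: "map_poly of_rat (map_poly rat_of_int (charpoly A)) = map_poly complex_of_int (charpoly A)"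
    by (rule poly_eqI) (simp add: coeff_map_poly)
  have dh: "degree (map_poly rat_of_int (charpoly A)) = CARD('n)"
    by (subst degree_map_poly) (simp_all add: charpoly_degree_monic)
  have "p = 0"
  proof (rule irreducible_rat_root_degree[OF irred])
    show "poly (map_poly of_rat (map_poly rat_of_int (charpoly A))) (lm i) = 0"
      by (simp add: h charpoly_root)
    have "degree (map_poly of_rat p :: complex poly) < CARD('n)"
      using deg by (simp add: degree_map_poly)
    thus "poly (map_poly of_rat p) (lm i) = 0"
      using assms(1) by (simp add: poly_sum_lessThan coeff_map_poly cp)
    show "degree p < degree (map_poly rat_of_int (charpoly A))" using deg dh by simp
  qed
  thus ?thesis using cp[of k] assms(2) by simp
qed

text \<open>The Lagrange polynomial of \<open>lm i\<close>, left unnormalised: its leading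
  coefficient 1 is a coordinate that stays nonzero when a relation descends to \<rat>.\<close>

definition ell :: "'n \<Rightarrow> complex poly" where
  "ell i = (\<Prod>x\<in>UNIV - {i}. [:- lm x, 1:])"

lemma degree_ell: "degree (ell i) = CARD('n) - 1" "coeff (ell i) (CARD('n) - 1) = 1"
  using monic_prod_linear[of "UNIV - {i}" lm] by (simp_all add: ell_def card_Diff_singleton)

lemma degree_ell_less: "degree (ell i) < CARD('n)"
  by (simp add: degree_ell)

lemma poly_ell_eq_0_iff: "poly (ell i) (lm j) = 0 \<longleftrightarrow> j \<noteq> i"
  using lm_inj by (auto simp: ell_def poly_prod inj_def)

lemma ell_sum: "(\<Sum>k<CARD('n). coeff (ell i) k * lm x ^ k) = (if x = i then poly (ell i) (lm i) else 0)"
  using poly_sum_lessThan[OF degree_ell_less, of i "lm x"] poly_ell_eq_0_iff[of i x] by auto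

text \<open>Since the eigenvalues are distinct, the coordinates \<open>W *v u\<close> vanish off
  \<open>i0\<close>, so \<open>u\<close> is a multiple of one column of \<open>P\<close>.\<close>

lemma eigenvector_eq:
  assumes "cmat A *v u = lm i0 *s u"
  shows "u $ a = P $ a $ i0 * (W *v u) $ i0"
proof -
  have PWu: "P *v (W *v u) = u" by (simp add: matrix_vector_mul_assoc PW)
  have "T A *v (W *v u) = W *v (cmat A *v ((P ** W) *v u))"
    by (simp add: T_def matrix_vector_mul_assoc matrix_mul_assoc)
  also have "\<dots> = W *v (lm i0 *s u)" by (simp only: PW matrix_vector_mul_lid assms)
  also have "\<dots> = lm i0 *s (W *v u)"
    by (simp add: vec_eq_iff matrix_vector_mult_def sum_distrib_left mult_ac)
  finally have "(T A *v (W *v u)) $ x = lm i0 * (W *v u) $ x" for x by simp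
  hence "lm x * (W *v u) $ x = lm i0 * (W *v u) $ x" for x
    by (simp add: T_A matrix_vector_mult_def[of "\<chi> i j. _ i j"] if_distrib[of "\<lambda>t. t * _"] cong: if_cong)
  hence 0: "(W *v u) $ x = 0" if "x \<noteq> i0" for x
    using that lm_inj by (metis injD mult_cancel_right)
  have "u $ a = (\<Sum>x\<in>UNIV. P $ a $ x * (W *v u) $ x)"
    using PWu by (simp add: matrix_vector_mult_def[of P] vec_eq_iff)
  also have "\<dots> = (\<Sum>x\<in>{i0}. P $ a $ x * (W *v u) $ x)"
    by (rule sum.mono_neutral_right) (auto simp: 0)
  finally show ?thesis by simp
qed

text \<open>If \<open>c\<close> annihilates \<open>u\<close>, then \<open>c\<close> times the polynomial \<open>ell i0\<close> in \<open>A\<close> vanishes; by descent so does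
  \<open>c\<close> times a nonzero rational polynomial in \<open>A\<close> of degree below \<open>n\<close>, which is invertible.\<close>

lemma eigenvector_independent:
  fixes c :: "'n \<Rightarrow> int"
  assumes u: "u \<noteq> 0" "cmat A *v u = lm i0 *s u" and c: "(\<Sum>a\<in>UNIV. of_int (c a) * u $ a) = 0"
  shows "c a = 0"
proof -
  define n where "n = CARD('n)"
  \<comment> \<open>\<open>y\<close> is the row \<open>c\<close> in eigenbasis coordinates; by
    \<open>eigenvector_eq\<close> the assumption on \<open>c\<close> becomes
    \<open>y i0 = 0\<close>.\<close>
  define y where "y x = (\<Sum>a\<in>UNIV. of_int (c a) * P $ a $ x)" for x
  obtain a0 where "u $ a0 \<noteq> 0" using u(1) by (auto simp: vec_eq_iff)
  hence w: "(W *v u) $ i0 \<noteq> 0" using eigenvector_eq[OF u(2), of a0] by auto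
  have "(\<Sum>a\<in>UNIV. of_int (c a) * u $ a) = (\<Sum>a\<in>UNIV. of_int (c a) * (P $ a $ i0 * (W *v u) $ i0))"
    by (rule sum.cong[OF refl]) (subst eigenvector_eq[OF u(2)], rule refl)
  also have "\<dots> = y i0 * (W *v u) $ i0"
    by (simp add: y_def sum_distrib_left sum_distrib_right mult_ac)
  finally have y0: "y i0 = 0" using w c by simp
  have cA: "complex_of_int (\<Sum>a\<in>UNIV. c a * matpow A k $ a $ b) = (\<Sum>x\<in>UNIV. y x * lm x ^ k * W $ x $ b)" for k b
  proof -
    have "complex_of_int (\<Sum>a\<in>UNIV. c a * matpow A k $ a $ b) =
       (\<Sum>a\<in>UNIV. \<Sum>x\<in>UNIV. of_int (c a) * (P $ a $ x * lm x ^ k * W $ x $ b))"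
      by (simp add: cmat_entry T_matpow if_distrib[of "\<lambda>t. _ * t"] if_distrib[of "\<lambda>t. t * _"] sum_distrib_left cong: if_cong)
    also have "\<dots> = (\<Sum>x\<in>UNIV. \<Sum>a\<in>UNIV. of_int (c a) * (P $ a $ x * lm x ^ k * W $ x $ b))"
      by (rule sum.swap)
    finally show ?thesis by (simp add: y_def sum_distrib_left sum_distrib_right mult_ac)
  qed
  \<comment> \<open>One equation per column \<open>b\<close>: a solution \<open>q\<close> makes the
    row \<open>c\<close> times the sum of \<open>q k\<close> A^k vanish. The coefficients of
    \<open>ell i0\<close> solve the system, as this polynomial kills every eigenvalue but
    \<open>lm i0\<close>, where \<open>y\<close> is zero.\<close>
  define EQ where "EQ = range (\<lambda>b k. \<Sum>a\<in>UNIV. c a * matpow A k $ a $ b)"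
  obtain q :: "nat \<Rightarrow> rat" where q: "q (n - 1) \<noteq> 0"
    and qe: "\<And>d. d \<in> EQ \<Longrightarrow> (\<Sum>k<n. of_int (d k) * q k) = 0"
  proof (rule rational_solution[where p = "coeff (ell i0)" and ?i0.0 = "n - 1" and I = "{..<n}" and EQ = EQ])
    show "coeff (ell i0) (n - 1) \<noteq> 0" using degree_ell(2)[of i0] by (simp add: n_def)
    fix d assume "d \<in> EQ"
    then obtain b where d: "d = (\<lambda>k. \<Sum>a\<in>UNIV. c a * matpow A k $ a $ b)" by (auto simp: EQ_def)
    have "(\<Sum>k<n. of_int (d k) * coeff (ell i0) k)
       = (\<Sum>k<n. \<Sum>x\<in>UNIV. y x * W $ x $ b * (coeff (ell i0) k * lm x ^ k))"
      by (simp add: d cA sum_distrib_left sum_distrib_right mult_ac del: of_int_sum)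
    also have "\<dots> = (\<Sum>x\<in>UNIV. \<Sum>k<n. y x * W $ x $ b * (coeff (ell i0) k * lm x ^ k))"
      by (rule sum.swap)
    also have "\<dots> = (\<Sum>x\<in>UNIV. y x * W $ x $ b * (if x = i0 then poly (ell i0) (lm i0) else 0))"
      by (simp only: sum_distrib_left[symmetric] n_def ell_sum)
    also have "\<dots> = 0" using y0 by (intro sum.neutral) auto
    finally show "(\<Sum>k<n. of_int (d k) * coeff (ell i0) k) = 0" .
  qed (use that in blast)
  have y_zero: "y x = 0" for x
  proof -
    have P1: "(\<Sum>b\<in>UNIV. (\<Sum>z\<in>UNIV. y z * lm z ^ k * W $ z $ b) * P $ b $ x) = y x * lm x ^ k" for k
    proof -
      have "(\<Sum>b\<in>UNIV. (\<Sum>z\<in>UNIV. y z * lm z ^ k * W $ z $ b) * P $ b $ x)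
         = (\<Sum>b\<in>UNIV. \<Sum>z\<in>UNIV. y z * lm z ^ k * (W $ z $ b * P $ b $ x))"
        by (simp add: sum_distrib_left sum_distrib_right mult_ac)
      also have "\<dots> = (\<Sum>z\<in>UNIV. \<Sum>b\<in>UNIV. y z * lm z ^ k * (W $ z $ b * P $ b $ x))"
        by (rule sum.swap)
      also have "\<dots> = (\<Sum>z\<in>UNIV. y z * lm z ^ k * (W ** P) $ z $ x)"
        by (simp add: matrix_matrix_mult_def sum_distrib_left)
      finally show ?thesis by (simp add: WP mat_def if_distrib[of "\<lambda>t. _ * t"] cong: if_cong)
    qed
    have e: "(\<Sum>k<n. complex_of_int (\<Sum>a\<in>UNIV. c a * matpow A k $ a $ b) * of_rat (q k)) = 0" for b
    proof -
      have "(\<Sum>k<n. of_int (\<Sum>a\<in>UNIV. c a * matpow A k $ a $ b) * q k) = 0"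
        by (rule qe) (simp add: EQ_def)
      hence "of_rat (\<Sum>k<n. of_int (\<Sum>a\<in>UNIV. c a * matpow A k $ a $ b) * q k) = (0::complex)"
        by simp
      thus ?thesis by (simp only: of_rat_sum of_rat_mult of_rat_of_int_eq)
    qed
    have "0 = (\<Sum>b\<in>UNIV. (\<Sum>k<n. complex_of_int (\<Sum>a\<in>UNIV. c a * matpow A k $ a $ b) * of_rat (q k)) * P $ b $ x)"
      by (simp only: e) simp
    also have "\<dots> = (\<Sum>b\<in>UNIV. \<Sum>k<n. of_rat (q k) * ((\<Sum>z\<in>UNIV. y z * lm z ^ k * W $ z $ b) * P $ b $ x))"
      unfolding cA by (simp add: sum_distrib_left sum_distrib_right mult_ac)
    also have "\<dots> = (\<Sum>k<n. \<Sum>b\<in>UNIV. of_rat (q k) * ((\<Sum>z\<in>UNIV. y z * lm z ^ k * W $ z $ b) * P $ b $ x))"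
      by (rule sum.swap)
    also have "\<dots> = (\<Sum>k<n. of_rat (q k) * (y x * lm x ^ k))"
      by (simp only: sum_distrib_left[symmetric] P1)
    also have "\<dots> = y x * (\<Sum>k<n. of_rat (q k) * lm x ^ k)"
      by (simp add: sum_distrib_left mult_ac)
    finally have "y x = 0 \<or> (\<Sum>k<n. of_rat (q k) * lm x ^ k) = 0" by auto
    moreover have "(\<Sum>k<n. of_rat (q k) * lm x ^ k) \<noteq> 0"
      using rat_poly_root[of q x "n - 1"] q by (auto simp: n_def)
    ultimately show ?thesis by simp
  qed
  have "complex_of_int (c a) = complex_of_int (\<Sum>b\<in>UNIV. c b * matpow A 0 $ b $ a)"
    by (simp add: mat_def if_distrib[of "\<lambda>t. _ * t"] cong: if_cong)
  also have "\<dots> = 0" unfolding cA by (simp add: y_zero)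
  finally show ?thesis by simp
qed

end

text \<open>An irreducible rational polynomial is separable, so there are n distinct eigenvalues,
  and eigenvectors for distinct eigenvalues are linearly independent.\<close>

lemma diagonalized_exists:
  fixes A :: "int ^ 'n ^ 'n"
  assumes irred: "Factorial_Ring.irreducible (map_poly rat_of_int (charpoly A))"
  obtains lm P W where "diagonalized A lm P W"
proof -
  define h where "h = map_poly complex_of_int (charpoly A)"
  define hr where "hr = map_poly rat_of_int (charpoly A)"
  have h: "h = map_poly of_rat hr"
    unfolding h_def hr_def by (rule poly_eqI) (simp add: coeff_map_poly)
  have dh: "degree h = CARD('n)" "degree hr = CARD('n)"
    unfolding h_def hr_def by (subst degree_map_poly; simp add: charpoly_degree_monic)+
  have lc: "lead_coeff h = 1"
    using charpoly_degree_monic[of A] dh by (simp add: h_def coeff_map_poly)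
  have "rsquarefree h"
  proof (unfold rsquarefree_roots, intro allI notI, elim conjE)
    fix x assume x: "poly h x = 0" "poly (pderiv h) x = 0"
    have pd: "map_poly of_rat (pderiv hr) = pderiv h"
      unfolding h by (rule poly_eqI) (simp add: coeff_map_poly coeff_pderiv of_rat_mult del: of_nat_Suc)
    \<comment> \<open>A double root is shared with the derivative, whose degree is smaller, so the
      derivative has to vanish.\<close>
    have "pderiv hr = 0"
      by (rule irreducible_rat_root_degree[of hr x])
        (use x irred dh in \<open>auto simp: pd h[symmetric] hr_def[symmetric] degree_pderiv\<close>)
    hence "degree hr = 0" by (simp add: pderiv_eq_0_iff)
    thus False using dh by simp
  qed
  hence decomp: "(\<Prod>z | poly h z = 0. [:- z, 1:]) = h"
    using complex_poly_decompose_rsquarefree[of h] lc by simp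
  have "h \<noteq> 0" using dh by auto
  hence fin: "finite {z. poly h z = 0}" by (rule poly_roots_finite)
  have "card {z. poly h z = 0} = CARD('n)"
    using monic_prod_linear(1)[OF fin, of "\<lambda>x. x"] decomp dh by simp
  then obtain lm where lm: "bij_betw lm (UNIV :: 'n set) {z. poly h z = 0}"
    using finite_same_card_bij[OF finite fin, of "UNIV :: 'n set"] by auto
  hence inj: "inj lm" by (simp add: bij_betw_def)
  have hp: "h = (\<Prod>i\<in>UNIV. [:- lm i, 1:])"
    using prod.reindex_bij_betw[OF lm, of "\<lambda>z. [:- z, 1:]"] decomp by simp
  have "\<exists>v. v \<noteq> 0 \<and> cmat A *v v = lm i *s v" for i
  proof -
    have "det (mat (lm i) - cmat A) = 0"
      using poly_charpoly[of A "lm i"] bij_betwE[OF lm] by (auto simp: h_def)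
    hence "\<not> invertible (mat (lm i) - cmat A)" by (simp add: invertible_det_nz)
    then obtain v where "(mat (lm i) - cmat A) *v v = 0" "v \<noteq> 0"
      using invertible_left_inverse[of "mat (lm i) - cmat A"] matrix_left_invertible_ker[of "mat (lm i) - cmat A"] by auto
    thus ?thesis
      by (intro exI[of _ v]) (simp add: vec_eq_iff matrix_vector_mult_def mat_def left_diff_distrib sum_subtractf
        if_distrib[of "\<lambda>t. t * _"] cong: if_cong)
  qed
  then obtain v where v: "\<And>i. v i \<noteq> 0" "\<And>i. cmat A *v v i = lm i *s v i" by metis
  define P where "P = (\<chi> a i. v i $ a)"
  have cmP: "cmat A ** P = P ** (\<chi> i j. if i = j then lm j else 0)"
    using v(2) by (simp add: P_def vec_eq_iff matrix_matrix_mult_def matrix_vector_mult_def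
        if_distrib[of "\<lambda>t. _ * t"] mult_ac cong: if_cong)
  have "\<exists>W. W ** P = mat 1"
  proof (unfold matrix_left_invertible_ker, intro allI impI)
    fix x assume x: "P *v x = 0"
    \<comment> \<open>Applying \<open>A\<close> repeatedly to the relation \<open>P *v x = 0\<close>
      yields one relation for each power; the Lagrange polynomial \<open>q\<close> below combines
      them into one for the coordinate \<open>j\<close> alone.\<close>
    have pow: "(\<Sum>i\<in>UNIV. P $ a $ i * lm i ^ k * x $ i) = 0" for k a
    proof (induction k arbitrary: a)
      case 0
      then show ?case using x by (simp add: matrix_vector_mult_def vec_eq_iff)
    next
      case (Suc k)
      have Av: "(\<Sum>b\<in>UNIV. of_int (A $ a $ b) * P $ b $ i) = lm i * P $ a $ i" for i
        using v(2)[of i] by (simp add: P_def vec_eq_iff matrix_vector_mult_def)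
      have "(\<Sum>i\<in>UNIV. P $ a $ i * lm i ^ Suc k * x $ i)
        = (\<Sum>i\<in>UNIV. (\<Sum>b\<in>UNIV. of_int (A $ a $ b) * P $ b $ i) * lm i ^ k * x $ i)"
        unfolding Av by (simp add: mult_ac)
      also have "\<dots> = (\<Sum>i\<in>UNIV. \<Sum>b\<in>UNIV. of_int (A $ a $ b) * (P $ b $ i * lm i ^ k * x $ i))"
        by (simp add: sum_distrib_left sum_distrib_right mult_ac)
      also have "\<dots> = (\<Sum>b\<in>UNIV. of_int (A $ a $ b) * (\<Sum>i\<in>UNIV. P $ b $ i * lm i ^ k * x $ i))"
        by (subst sum.swap) (simp add: sum_distrib_left)
      finally show ?case by (simp add: Suc)
    qed
    show "x = 0"
    proof (subst vec_eq_iff, intro allI)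
      fix j
      obtain a where a: "P $ a $ j \<noteq> 0" using v(1)[of j] by (auto simp: P_def vec_eq_iff)
      define q where "q = (\<Prod>i\<in>UNIV - {j}. [:- lm i, 1:])"
      have q: "poly q (lm i) = 0 \<longleftrightarrow> i \<noteq> j" for i
        using inj by (auto simp: q_def poly_prod inj_def)
      have "0 = (\<Sum>k\<le>degree q. coeff q k * (\<Sum>i\<in>UNIV. P $ a $ i * lm i ^ k * x $ i))"
        by (simp add: pow)
      also have "\<dots> = (\<Sum>k\<le>degree q. \<Sum>i\<in>UNIV. P $ a $ i * x $ i * (coeff q k * lm i ^ k))"
        by (simp add: sum_distrib_left mult_ac)
      also have "\<dots> = (\<Sum>i\<in>UNIV. P $ a $ i * x $ i * poly q (lm i))"
        by (subst sum.swap) (simp add: sum_distrib_left poly_altdef)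
      also have "\<dots> = (\<Sum>i\<in>{j}. P $ a $ i * x $ i * poly q (lm i))"
        by (rule sum.mono_neutral_right) (auto simp: q)
      finally show "x $ j = 0 $ j" using a q[of j] by simp
    qed
  qed
  then obtain W where W: "W ** P = mat 1" by blast
  hence "P ** W = mat 1" using matrix_left_right_inverse by blast
  with W irred inj hp cmP have "diagonalized A lm P W"
    by unfold_locales (auto simp: h_def)
  thus thesis by (rule that)
qed

section \<open>Endomorphisms of the lattice union and prime ideals\<close>

text \<open>Zorn's lemma gives an ideal maximal among those that contain \<open>p\<close> and not 1.
  The ring is a subset of the type because it will be a ring of algebraic integers inside
  \<complex>.\<close>

lemma exists_prime_ideal:
  fixes R :: "'a::comm_ring_1 set"
  assumes R1: "1 \<in> R" and Radd: "\<And>a b. a \<in> R \<Longrightarrow> b \<in> R \<Longrightarrow> a + b \<in> R"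
    and Rmult: "\<And>a b. a \<in> R \<Longrightarrow> b \<in> R \<Longrightarrow> a * b \<in> R"
    and Rminus: "\<And>a. a \<in> R \<Longrightarrow> - a \<in> R"
    and p: "p \<in> R" "\<And>y. y \<in> R \<Longrightarrow> p * y \<noteq> 1"
  obtains I where "I \<subseteq> R" "p \<in> I" "1 \<notin> I" "\<And>a b. a \<in> I \<Longrightarrow> b \<in> I \<Longrightarrow> a + b \<in> I"
    "\<And>a r. a \<in> I \<Longrightarrow> r \<in> R \<Longrightarrow> a * r \<in> I"
    "\<And>a b. a \<in> R \<Longrightarrow> b \<in> R \<Longrightarrow> a * b \<in> I \<Longrightarrow> a \<in> I \<or> b \<in> I"
proof -
  define ideal where "ideal I \<longleftrightarrow> I \<subseteq> R \<and> (\<forall>a\<in>I. \<forall>b\<in>I. a + b \<in> I) \<and> (\<forall>a\<in>I. \<forall>r\<in>R. a * r \<in> I)" for I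
  define F where "F = {I. ideal I \<and> p \<in> I \<and> 1 \<notin> I}"
  have "(\<lambda>r. p * r) ` R \<in> F"
  proof -
    have "ideal ((\<lambda>r. p * r) ` R)"
      unfolding ideal_def using p Radd Rmult
      by (auto simp: image_iff distrib_left[symmetric] mult.assoc)
    moreover have "p \<in> (\<lambda>r. p * r) ` R" using R1 by (force simp: image_iff)
    ultimately show ?thesis using p(2) by (auto simp: F_def)
  qed
  hence "F \<noteq> {}" by blast
  have "\<exists>M\<in>F. \<forall>X\<in>F. M \<subseteq> X \<longrightarrow> X = M"
  proof (rule subset_Zorn_nonempty[OF \<open>F \<noteq> {}\<close>])
    fix C assume C: "C \<noteq> {}" "subset.chain F C"
    have sub: "\<And>X. X \<in> C \<Longrightarrow> ideal X \<and> p \<in> X \<and> 1 \<notin> X"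
      using C(2) by (auto simp: subset_chain_def F_def)
    have tot: "X \<subseteq> Y \<or> Y \<subseteq> X" if "X \<in> C" "Y \<in> C" for X Y
      using C(2) that by (auto simp: subset_chain_def)
    have "a + b \<in> \<Union> C" if ab: "a \<in> \<Union> C" "b \<in> \<Union> C" for a b
    proof -
      obtain X Y where XY: "X \<in> C" "Y \<in> C" "a \<in> X" "b \<in> Y" using ab by blast
      then obtain Z where Z: "Z \<in> C" "a \<in> Z" "b \<in> Z" using tot[OF XY(1,2)] by blast
      thus ?thesis using sub[OF Z(1)] unfolding ideal_def by blast
    qed
    moreover have "a * r \<in> \<Union> C" if "a \<in> \<Union> C" "r \<in> R" for a r
      using that sub unfolding ideal_def by blast
    moreover have "\<Union> C \<subseteq> R" using sub unfolding ideal_def by blast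
    ultimately have "ideal (\<Union> C)" unfolding ideal_def by blast
    thus "\<Union> C \<in> F" using sub C(1) unfolding F_def by blast
  qed
  then obtain M where M: "M \<in> F" and max: "\<And>X. X \<in> F \<Longrightarrow> M \<subseteq> X \<Longrightarrow> X = M" by blast
  have MR: "M \<subseteq> R" "p \<in> M" "1 \<notin> M" and Madd: "\<And>a b. a \<in> M \<Longrightarrow> b \<in> M \<Longrightarrow> a + b \<in> M"
    and Mmult: "\<And>a r. a \<in> M \<Longrightarrow> r \<in> R \<Longrightarrow> a * r \<in> M"
    using M by (auto simp: F_def ideal_def)
  \<comment> \<open>By maximality, the ideal generated by \<open>M\<close> and an element outside it
    contains 1.\<close>
  have key: "\<exists>m\<in>M. \<exists>r\<in>R. m + a * r = 1" if a: "a \<in> R" "a \<notin> M" for a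
  proof (rule ccontr)
    assume neg: "\<not> ?thesis"
    define N where "N = {m + a * r | m r. m \<in> M \<and> r \<in> R}"
    have R0: "0 \<in> R" using Radd[OF R1 Rminus[OF R1]] by simp
    have M0: "0 \<in> M" using Mmult[OF MR(2) R0] by simp
    have NR: "N \<subseteq> R" unfolding N_def using MR(1) Radd Rmult a(1) by blast
    have "ideal N" unfolding ideal_def
    proof (intro conjI ballI NR)
      fix x y assume "x \<in> N" "y \<in> N"
      then obtain m r m' r' where "x = m + a * r" "y = m' + a * r'" "m \<in> M" "m' \<in> M" "r \<in> R" "r' \<in> R"
        unfolding N_def by blast
      moreover from this have "x + y = (m + m') + a * (r + r')" by (simp add: algebra_simps)
      ultimately show "x + y \<in> N" unfolding N_def using Madd Radd by blast
    next
      fix x s assume "x \<in> N" "s \<in> R"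
      then obtain m r where "x = m + a * r" "m \<in> M" "r \<in> R" unfolding N_def by blast
      moreover from this have "x * s = m * s + a * (r * s)" by (simp add: algebra_simps)
      ultimately show "x * s \<in> N" unfolding N_def using Mmult Rmult \<open>s \<in> R\<close> by blast
    qed
    moreover have MN: "M \<subseteq> N" unfolding N_def using R0 by force
    moreover have "1 \<notin> N" unfolding N_def using neg by clarsimp
    ultimately have "N \<in> F" using MR(2) by (auto simp: F_def)
    hence "N = M" using max MN by blast
    moreover have "a \<in> N" unfolding N_def using M0 R1 by force
    ultimately show False using a(2) by blast
  qed
  show thesis
  proof (rule that[OF MR Madd Mmult])
    fix a b assume ab: "a \<in> R" "b \<in> R" "a * b \<in> M"
    show "a \<in> M \<or> b \<in> M"
    proof (rule ccontr)
      assume neg: "\<not> (a \<in> M \<or> b \<in> M)"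
      then obtain m r where m: "m \<in> M" "r \<in> R" "m + a * r = 1" using key[of a] ab(1) by blast
      have "b = m * b + (a * b) * r"
        using m(3) by (metis distrib_right mult.assoc mult.commute mult.left_neutral)
      also have "\<dots> \<in> M" using m(1,2) ab(2,3) Madd Mmult by blast
      finally show False using neg by blast
    qed
  qed
qed

section \<open>A ring of algebraic integers containing the eigenvalues\<close>

context diagonalized
begin

text \<open>The tensor product of the columns of \<open>P\<close>: a common eigenvector of integer matrices with
  eigenvalues \<open>lm k\<close>, so that its eigenvalues form a ring of algebraic integers containing every \<open>lm k\<close>.\<close>

definition tensor_vec :: "complex ^ ('n \<Rightarrow> 'n)" where
  "tensor_vec = (\<chi> e. \<Prod>k\<in>UNIV. P $ e k $ k)"

definition integral_ring :: "complex set" where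
  "integral_ring = {s. \<exists>B :: int ^ ('n \<Rightarrow> 'n) ^ ('n \<Rightarrow> 'n). cmat B *v tensor_vec = s *s tensor_vec}"

lemma P_column_nz: "\<exists>a. P $ a $ i \<noteq> 0"
proof (rule ccontr)
  assume "\<not> ?thesis"
  hence "(W ** P) $ i $ i = 0" by (simp add: matrix_matrix_mult_def)
  thus False by (simp add: WP mat_def)
qed

lemma W_row_nz: "\<exists>b. W $ j $ b \<noteq> 0"
proof (rule ccontr)
  assume "\<not> ?thesis"
  hence "(W ** P) $ j $ j = 0" by (simp add: matrix_matrix_mult_def)
  thus False by (simp add: WP mat_def)
qed

lemma tensor_vec_nz: "tensor_vec \<noteq> 0"
proof -
  obtain e where "\<And>i. P $ e i $ i \<noteq> 0" using P_column_nz by metis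
  hence "tensor_vec $ e \<noteq> 0" by (simp add: tensor_vec_def)
  thus ?thesis by auto
qed

lemma integral_ring_algebraic_int: "s \<in> integral_ring \<Longrightarrow> algebraic_int s"
  unfolding integral_ring_def using algebraic_int_eigenvalue[OF tensor_vec_nz] by blast

lemma integral_ring_of_int: "of_int k \<in> integral_ring"
proof -
  have "cmat (mat k) *v tensor_vec = of_int k *s tensor_vec"
    by (simp add: vec_eq_iff matrix_vector_mult_def mat_def if_distrib[of "\<lambda>t. t * _"] if_distrib[of of_int] cong: if_cong)
  thus ?thesis unfolding integral_ring_def by blast
qed

lemma integral_ring_0: "0 \<in> integral_ring" and integral_ring_1: "1 \<in> integral_ring"
  using integral_ring_of_int[of 0] integral_ring_of_int[of 1] by auto

lemma integral_ring_add: assumes "s \<in> integral_ring" "t \<in> integral_ring" shows "s + t \<in> integral_ring"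
proof -
  obtain B C where BC: "cmat B *v tensor_vec = s *s tensor_vec" "cmat C *v tensor_vec = t *s tensor_vec"
    using assms unfolding integral_ring_def by blast
  have "cmat (B + C) = cmat B + cmat C" by (simp add: vec_eq_iff)
  hence "cmat (B + C) *v tensor_vec = (s + t) *s tensor_vec"
    using BC by (simp only: matrix_vector_mult_add_rdistrib vec.scale_left_distrib)
  thus ?thesis unfolding integral_ring_def by blast
qed

lemma integral_ring_mult: assumes "s \<in> integral_ring" "t \<in> integral_ring" shows "s * t \<in> integral_ring"
proof -
  obtain B C where BC: "cmat B *v tensor_vec = s *s tensor_vec" "cmat C *v tensor_vec = t *s tensor_vec"
    using assms unfolding integral_ring_def by blast
  have "cmat (B ** C) *v tensor_vec = cmat B *v (t *s tensor_vec)"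
    by (simp only: cmat_mult matrix_vector_mul_assoc[symmetric] BC)
  also have "\<dots> = t *s (cmat B *v tensor_vec)"
    by (simp add: vec_eq_iff matrix_vector_mult_def sum_distrib_left mult_ac)
  also have "\<dots> = (s * t) *s tensor_vec"
    by (simp add: BC vec_eq_iff mult_ac)
  finally show ?thesis unfolding integral_ring_def by blast
qed

lemma integral_ring_minus: "s \<in> integral_ring \<Longrightarrow> - s \<in> integral_ring"
  using integral_ring_mult[OF integral_ring_of_int[of "-1"], of s] by simp

lemma integral_ring_sum: "(\<And>x. x \<in> X \<Longrightarrow> g x \<in> integral_ring) \<Longrightarrow> sum g X \<in> integral_ring"
  by (induction X rule: infinite_finite_induct) (auto intro: integral_ring_add integral_ring_0)

lemma integral_ring_power: "s \<in> integral_ring \<Longrightarrow> s ^ k \<in> integral_ring"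
  by (induction k) (auto intro: integral_ring_mult integral_ring_1)

lemma A_column: "(\<Sum>b\<in>UNIV. of_int (A $ a $ b) * P $ b $ k) = lm k * P $ a $ k"
proof -
  have "(cmat A ** P) $ a $ k = (P ** (\<chi> i j. if i = j then lm j else 0)) $ a $ k"
    by (simp only: cmA_P)
  thus ?thesis
    by (simp add: matrix_matrix_mult_def if_distrib[of "\<lambda>t. _ * t"] mult_ac cong: if_cong)
qed

text \<open>The witness is \<open>A\<close> acting on the \<open>k\<close>-th tensor factor and the
  identity on the others, so its entries vanish unless the two multi-indices agree off
  \<open>k\<close>.\<close>

lemma integral_ring_lm: "lm k \<in> integral_ring"
proof -
  define B :: "int ^ ('n \<Rightarrow> 'n) ^ ('n \<Rightarrow> 'n)" where
    "B = (\<chi> e e'. if e' = e(k := e' k) then A $ e k $ e' k else 0)"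
  have "(cmat B *v tensor_vec) $ e = (lm k *s tensor_vec) $ e" for e
  proof -
    have tv: "tensor_vec $ (e(k := j)) = P $ j $ k * (\<Prod>l\<in>UNIV - {k}. P $ e l $ l)" for j
      unfolding tensor_vec_def by (simp add: prod.remove[of UNIV k])
    have rng: "{e'. e' = e(k := e' k)} = range (\<lambda>j. e(k := j))"
    proof (intro Set.set_eqI iffI)
      fix e' assume "e' \<in> {e'. e' = e(k := e' k)}"
      hence "e' = e(k := e' k)" by simp
      thus "e' \<in> range (\<lambda>j. e(k := j))" by (rule range_eqI)
    qed auto
    have "(cmat B *v tensor_vec) $ e =
      (\<Sum>e'\<in>UNIV. if e' = e(k := e' k) then of_int (A $ e k $ e' k) * tensor_vec $ e' else 0)"
      by (simp add: matrix_vector_mult_def B_def if_distrib[of "\<lambda>t. t * _"] if_distrib[of of_int] cong: if_cong)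
    also have "\<dots> = (\<Sum>e'\<in>range (\<lambda>j. e(k := j)). of_int (A $ e k $ e' k) * tensor_vec $ e')"
      by (subst sum.inter_filter[symmetric]) (simp_all add: rng)
    also have "\<dots> = (\<Sum>j\<in>UNIV. of_int (A $ e k $ j) * tensor_vec $ (e(k := j)))"
      by (subst sum.reindex) (auto intro!: injI dest: fun_upd_eqD)
    also have "\<dots> = (\<Sum>j\<in>UNIV. of_int (A $ e k $ j) * P $ j $ k) * (\<Prod>l\<in>UNIV - {k}. P $ e l $ l)"
      by (simp add: tv sum_distrib_right mult.assoc)
    also have "\<dots> = lm k * tensor_vec $ (e(k := e k))"
      by (simp only: A_column tv mult.assoc)
    finally show ?thesis by simp
  qed
  hence "cmat B *v tensor_vec = lm k *s tensor_vec" by (subst vec_eq_iff) blast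
  thus ?thesis unfolding integral_ring_def by blast
qed

lemma integral_ring_int_poly: "s \<in> integral_ring \<Longrightarrow> poly (map_poly of_int g) s \<in> integral_ring"
  by (induction g) (auto simp: map_poly_pCons intro: integral_ring_add integral_ring_mult integral_ring_of_int integral_ring_0)

text \<open>A nonzero integer polynomial vanishing at \<open>s\<close> can be divided by the
  variable until its constant term is nonzero; the relation then exhibits that constant as a
  multiple of \<open>s\<close>.\<close>

lemma integral_ring_divides_int:
  assumes "s \<in> integral_ring" "s \<noteq> 0"
  obtains N r where "N \<noteq> 0" "r \<in> integral_ring" "s * r = of_int N"
proof -
  have "\<exists>N r. N \<noteq> 0 \<and> r \<in> integral_ring \<and> s * r = of_int N"
    if "g \<noteq> 0" "poly (map_poly of_int g) s = 0" for g
    using that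
  proof (induction g)
    case (pCons c g)
    show ?case
    proof (cases "c = 0")
      case True
      then show ?thesis using pCons assms by (auto simp: map_poly_pCons)
    next
      case False
      have "s * poly (map_poly of_int g) s = of_int (- c)"
        using pCons(4) by (simp add: map_poly_pCons add_eq_0_iff)
      thus ?thesis using False integral_ring_int_poly[OF assms(1), of g] by (metis neg_equal_0_iff_equal)
    qed
  qed auto
  moreover obtain g :: "int poly" where "poly (map_poly of_int g) s = 0" "lead_coeff g = 1"
    using integral_ring_algebraic_int[OF assms(1)] unfolding algebraic_int_altdef_ipoly by blast
  ultimately show thesis using that by (metis leading_coeff_0_iff zero_neq_one)
qed

lemma integral_ring_prod_linear_coeff: "coeff (\<Prod>i\<in>X. [:- lm i, 1:]) k \<in> integral_ring"
proof (induction X arbitrary: k rule: infinite_finite_induct)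
  case (insert x X)
  have "coeff (\<Prod>i\<in>insert x X. [:- lm i, 1:]) k
    = - lm x * coeff (\<Prod>i\<in>X. [:- lm i, 1:]) k + (case k of 0 \<Rightarrow> 0 | Suc j \<Rightarrow> coeff (\<Prod>i\<in>X. [:- lm i, 1:]) j)"
    using insert by (simp add: coeff_pCons)
  also have "\<dots> \<in> integral_ring"
    by (intro integral_ring_add integral_ring_mult integral_ring_minus integral_ring_lm insert) (auto split: nat.split intro: integral_ring_0 insert)
  finally show ?case .
qed (auto simp: integral_ring_0 integral_ring_1 coeff_1)

end

section \<open>Eigenvalues in a prime ideal above p\<close>

locale diagonalized_prime = diagonalized A lm P W
  for A :: "int ^ 'n ^ 'n" and lm :: "'n \<Rightarrow> complex" and P W :: "complex ^ 'n ^ 'n" +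
  fixes p :: nat and I :: "complex set"
  assumes p_prime: "Factorial_Ring.prime p"
    and I_sub: "I \<subseteq> integral_ring" and I_p: "of_nat p \<in> I" and I_1: "1 \<notin> I"
    and I_add: "\<And>a b. a \<in> I \<Longrightarrow> b \<in> I \<Longrightarrow> a + b \<in> I"
    and I_mult: "\<And>a r. a \<in> I \<Longrightarrow> r \<in> integral_ring \<Longrightarrow> a * r \<in> I"
    and I_prime: "\<And>a b. a \<in> integral_ring \<Longrightarrow> b \<in> integral_ring \<Longrightarrow> a * b \<in> I \<Longrightarrow> a \<in> I \<or> b \<in> I"
begin

lemma I_0: "0 \<in> I"
  using I_mult[OF I_p integral_ring_0] by simp

lemma I_sum: "(\<And>x. x \<in> X \<Longrightarrow> g x \<in> I) \<Longrightarrow> sum g X \<in> I"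
  by (induction X rule: infinite_finite_induct) (auto intro: I_add I_0)

lemma I_minus: "a \<in> I \<Longrightarrow> - a \<in> I"
  using I_mult[OF _ integral_ring_of_int[of "-1"], of a] by simp

lemma I_power: "a \<in> integral_ring \<Longrightarrow> a ^ k \<in> I \<Longrightarrow> a \<in> I"
  by (induction k) (use I_1 I_prime integral_ring_power in auto)

text \<open>By Bezout, an integer prime to \<open>p\<close> in \<open>I\<close> would put 1 into
  \<open>I\<close>.\<close>

lemma of_int_in_I_iff: "of_int k \<in> I \<longleftrightarrow> int p dvd k"
proof
  assume k: "of_int k \<in> I"
  show "int p dvd k"
  proof (rule ccontr)
    assume "\<not> int p dvd k"
    hence "coprime (int p) k" using p_prime by (simp add: prime_imp_coprime)
    then obtain a b where ab: "a * int p + b * k = 1" using bezout_int[of "int p" k] by auto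
    have "of_int (a * int p + b * k) = of_nat p * of_int a + of_int k * (of_int b :: complex)"
      by simp
    also have "\<dots> \<in> I" by (intro I_add I_mult I_p k integral_ring_of_int)
    finally show False using I_1 ab by simp
  qed
next
  assume "int p dvd k"
  then obtain m where "k = int p * m" by auto
  thus "of_int k \<in> I" using I_mult[OF I_p integral_ring_of_int[of m]] by simp
qed

definition prime_roots :: "'n set" where "prime_roots = {i. lm i \<in> I}"

lemma prod_in_I: "(\<Prod>i\<in>X. - lm i) \<in> I \<Longrightarrow> finite X \<Longrightarrow> \<exists>i\<in>X. lm i \<in> I"
proof (induction X rule: infinite_finite_induct)
  case (insert x X)
  have "(\<Prod>i\<in>X. - lm i) = poly (\<Prod>i\<in>X. [:- lm i, 1:]) 0" by (simp add: poly_prod)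
  hence "(\<Prod>i\<in>X. - lm i) \<in> integral_ring" using integral_ring_prod_linear_coeff[of X 0] by (simp add: poly_0_coeff_0)
  thus ?case using insert I_prime[of "- lm x" "\<Prod>i\<in>X. - lm i"] integral_ring_minus[OF integral_ring_lm] I_minus by fastforce
qed (use I_1 in auto)

lemma prod_linear_low_coeff:
  "X \<subseteq> prime_roots \<Longrightarrow> k < card X \<Longrightarrow> coeff (\<Prod>i\<in>X. [:- lm i, 1:]) k \<in> I"
proof (induction X arbitrary: k rule: infinite_finite_induct)
  case (insert x X)
  have "- lm x * coeff (\<Prod>i\<in>X. [:- lm i, 1:]) k \<in> I"
    using insert by (intro I_mult I_minus integral_ring_prod_linear_coeff) (auto simp: prime_roots_def)
  moreover have "(case k of 0 \<Rightarrow> 0 | Suc j \<Rightarrow> coeff (\<Prod>i\<in>X. [:- lm i, 1:]) j) \<in> I"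
    using insert by (auto split: nat.split intro: I_0)
  ultimately have "- lm x * coeff (\<Prod>i\<in>X. [:- lm i, 1:]) k + (case k of 0 \<Rightarrow> 0 | Suc j \<Rightarrow> coeff (\<Prod>i\<in>X. [:- lm i, 1:]) j) \<in> I"
    by (rule I_add)
  thus ?case using insert by (simp add: coeff_pCons)
qed auto

text \<open>Split the characteristic polynomial as \<open>F * G\<close>, with the roots of
  \<open>F\<close> in \<open>I\<close> and those of \<open>G\<close> outside. Modulo
  \<open>I\<close>, \<open>F\<close> is a pure power of the variable and the constant term of
  \<open>G\<close> is nonzero.\<close>

lemma charpoly_coeff_prime_roots:
  "k < card prime_roots \<Longrightarrow> int p dvd coeff (charpoly A) k"
  "\<not> int p dvd coeff (charpoly A) (card prime_roots)"
proof -
  define F where "F = (\<Prod>i\<in>prime_roots. [:- lm i, 1:])"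
  define G where "G = (\<Prod>i\<in>- prime_roots. [:- lm i, 1:])"
  have "map_poly complex_of_int (charpoly A) = F * G"
    unfolding charpoly_prod F_def G_def
    by (subst prod.union_disjoint[symmetric]) auto
  hence co: "of_int (coeff (charpoly A) k) = (\<Sum>i\<le>k. coeff F i * coeff G (k - i))" for k
    by (metis coeff_map_poly coeff_mult of_int_0)
  have G: "coeff G k \<in> integral_ring" for k unfolding G_def by (rule integral_ring_prod_linear_coeff)
  have F: "coeff F k \<in> I" if "k < card prime_roots" for k
    unfolding F_def by (rule prod_linear_low_coeff) (use that in auto)
  show "int p dvd coeff (charpoly A) k" if "k < card prime_roots" for k
  proof -
    have "of_int (coeff (charpoly A) k) \<in> I"
      unfolding co by (intro I_sum I_mult F G) (use that in auto)
    thus ?thesis by (simp add: of_int_in_I_iff)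
  qed
  have lF: "coeff F (card prime_roots) = 1"
    using monic_prod_linear[of prime_roots lm] by (simp add: F_def)
  show "\<not> int p dvd coeff (charpoly A) (card prime_roots)"
  proof
    assume "int p dvd coeff (charpoly A) (card prime_roots)"
    hence a: "of_int (coeff (charpoly A) (card prime_roots)) \<in> I" by (simp add: of_int_in_I_iff)
    have b: "(\<Sum>i<card prime_roots. coeff F i * coeff G (card prime_roots - i)) \<in> I"
      by (intro I_sum I_mult F G) auto
    \<comment> \<open>\<open>F\<close> is monic of degree \<open>card prime_roots\<close> with lower
      coefficients in \<open>I\<close>, so this coefficient is congruent to the constant term of
      \<open>G\<close>.\<close>
    have "of_int (coeff (charpoly A) (card prime_roots)) = (\<Sum>i<card prime_roots. coeff F i * coeff G (card prime_roots - i)) + coeff G 0"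
      unfolding co by (simp add: lessThan_Suc_atMost[symmetric] lF)
    hence "coeff G 0 = of_int (coeff (charpoly A) (card prime_roots)) + - (\<Sum>i<card prime_roots. coeff F i * coeff G (card prime_roots - i))"
      by simp
    also have "\<dots> \<in> I" by (intro I_add I_minus a b)
    finally have "(\<Prod>i\<in>- prime_roots. - lm i) \<in> I"
      by (simp add: G_def poly_0_coeff_0[symmetric] poly_prod)
    from prod_in_I[OF this] show False by (auto simp: prime_roots_def)
  qed
qed

text \<open>Divisibility of the coefficients by \<open>p\<close> pins down the exponent:
  \<open>poly_shift\<close> supplies the cofactor, and the first coefficient prime to
  \<open>p\<close> rules out larger powers.\<close>

lemma zero_mult_eq: "zero_mult A p = card prime_roots"
  unfolding zero_mult_def
proof (rule Greatest_equality)
  have "poly_cong p (charpoly A) (monom 1 (card prime_roots) * poly_shift (card prime_roots) (charpoly A))"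
    unfolding poly_cong_def coeff_monom_mult coeff_poly_shift
    using charpoly_coeff_prime_roots(1) by (auto simp: cong_0_iff)
  thus "\<exists>g. poly_cong p (charpoly A) (monom 1 (card prime_roots) * g)" by blast
next
  fix y assume "\<exists>g. poly_cong p (charpoly A) (monom 1 y * g)"
  then obtain g where g: "poly_cong p (charpoly A) (monom 1 y * g)" by blast
  show "y \<le> card prime_roots"
  proof (rule ccontr)
    assume "\<not> ?thesis"
    hence "[coeff (charpoly A) (card prime_roots) = 0] (mod int p)"
      using g[unfolded poly_cong_def, rule_format, of "card prime_roots"] by (simp add: coeff_monom_mult)
    thus False using charpoly_coeff_prime_roots(2) by (simp add: cong_0_iff)
  qed
qed

text \<open>This replaces valuations at \<open>I\<close>. In the characteristic polynomial evaluated
  at \<open>lm i\<close>, the terms below index \<open>card prime_roots\<close> are divisible by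
  \<open>p\<close>, and the remaining ones form the power of \<open>lm i\<close> times
  \<open>g\<close>.\<close>

lemma lm_power_divisible:
  assumes "i \<in> prime_roots"
  obtains g w where "g \<in> integral_ring" "g \<notin> I" "w \<in> integral_ring" "lm i ^ card prime_roots * g = of_nat p * w"
proof -
  define s where "s = card prime_roots"
  define h where "h = charpoly A"
  define hs where "hs = poly_shift s h"
  define g where "g = poly (map_poly complex_of_int hs) (lm i)"
  have "\<exists>w. \<forall>k<s. coeff h k = int p * w k"
    using charpoly_coeff_prime_roots(1) unfolding s_def h_def dvd_def by metis
  then obtain w where w: "\<And>k. k < s \<Longrightarrow> coeff h k = int p * w k" by blast
  define w' where "w' = - (\<Sum>k<s. of_int (w k) * lm i ^ k)"
  have w': "w' \<in> integral_ring" unfolding w'_def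
    by (intro integral_ring_minus integral_ring_sum integral_ring_mult integral_ring_of_int integral_ring_power integral_ring_lm)
  have gO: "g \<in> integral_ring" unfolding g_def by (rule integral_ring_int_poly[OF integral_ring_lm])
  \<comment> \<open>Modulo \<open>lm i\<close>, which lies in \<open>I\<close>, the value
    \<open>g\<close> reduces to the coefficient of index \<open>card prime_roots\<close>, which is
    prime to \<open>p\<close>.\<close>
  have gI: "g \<notin> I"
  proof
    assume "g \<in> I"
    obtain c hs' where hs': "hs = pCons c hs'" by (cases hs)
    have c: "c = coeff h s" using arg_cong[OF hs', of "\<lambda>q. coeff q 0"] by (simp add: hs_def coeff_poly_shift)
    have "of_int c = g + - (lm i * poly (map_poly complex_of_int hs') (lm i))"
      by (simp add: g_def hs' map_poly_pCons)
    also have "\<dots> \<in> I"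
      using assms \<open>g \<in> I\<close> integral_ring_int_poly[OF integral_ring_lm] by (intro I_add I_minus I_mult) (auto simp: prime_roots_def)
    finally show False using charpoly_coeff_prime_roots(2) by (simp add: of_int_in_I_iff c h_def s_def)
  qed
  have hsum: "h = monom 1 s * hs + (\<Sum>k<s. monom (coeff h k) k)"
    by (rule poly_eqI) (simp add: coeff_monom_mult hs_def coeff_poly_shift coeff_sum)
  interpret ev: unital_ring_hom "\<lambda>q. poly (map_poly complex_of_int q) (lm i)"
    by (rule unital_ring_hom.unital_ring_hom_poly[OF unital_ring_hom_of_int])
  have mono: "poly (map_poly complex_of_int (monom c k)) (lm i) = of_int c * lm i ^ k" for c k
    by (simp add: map_poly_monom poly_monom)
  have "0 = poly (map_poly complex_of_int (monom 1 s * hs + (\<Sum>k<s. monom (coeff h k) k))) (lm i)"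
    unfolding hsum[symmetric] using charpoly_root[of i] by (simp add: h_def)
  also have "\<dots> = lm i ^ s * g + (\<Sum>k<s. of_int (coeff h k) * lm i ^ k)"
    by (simp only: ev.f_add ev.f_mult ev.f_sum mono g_def) simp
  also have "(\<Sum>k<s. of_int (coeff h k) * lm i ^ k) = (\<Sum>k<s. of_nat p * (of_int (w k) * lm i ^ k))"
    by (rule sum.cong) (auto simp: w mult_ac)
  also have "\<dots> = - (of_nat p * w')" by (simp add: w'_def sum_distrib_left)
  finally have "lm i ^ s * g = of_nat p * w'" by simp
  thus thesis using that gO gI w' by (auto simp: s_def)
qed

end

section \<open>Stable matrices and the successor relation on eigenvalues\<close>

context diagonalized
begin

text \<open>These are the matrices that are continuous for the topology on \<int>^n in which the
  lattices A^k \<int>^n form a neighbourhood base at 0.\<close>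

definition stable_mats :: "(int ^ 'n ^ 'n) set" where
  "stable_mats = {B. \<forall>k. \<exists>m B'. B ** matpow A m = matpow A k ** B'}"

lemma stable_mats_mult:
  assumes "B \<in> stable_mats" "C \<in> stable_mats"
  shows "B ** C \<in> stable_mats"
  unfolding stable_mats_def
proof (intro CollectI allI)
  fix k
  obtain m B' where B: "B ** matpow A m = matpow A k ** B'" using assms(1) unfolding stable_mats_def by blast
  obtain l C' where C: "C ** matpow A l = matpow A m ** C'" using assms(2) unfolding stable_mats_def by blast
  have "B ** C ** matpow A l = (B ** matpow A m) ** C'"
    by (simp only: matrix_mul_assoc[symmetric] C)
  also have "\<dots> = matpow A k ** (B' ** C')" by (simp only: B matrix_mul_assoc)
  finally show "\<exists>m B''. B ** C ** matpow A m = matpow A k ** B''" by blast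
qed

lemma matpow_commute: "matpow A m ** matpow A k = matpow A k ** matpow A m"
  by (simp only: matpow_add[symmetric] add.commute)

lemma stable_mats_matpow: "matpow A m \<in> stable_mats"
  unfolding stable_mats_def using matpow_commute by blast

definition succs :: "'n \<Rightarrow> 'n set" where
  "succs i = {j. \<exists>B\<in>stable_mats. T B $ i $ j \<noteq> 0}"

lemma succs_refl: "i \<in> succs i"
proof -
  have "T (matpow A 0) $ i $ i \<noteq> 0" by (simp only: T_matpow) simp
  thus ?thesis unfolding succs_def using stable_mats_matpow by blast
qed

text \<open>The entry of \<open>B ** C\<close> at \<open>i\<close>, \<open>j\<close> could vanish by
  cancellation. Inserting powers of \<open>A\<close> between the factors weights the summand at
  \<open>x\<close> by \<open>lm x ^ m\<close>, and the coefficients of \<open>ell k\<close> single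
  out the summand at \<open>k\<close>.\<close>

lemma succs_trans:
  assumes "k \<in> succs i" "j \<in> succs k"
  shows "j \<in> succs i"
proof (rule ccontr)
  assume neg: "j \<notin> succs i"
  obtain B C where BC: "B \<in> stable_mats" "T B $ i $ k \<noteq> 0" "C \<in> stable_mats" "T C $ k $ j \<noteq> 0"
    using assms unfolding succs_def by blast
  have z: "(\<Sum>x\<in>UNIV. T B $ i $ x * lm x ^ m * T C $ x $ j) = 0" for m
  proof -
    \<comment> \<open>The factor \<open>matpow A 0\<close> brings the product into the form of
      \<open>T_sandwich\<close>.\<close>
    have "B ** (matpow A m ** C ** matpow A 0) \<in> stable_mats" by (intro stable_mats_mult stable_mats_matpow BC)
    hence "T (B ** (matpow A m ** C ** matpow A 0)) $ i $ j = 0"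
      using neg unfolding succs_def by blast
    also have "T (B ** (matpow A m ** C ** matpow A 0)) $ i $ j =
      (\<Sum>x\<in>UNIV. T B $ i $ x * (T (matpow A m ** C ** matpow A 0) $ x $ j))"
      by (simp only: T_mult[of B]) (simp add: matrix_matrix_mult_def[of "T _"])
    finally show ?thesis by (simp only: T_sandwich) (simp add: mult_ac)
  qed
  have "0 = (\<Sum>m<CARD('n). coeff (ell k) m * (\<Sum>x\<in>UNIV. T B $ i $ x * lm x ^ m * T C $ x $ j))"
    by (simp only: z) simp
  also have "\<dots> = (\<Sum>m<CARD('n). \<Sum>x\<in>UNIV. T B $ i $ x * T C $ x $ j * (coeff (ell k) m * lm x ^ m))"
    by (simp add: sum_distrib_left mult_ac)
  also have "\<dots> = (\<Sum>x\<in>UNIV. \<Sum>m<CARD('n). T B $ i $ x * T C $ x $ j * (coeff (ell k) m * lm x ^ m))"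
    by (rule sum.swap)
  also have "\<dots> = (\<Sum>x\<in>UNIV. T B $ i $ x * T C $ x $ j * (if x = k then poly (ell k) (lm k) else 0))"
    by (simp only: sum_distrib_left[symmetric] ell_sum)
  also have "\<dots> = T B $ i $ k * T C $ k $ j * poly (ell k) (lm k)"
    by (simp add: if_distrib[of "\<lambda>t. _ * t"] cong: if_cong)
  finally show False using BC poly_ell_eq_0_iff[of k k] by simp
qed

text \<open>A polynomial in \<open>x\<close> and \<open>y\<close> that vanishes at all \<open>(lm i, lm j)\<close> with \<open>j \<in> succs i\<close> and has degree
  \<open>card (succs i0)\<close> in \<open>y\<close> can be descended to \<open>\<rat>\<close>, and irreducibility of the characteristic polynomial
  keeps it nonzero after substituting any \<open>lm i\<close> for \<open>x\<close>.\<close>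

lemma card_succs_le: "card (succs i) \<le> card (succs i0)"
proof -
  define n where "n = CARD('n)"
  define q where "q = (\<Prod>j\<in>succs i0. [:- lm j, 1:])"
  define r where "r = card (succs i0)"
  have dq: "degree q = r" "coeff q r = 1"
    using monic_prod_linear[of "succs i0" lm] by (auto simp: q_def r_def)
  define J where "J = {..<n} \<times> {..r}"
  \<comment> \<open>The unknown at \<open>(a, k)\<close> is the coefficient of x^a y^k; the
    equations say that the matrices A^a B A^k, combined with these coefficients, sum to zero for
    every stable B. The product of \<open>ell i0\<close> in x and \<open>q\<close> in y is a
    solution: it is nonzero at an eigenvalue pair only if i is \<open>i0\<close> and j lies outside
    \<open>succs i0\<close>, and there the entry of \<open>T B\<close> vanishes.\<close>
  define EQ where "EQ = {\<lambda>(a, k). (matpow A a ** B ** matpow A k) $ c $ d | B c d. B \<in> stable_mats}"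
  obtain f :: "nat \<times> nat \<Rightarrow> rat" where f: "f (n - 1, r) \<noteq> 0"
    and fe: "\<And>d. d \<in> EQ \<Longrightarrow> (\<Sum>e\<in>J. of_int (d e) * f e) = 0"
  proof (rule rational_solution[where p = "\<lambda>(a, k). coeff (ell i0) a * coeff q k"
        and ?i0.0 = "(n - 1, r)" and I = J and EQ = EQ])
    show "(case (n - 1, r) of (a, k) \<Rightarrow> coeff (ell i0) a * coeff q k) \<noteq> 0"
      using degree_ell(2)[of i0] dq by (simp add: n_def)
    fix d assume "d \<in> EQ"
    then obtain B x y where d: "d = (\<lambda>(a, k). (matpow A a ** B ** matpow A k) $ x $ y)" and B: "B \<in> stable_mats"
      by (auto simp: EQ_def)
    have "(\<Sum>e\<in>J. (case e of (a, k) \<Rightarrow> coeff (ell i0) a * coeff q k)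
        * of_int ((case e of (a, k) \<Rightarrow> matpow A a ** B ** matpow A k) $ x $ y)) = 0"
    proof (rule linear_relation_T)
      fix i j
      have "(\<Sum>e\<in>J. (case e of (a, k) \<Rightarrow> coeff (ell i0) a * coeff q k)
          * T (case e of (a, k) \<Rightarrow> matpow A a ** B ** matpow A k) $ i $ j)
        = (\<Sum>a<n. \<Sum>k\<le>r. (coeff (ell i0) a * lm i ^ a) * ((coeff q k * lm j ^ k) * T B $ i $ j))"
        unfolding J_def sum.cartesian_product
        by (rule sum.cong[OF refl]) (clarsimp simp: T_sandwich mult_ac)
      also have "\<dots> = (\<Sum>a<n. coeff (ell i0) a * lm i ^ a) * ((\<Sum>k\<le>r. coeff q k * lm j ^ k) * T B $ i $ j)"
        by (simp only: sum_distrib_left[symmetric] sum_distrib_right[symmetric])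
      also have "(\<Sum>k\<le>r. coeff q k * lm j ^ k) = poly q (lm j)" by (simp add: poly_altdef dq)
      also have "(\<Sum>a<n. coeff (ell i0) a * lm i ^ a) * (poly q (lm j) * T B $ i $ j) = 0"
      proof (cases "i = i0")
        case True
        show ?thesis
        proof (cases "j \<in> succs i0")
          case True
          hence "poly q (lm j) = 0" by (auto simp: q_def poly_prod)
          thus ?thesis by simp
        next
          case False
          hence "T B $ i $ j = 0" using B True unfolding succs_def by blast
          thus ?thesis by simp
        qed
      qed (simp add: ell_sum n_def)
      finally show "(\<Sum>e\<in>J. (case e of (a, k) \<Rightarrow> coeff (ell i0) a * coeff q k)
          * T (case e of (a, k) \<Rightarrow> matpow A a ** B ** matpow A k) $ i $ j) = 0" .
    qed
    thus "(\<Sum>e\<in>J. of_int (d e) * (case e of (a, k) \<Rightarrow> coeff (ell i0) a * coeff q k)) = 0"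
      by (simp add: d case_prod_unfold mult_ac)
  qed (use that in blast)
  \<comment> \<open>\<open>Q\<close> is the descended polynomial at x = \<open>lm i\<close>. Its
    coefficient at \<open>r\<close> is the value at \<open>lm i\<close> of a nonzero rational
    polynomial of degree below n, hence nonzero.\<close>
  define Q where "Q = (\<Sum>k\<le>r. monom (\<Sum>a<n. of_rat (f (a, k)) * lm i ^ a) k)"
  have cQ: "coeff Q k = (if k \<le> r then \<Sum>a<n. of_rat (f (a, k)) * lm i ^ a else 0)" for k
    by (simp add: Q_def coeff_sum)
  have "coeff Q r \<noteq> 0"
    using rat_poly_root[of "\<lambda>a. f (a, r)" i "n - 1"] f by (auto simp: cQ n_def)
  hence "Q \<noteq> 0" by auto
  have dQ: "degree Q \<le> r" by (rule degree_le) (simp add: cQ)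
  have "poly Q (lm j) = 0" if "j \<in> succs i" for j
  proof -
    obtain B where B: "B \<in> stable_mats" "T B $ i $ j \<noteq> 0" using \<open>j \<in> succs i\<close> unfolding succs_def by blast
    have "(\<Sum>e\<in>J. of_rat (f e) * T (case e of (a, k) \<Rightarrow> matpow A a ** B ** matpow A k) $ i $ j) = 0"
    proof (rule T_linear_relation)
      fix x y
      have "(\<lambda>(a, k). (matpow A a ** B ** matpow A k) $ x $ y) \<in> EQ" using B(1) by (auto simp: EQ_def)
      from fe[OF this] have "of_rat (\<Sum>e\<in>J. of_int (case e of (a, k) \<Rightarrow> (matpow A a ** B ** matpow A k) $ x $ y) * f e) = (0::complex)"
        by simp
      thus "(\<Sum>e\<in>J. of_rat (f e) * complex_of_int ((case e of (a, k) \<Rightarrow> matpow A a ** B ** matpow A k) $ x $ y)) = 0"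
        by (simp add: of_rat_sum of_rat_mult case_prod_unfold mult_ac)
    qed
    also have "(\<Sum>e\<in>J. of_rat (f e) * T (case e of (a, k) \<Rightarrow> matpow A a ** B ** matpow A k) $ i $ j)
      = (\<Sum>a<n. \<Sum>k\<le>r. of_rat (f (a, k)) * (lm i ^ a * T B $ i $ j * lm j ^ k))"
      unfolding J_def sum.cartesian_product
      by (rule sum.cong[OF refl]) (clarsimp simp: T_sandwich)
    also have "\<dots> = (\<Sum>k\<le>r. \<Sum>a<n. of_rat (f (a, k)) * (lm i ^ a * T B $ i $ j * lm j ^ k))"
      by (rule sum.swap)
    also have "\<dots> = (\<Sum>k\<le>r. coeff Q k * lm j ^ k) * T B $ i $ j"
      by (simp add: cQ sum_distrib_left sum_distrib_right mult_ac)
    also have "(\<Sum>k\<le>r. coeff Q k * lm j ^ k) = poly Q (lm j)"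
      using dQ poly_sum_lessThan[of Q "Suc r" "lm j"] by (simp add: lessThan_Suc_atMost)
    finally show ?thesis using B(2) by simp
  qed
  hence "lm ` succs i \<subseteq> {x. poly Q x = 0}" by auto
  hence "card (lm ` succs i) \<le> card {x. poly Q x = 0}"
    by (intro card_mono poly_roots_finite \<open>Q \<noteq> 0\<close>)
  also have "\<dots> \<le> degree Q" by (rule card_poly_roots_bound[OF \<open>Q \<noteq> 0\<close>])
  also have "\<dots> \<le> r" by (rule dQ)
  finally show ?thesis
    by (simp add: r_def card_image inj_on_subset[OF lm_inj])
qed

text \<open>All successor sets have the same size, so the inclusion given by transitivity is an
  equality, and the successor sets partition any closed set \<open>X\<close>.\<close>

lemma card_succs_dvd:
  assumes X: "\<And>i. i \<in> X \<Longrightarrow> succs i \<subseteq> X"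
  shows "card (succs i0) dvd card X"
proof -
  have c: "card (succs i) = card (succs i0)" for i
    using card_succs_le[of i i0] card_succs_le[of i0 i] by simp
  have eq: "succs j = succs i" if "j \<in> succs i" for i j
  proof (rule card_subset_eq)
    show "succs j \<subseteq> succs i" using succs_trans[OF that] by blast
    show "card (succs j) = card (succs i)" by (rule trans[OF c c[symmetric]])
  qed simp
  have "card (succs i0) * card (succs ` X) = card (\<Union> (succs ` X))"
  proof (rule card_partition)
    fix a b assume "a \<in> succs ` X" "b \<in> succs ` X" "a \<noteq> b"
    thus "a \<inter> b = {}" using eq by blast
  next
    fix a assume "a \<in> succs ` X"
    thus "card a = card (succs i0)" using c by blast
  qed simp_all
  moreover have "\<Union> (succs ` X) = X" using X succs_refl by blast
  ultimately show ?thesis by (metis dvd_triv_left)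
qed

end

context diagonalized_prime
begin

text \<open>Stability gives a fixed nonzero integer \<open>N\<close> such that, for every k,
  \<open>N\<close> times some power of \<open>lm j\<close> is a multiple of \<open>lm i ^ k\<close>.
  For large k this forces \<open>lm j\<close> into \<open>I\<close> along with
  \<open>lm i\<close>.\<close>

lemma prime_roots_closed:
  assumes i: "i \<in> prime_roots" and j: "j \<in> succs i"
  shows "j \<in> prime_roots"
proof -
  define n where "n = CARD('n)"
  obtain B where B: "B \<in> stable_mats" "T B $ i $ j \<noteq> 0" using j unfolding succs_def by blast
  obtain a b where ab: "P $ a $ i \<noteq> 0" "W $ j $ b \<noteq> 0" using P_column_nz W_row_nz by metis
  \<comment> \<open>Lagrange polynomials in \<open>A\<close> on both sides of \<open>C\<close>
    isolate the entry of \<open>T C\<close> at \<open>i\<close>, \<open>j\<close>. So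
    \<open>F C\<close>, an algebraic integer by its form, is that entry times the constant
    \<open>kap\<close>, which is nonzero by the choice of \<open>a\<close> and
    \<open>b\<close>.\<close>
  define F where "F C = (\<Sum>k<n. \<Sum>l<n. coeff (ell i) k * coeff (ell j) l *
    complex_of_int ((matpow A k ** C ** matpow A l) $ a $ b))" for C
  define kap where "kap = P $ a $ i * W $ j $ b * poly (ell i) (lm i) * poly (ell j) (lm j)"
  have kap: "kap \<noteq> 0" using ab poly_ell_eq_0_iff[of i i] poly_ell_eq_0_iff[of j j] by (simp add: kap_def)
  have F_integral_ring: "F C \<in> integral_ring" for C
    unfolding F_def ell_def by (intro integral_ring_sum integral_ring_mult integral_ring_prod_linear_coeff integral_ring_of_int)
  have F_eq: "F C = kap * T C $ i $ j" for C
  proof -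
    have "F C = (\<Sum>k<n. \<Sum>l<n. \<Sum>x\<in>UNIV. \<Sum>y\<in>UNIV. (P $ a $ x * W $ y $ b * T C $ x $ y) *
       ((coeff (ell i) k * lm x ^ k) * (coeff (ell j) l * lm y ^ l)))"
      unfolding F_def cmat_entry T_sandwich by (simp add: sum_distrib_left mult_ac)
    also have "\<dots> = (\<Sum>k<n. \<Sum>x\<in>UNIV. \<Sum>l<n. \<Sum>y\<in>UNIV. (P $ a $ x * W $ y $ b * T C $ x $ y) *
       ((coeff (ell i) k * lm x ^ k) * (coeff (ell j) l * lm y ^ l)))"
      by (rule sum.cong[OF refl], rule sum.swap)
    also have "\<dots> = (\<Sum>x\<in>UNIV. \<Sum>k<n. \<Sum>l<n. \<Sum>y\<in>UNIV. (P $ a $ x * W $ y $ b * T C $ x $ y) *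
       ((coeff (ell i) k * lm x ^ k) * (coeff (ell j) l * lm y ^ l)))"
      by (rule sum.swap)
    also have "\<dots> = (\<Sum>x\<in>UNIV. \<Sum>k<n. \<Sum>y\<in>UNIV. \<Sum>l<n. (P $ a $ x * W $ y $ b * T C $ x $ y) *
       ((coeff (ell i) k * lm x ^ k) * (coeff (ell j) l * lm y ^ l)))"
      by (rule sum.cong[OF refl], rule sum.cong[OF refl], rule sum.swap)
    also have "\<dots> = (\<Sum>x\<in>UNIV. \<Sum>y\<in>UNIV. \<Sum>k<n. \<Sum>l<n. (P $ a $ x * W $ y $ b * T C $ x $ y) *
       ((coeff (ell i) k * lm x ^ k) * (coeff (ell j) l * lm y ^ l)))"
      by (rule sum.cong[OF refl], rule sum.swap)
    also have "\<dots> = (\<Sum>x\<in>UNIV. \<Sum>y\<in>UNIV. (P $ a $ x * W $ y $ b * T C $ x $ y) *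
       ((\<Sum>k<n. coeff (ell i) k * lm x ^ k) * (\<Sum>l<n. coeff (ell j) l * lm y ^ l)))"
      by (simp only: sum_distrib_left[symmetric] sum_distrib_right[symmetric])
    also have "\<dots> = kap * T C $ i $ j"
      by (simp add: n_def ell_sum kap_def if_distrib[of "\<lambda>t. _ * t"] if_distrib[of "\<lambda>t. t * _"] cong: if_cong)
    finally show ?thesis .
  qed
  define s where "s = F B"
  have s: "s \<in> integral_ring" "s \<noteq> 0" using F_integral_ring kap B by (simp_all add: s_def F_eq)
  obtain N r where N: "N \<noteq> 0" "r \<in> integral_ring" "s * r = of_int N" using integral_ring_divides_int[OF s] by blast
  have div: "\<exists>m w. w \<in> integral_ring \<and> of_int N * lm j ^ m = lm i ^ k * w" for k
  proof -
    obtain m B' where B': "B ** matpow A m = matpow A k ** B'" using B(1) unfolding stable_mats_def by blast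
    have "T (matpow A 0 ** B ** matpow A m) $ i $ j = T (matpow A k ** B' ** matpow A 0) $ i $ j"
      by (simp add: B')
    hence "T B $ i $ j * lm j ^ m = lm i ^ k * T B' $ i $ j" unfolding T_sandwich by simp
    hence "s * lm j ^ m = lm i ^ k * F B'" by (simp add: s_def F_eq mult_ac)
    hence "of_int N * lm j ^ m = lm i ^ k * (F B' * r)"
      unfolding N(3)[symmetric] by (simp add: mult_ac)
    thus ?thesis using integral_ring_mult[OF F_integral_ring N(2)] by blast
  qed
  obtain d N' where N': "N = int p ^ d * N'" "\<not> int p dvd N'"
    using multiplicity_decompose'[of N "int p"] N(1) p_prime by (metis not_prime_unit prime_nat_int_transfer)
  obtain g w where gw: "g \<in> integral_ring" "g \<notin> I" "w \<in> integral_ring" "lm i ^ card prime_roots * g = of_nat p * w"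
    using lm_power_divisible[OF i] by blast
  \<comment> \<open>The exponent supplies \<open>Suc d\<close> factors \<open>p\<close>, one more
    than \<open>N\<close> contains, so one survives the cancellation.\<close>
  obtain m w' where mw: "w' \<in> integral_ring" "of_int N * lm j ^ m = lm i ^ (card prime_roots * Suc d) * w'"
    using div by blast
  have pz: "(of_nat p :: complex) \<noteq> 0" using p_prime by (auto simp: prime_gt_0_nat)
  have "of_nat p ^ d * (of_int N' * lm j ^ m * g ^ Suc d) = (of_int N * lm j ^ m) * g ^ Suc d"
    by (simp only: N'(1) of_int_mult of_int_power of_int_of_nat_eq mult.assoc)
  also have "\<dots> = (lm i ^ card prime_roots * g) ^ Suc d * w'"
    unfolding mw(2) power_mult power_mult_distrib by (simp only: mult_ac)
  also have "\<dots> = of_nat p ^ d * (of_nat p * (w ^ Suc d * w'))"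
    unfolding gw(4) power_mult_distrib power_Suc by (simp only: mult_ac)
  finally have "of_int N' * lm j ^ m * g ^ Suc d = of_nat p * (w ^ Suc d * w')"
    using pz by simp
  also have "\<dots> \<in> I" by (intro I_mult I_p integral_ring_mult integral_ring_power gw mw)
  finally have "of_int N' * lm j ^ m \<in> I \<or> g ^ Suc d \<in> I"
    by (intro I_prime integral_ring_mult integral_ring_of_int integral_ring_power integral_ring_lm gw)
  hence "of_int N' * lm j ^ m \<in> I" using I_power[OF gw(1)] gw(2) by blast
  hence "of_int N' \<in> I \<or> lm j ^ m \<in> I" by (intro I_prime integral_ring_of_int integral_ring_power integral_ring_lm)
  hence "lm j \<in> I" using N'(2) I_power[OF integral_ring_lm] by (auto simp: of_int_in_I_iff)
  thus ?thesis by (simp add: prime_roots_def)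
qed

text \<open>The common size of the successor sets divides n, by the partition of all indices, and
  t_p, by the partition of \<open>prime_roots\<close>.\<close>

lemma succs_trivial:
  assumes "gcd CARD('n) (zero_mult A p) = 1"
  shows "succs i = {i}"
proof -
  have "card (succs i) dvd gcd CARD('n) (card prime_roots)"
    using card_succs_dvd[of UNIV i] card_succs_dvd[of prime_roots i] prime_roots_closed by (intro gcd_greatest) auto
  hence "card (succs i) dvd 1" using assms by (simp only: zero_mult_eq)
  hence "card (succs i) = 1" by simp
  then obtain x where "succs i = {x}" by (auto simp: card_1_singleton_iff)
  thus ?thesis using succs_refl[of i] by auto
qed

end

section \<open>Off-diagonal entries of stable matrices\<close>

context diagonalized
begin

lemma exists_diagonalized_prime:
  assumes "Factorial_Ring.prime p"
  obtains I where "diagonalized_prime A lm P W p I"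
proof -
  \<comment> \<open>Otherwise 1/p would be a rational algebraic integer, hence an integer.\<close>
  have "of_nat p * y \<noteq> 1" if "y \<in> integral_ring" for y :: complex
  proof
    assume y: "of_nat p * y = 1"
    hence "y = inverse (of_nat p)" by (metis inverse_unique)
    hence "y \<in> \<rat>" by simp
    hence "y \<in> \<int>" using integral_ring_algebraic_int[OF that] rational_algebraic_int_is_int by blast
    then obtain k where "y = of_int k" by (auto elim: Ints_cases)
    hence "complex_of_int (int p * k) = of_int 1" using y by simp
    hence "int p * k = 1" by (simp only: of_int_eq_iff)
    hence "int p dvd 1" by (metis dvd_triv_left)
    thus False using assms by auto
  qed
  from exists_prime_ideal[OF integral_ring_1 integral_ring_add integral_ring_mult integral_ring_minus, of "of_nat p"] this
  obtain I where "I \<subseteq> integral_ring" "of_nat p \<in> I" "1 \<notin> I" "\<And>a b. a \<in> I \<Longrightarrow> b \<in> I \<Longrightarrow> a + b \<in> I"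
    "\<And>a r. a \<in> I \<Longrightarrow> r \<in> integral_ring \<Longrightarrow> a * r \<in> I"
    "\<And>a b. a \<in> integral_ring \<Longrightarrow> b \<in> integral_ring \<Longrightarrow> a * b \<in> I \<Longrightarrow> a \<in> I \<or> b \<in> I"
    using integral_ring_of_int[of "int p"] by (metis of_int_of_nat_eq)
  hence "diagonalized_prime A lm P W p I"
    using assms by unfold_locales auto
  thus thesis by (rule that)
qed

lemma stable_mats_diagonal:
  assumes p: "Factorial_Ring.prime (p::nat)" "gcd CARD('n) (zero_mult A p) = 1" and "B \<in> stable_mats" "i \<noteq> j"
  shows "T B $ i $ j = 0"
proof -
  obtain I where dp: "diagonalized_prime A lm P W p I" by (rule exists_diagonalized_prime[OF p(1)])
  have "j \<notin> succs i"
    using diagonalized_prime.succs_trivial[OF dp p(2), of i] assms(4) by (simp only: singleton_iff) simp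
  thus ?thesis using assms(3) by (simp add: succs_def)
qed

end

section \<open>The module generated by the eigenvector\<close>

lemma a_inv_complex_ring: "\<ominus>\<^bsub>complex_ring\<^esub> x = - x"
proof -
  interpret field complex_ring by (rule field_complex_ring)
  show ?thesis
    by (rule minus_equality) (auto simp: complex_ring_def)
qed

lemma m_inv_complex_ring: "x \<noteq> 0 \<Longrightarrow> inv\<^bsub>complex_ring\<^esub> x = inverse x"
proof -
  interpret field complex_ring by (rule field_complex_ring)
  assume "x \<noteq> 0"
  thus ?thesis
    by (intro comm_inv_char) (auto simp: complex_ring_def)
qed

lemma int_adjoin_1: "1 \<in> int_adjoin S"
  using generate_ring.one[of complex_ring S] by (simp add: int_adjoin_def complex_ring_def)

lemma int_adjoin_incl: "x \<in> S \<Longrightarrow> x \<in> int_adjoin S"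
  unfolding int_adjoin_def by (rule generate_ring.incl)

lemma int_adjoin_minus: "x \<in> int_adjoin S \<Longrightarrow> - x \<in> int_adjoin S"
  using generate_ring.a_inv[of x complex_ring S] by (simp add: int_adjoin_def a_inv_complex_ring)

lemma int_adjoin_add: "x \<in> int_adjoin S \<Longrightarrow> y \<in> int_adjoin S \<Longrightarrow> x + y \<in> int_adjoin S"
  using generate_ring.eng_add[of x complex_ring S y] by (simp add: int_adjoin_def complex_ring_def)

lemma int_adjoin_mult: "x \<in> int_adjoin S \<Longrightarrow> y \<in> int_adjoin S \<Longrightarrow> x * y \<in> int_adjoin S"
  using generate_ring.eng_mult[of x complex_ring S y] by (simp add: int_adjoin_def complex_ring_def)

lemma int_adjoin_0: "0 \<in> int_adjoin S"
  using int_adjoin_add[OF int_adjoin_1 int_adjoin_minus[OF int_adjoin_1]] by simp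

lemma int_adjoin_of_int: "of_int k \<in> int_adjoin S"
proof -
  have "of_nat m \<in> int_adjoin S" for m
    by (induction m) (auto intro: int_adjoin_0 int_adjoin_add int_adjoin_1)
  thus ?thesis by (cases k rule: int_cases2) (auto intro: int_adjoin_minus)
qed

lemma int_adjoin_power: "x \<in> int_adjoin S \<Longrightarrow> x ^ k \<in> int_adjoin S"
  by (induction k) (auto intro: int_adjoin_1 int_adjoin_mult)

lemma int_adjoin_sum: "(\<And>i. i \<in> I \<Longrightarrow> g i \<in> int_adjoin S) \<Longrightarrow> sum g I \<in> int_adjoin S"
  by (induction I rule: infinite_finite_induct) (auto intro: int_adjoin_0 int_adjoin_add)

lemma int_adjoin_induct [consumes 1, case_names one incl minus add mult]:
  assumes "x \<in> int_adjoin S" "Q 1" "\<And>h. h \<in> S \<Longrightarrow> Q h" "\<And>h. Q h \<Longrightarrow> Q (- h)"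
    "\<And>h k. Q h \<Longrightarrow> Q k \<Longrightarrow> Q (h + k)" "\<And>h k. Q h \<Longrightarrow> Q k \<Longrightarrow> Q (h * k)"
  shows "Q x"
  using assms(1) unfolding int_adjoin_def
  by (induction rule: generate_ring.induct)
    (use assms(2-) in \<open>auto simp: a_inv_complex_ring\<close>, auto simp: complex_ring_def)

lemma rat_adjoin_field_1: "1 \<in> rat_adjoin_field l"
  using generate_field.one[of complex_ring "{l}"] by (simp add: rat_adjoin_field_def complex_ring_def)

lemma rat_adjoin_field_gen: "l \<in> rat_adjoin_field l"
  unfolding rat_adjoin_field_def by (rule generate_field.incl) simp

lemma rat_adjoin_field_minus: "x \<in> rat_adjoin_field l \<Longrightarrow> - x \<in> rat_adjoin_field l"
  using generate_field.a_inv[of x complex_ring "{l}"] by (simp add: rat_adjoin_field_def a_inv_complex_ring)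

lemma rat_adjoin_field_add:
  "x \<in> rat_adjoin_field l \<Longrightarrow> y \<in> rat_adjoin_field l \<Longrightarrow> x + y \<in> rat_adjoin_field l"
  using generate_field.eng_add[of x complex_ring "{l}" y] by (simp add: rat_adjoin_field_def complex_ring_def)

lemma rat_adjoin_field_mult:
  "x \<in> rat_adjoin_field l \<Longrightarrow> y \<in> rat_adjoin_field l \<Longrightarrow> x * y \<in> rat_adjoin_field l"
  using generate_field.eng_mult[of x complex_ring "{l}" y] by (simp add: rat_adjoin_field_def complex_ring_def)

lemma rat_adjoin_field_0: "0 \<in> rat_adjoin_field l"
  using rat_adjoin_field_add[OF rat_adjoin_field_1 rat_adjoin_field_minus[OF rat_adjoin_field_1]] by simp

lemma rat_adjoin_field_inverse: "x \<in> rat_adjoin_field l \<Longrightarrow> inverse x \<in> rat_adjoin_field l"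
proof (cases "x = 0")
  case False
  assume "x \<in> rat_adjoin_field l"
  moreover have "x \<noteq> \<zero>\<^bsub>complex_ring\<^esub>" using False by (simp add: complex_ring_def)
  ultimately show ?thesis
    using generate_field.m_inv[of x complex_ring "{l}"] False
    by (simp add: rat_adjoin_field_def m_inv_complex_ring)
qed (simp add: rat_adjoin_field_0)

lemma rat_adjoin_field_of_rat: "of_rat q \<in> rat_adjoin_field l"
proof -
  have nat: "of_nat m \<in> rat_adjoin_field l" for m
    by (induction m) (auto intro: rat_adjoin_field_0 rat_adjoin_field_add rat_adjoin_field_1)
  have int: "of_int k \<in> rat_adjoin_field l" for k
    by (cases k rule: int_cases2) (auto intro: rat_adjoin_field_minus nat)
  obtain a b where "q = Rat.Fract a b" "b > 0" by (cases q) auto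
  hence "of_rat q = of_int a * inverse (of_int b :: complex)"
    by (simp add: of_rat_rat divide_inverse)
  thus ?thesis using int rat_adjoin_field_mult rat_adjoin_field_inverse by metis
qed

lemma rat_adjoin_field_power: "x \<in> rat_adjoin_field l \<Longrightarrow> x ^ k \<in> rat_adjoin_field l"
  by (induction k) (auto intro: rat_adjoin_field_1 rat_adjoin_field_mult)

lemma rat_adjoin_field_sum:
  "(\<And>i. i \<in> I \<Longrightarrow> g i \<in> rat_adjoin_field l) \<Longrightarrow> sum g I \<in> rat_adjoin_field l"
  by (induction I rule: infinite_finite_induct) (auto intro: rat_adjoin_field_0 rat_adjoin_field_add)

section \<open>Integer matrices that are diagonal in the eigenbasis\<close>

context diagonalized
begin

text \<open>Interpolation writes the diagonal matrix \<open>T B\<close> as a polynomial in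
  \<open>T A\<close>, so \<open>B\<close> is a complex combination of powers of \<open>A\<close>.
  Descent makes the coefficients rational, which turns the diagonal entry into a rational polynomial
  in \<open>lm i\<close>.\<close>

lemma diagonal_imp_rat_poly:
  assumes diag: "\<And>i j. i \<noteq> j \<Longrightarrow> T B $ i $ j = 0"
  shows "T B $ i $ i \<in> rat_adjoin_field (lm i)"
proof -
  define n where "n = CARD('n)"
  define q where "q = (\<Sum>x\<in>UNIV. smult (T B $ x $ x / poly (ell x) (lm x)) (ell x))"
  have q: "poly q (lm j) = T B $ j $ j" for j
  proof -
    have "poly q (lm j) = (\<Sum>x\<in>UNIV. T B $ x $ x / poly (ell x) (lm x) * poly (ell x) (lm j))"
      by (simp add: q_def poly_sum)
    also have "\<dots> = (\<Sum>x\<in>{j}. T B $ x $ x / poly (ell x) (lm x) * poly (ell x) (lm j))"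
      by (rule sum.mono_neutral_right) (auto simp: poly_ell_eq_0_iff)
    finally show ?thesis using poly_ell_eq_0_iff[of j j] by simp
  qed
  have "degree q \<le> n - 1" unfolding q_def
    by (rule degree_sum_le) (auto simp: n_def degree_ell intro: order_trans[OF degree_smult_le])
  hence dq: "degree q < n" by (simp add: n_def less_eq_Suc_le[symmetric] Suc_le_eq order_le_less_trans)
  \<comment> \<open>Slot \<open>n\<close> holds \<open>B\<close> itself, with coefficient -1; the
    descent keeps this coefficient nonzero, so the rational relation can be solved for
    \<open>B\<close>.\<close>
  define M where "M k = (if k < n then matpow A k else B)" for k
  define c where "c k = (if k < n then coeff q k else - 1)" for k
  have Tc: "(\<Sum>k\<le>n. c k * T (M k) $ a $ b) = 0" for a b
  proof -
    have "(\<Sum>k\<le>n. c k * T (M k) $ a $ b) = (\<Sum>k<n. c k * T (M k) $ a $ b) + c n * T (M n) $ a $ b"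
      by (simp add: lessThan_Suc_atMost[symmetric])
    also have "(\<Sum>k<n. c k * T (M k) $ a $ b) = (\<Sum>k<n. coeff q k * (if a = b then lm b ^ k else 0))"
      by (rule sum.cong) (auto simp: c_def M_def T_matpow)
    also have "\<dots> = (if a = b then poly q (lm b) else 0)"
      using poly_sum_lessThan[OF dq] by simp
    finally show ?thesis using diag[of a b] by (auto simp: c_def M_def q)
  qed
  define EQ where "EQ = {\<lambda>k. M k $ a $ b | a b. True}"
  obtain f :: "nat \<Rightarrow> rat" where f: "f n \<noteq> 0"
    and fe: "\<And>d. d \<in> EQ \<Longrightarrow> (\<Sum>k\<le>n. of_int (d k) * f k) = 0"
  proof (rule rational_solution[where p = c and ?i0.0 = n and I = "{..n}" and EQ = EQ])
    show "c n \<noteq> 0" by (simp add: c_def)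
    fix d assume "d \<in> EQ"
    then obtain a b where d: "d = (\<lambda>k. M k $ a $ b)" by (auto simp: EQ_def)
    show "(\<Sum>k\<le>n. of_int (d k) * c k) = 0"
      using linear_relation_T[where I = "{..n}" and q = c and B = M and a = a and b = b, OF Tc] by (simp add: d mult_ac)
  qed (use that in blast)
  have "(\<Sum>k\<le>n. of_rat (f k) * T (M k) $ i $ i) = 0"
  proof (rule T_linear_relation)
    fix a b
    have "(\<lambda>k. M k $ a $ b) \<in> EQ" by (auto simp: EQ_def)
    from fe[OF this] have "of_rat (\<Sum>k\<le>n. of_int (M k $ a $ b) * f k) = (0::complex)" by simp
    thus "(\<Sum>k\<le>n. of_rat (f k) * complex_of_int (M k $ a $ b)) = 0"
      by (simp add: of_rat_sum of_rat_mult mult_ac)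
  qed
  hence "(\<Sum>k<n. of_rat (f k) * lm i ^ k) + of_rat (f n) * T B $ i $ i = 0"
    by (simp add: lessThan_Suc_atMost[symmetric] M_def T_matpow)
  hence "T B $ i $ i = - (\<Sum>k<n. of_rat (f k) * lm i ^ k) * inverse (of_rat (f n))"
    using f by (simp add: field_simps add_eq_0_iff)
  also have "\<dots> \<in> rat_adjoin_field (lm i)"
    by (intro rat_adjoin_field_mult rat_adjoin_field_minus rat_adjoin_field_sum rat_adjoin_field_of_rat
        rat_adjoin_field_power rat_adjoin_field_gen rat_adjoin_field_inverse)
  finally show ?thesis .
qed

lemma diagonal_eigenvector:
  assumes diag: "\<And>i j. i \<noteq> j \<Longrightarrow> T B $ i $ j = 0" and u: "cmat A *v u = lm i0 *s u"
  shows "cmat B *v u = T B $ i0 $ i0 *s u"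
proof -
  define w where "w = (W *v u) $ i0"
  have ua: "u $ a = P $ a $ i0 * w" for a unfolding w_def by (rule eigenvector_eq[OF u])
  have "cmat B ** P = P ** T B"
    by (simp add: T_def matrix_mul_assoc PW)
  hence BP: "(cmat B ** P) $ a $ i0 = (P ** T B) $ a $ i0" for a by simp
  have "(P ** T B) $ a $ i0 = (\<Sum>x\<in>UNIV. P $ a $ x * T B $ x $ i0)" for a
    by (simp add: matrix_matrix_mult_def[of P])
  also have "\<dots> a = (\<Sum>x\<in>{i0}. P $ a $ x * T B $ x $ i0)" for a
    by (rule sum.mono_neutral_right) (auto simp: diag)
  finally have e: "(\<Sum>b\<in>UNIV. of_int (B $ a $ b) * P $ b $ i0) = T B $ i0 $ i0 * P $ a $ i0" for a
    using BP[of a] by (simp add: matrix_matrix_mult_def[of "cmat B"] mult_ac)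
  have "(cmat B *v u) $ a = (T B $ i0 $ i0 *s u) $ a" for a
  proof -
    have "(cmat B *v u) $ a = (\<Sum>b\<in>UNIV. of_int (B $ a $ b) * P $ b $ i0) * w"
      by (simp add: matrix_vector_mult_def ua sum_distrib_right mult.assoc)
    thus ?thesis unfolding e by (simp add: ua mult.assoc)
  qed
  thus ?thesis by (subst vec_eq_iff) blast
qed

end

section \<open>The module as a union of lattices, and its endomorphisms\<close>

locale solenoid_eigenvector = diagonalized A lm P W
  for A :: "int ^ 'n ^ 'n" and lm :: "'n \<Rightarrow> complex" and P W :: "complex ^ 'n ^ 'n" +
  fixes lam :: complex and u :: "complex ^ 'n" and i0 :: 'n
  assumes nonsing: "det A \<noteq> 0" and u_nz: "u \<noteq> 0" and Au: "cmat A *v u = lam *s u" and lam_eq: "lam = lm i0"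
begin

definition dotu :: "int ^ 'n \<Rightarrow> complex" where
  "dotu c = (\<Sum>a\<in>UNIV. of_int (c $ a) * u $ a)"

lemma dotu_add: "dotu (c + d) = dotu c + dotu d"
  by (simp add: dotu_def distrib_right sum.distrib)

lemma dotu_minus: "dotu (- c) = - dotu c"
  by (simp add: dotu_def sum_negf)

lemma dotu_eq_0: "dotu c = 0 \<Longrightarrow> c = 0"
  unfolding dotu_def
  using eigenvector_independent[OF u_nz Au[unfolded lam_eq], of "\<lambda>a. c $ a"] vec_eq_iff[of c 0] by auto

lemma dotu_inj: "dotu c = dotu d \<Longrightarrow> c = d"
  using dotu_eq_0[of "c - d"] by (simp add: dotu_def left_diff_distrib sum_subtractf)

lemma dotu_axis: "dotu (axis a 1) = u $ a"
  by (simp add: dotu_def axis_def if_distrib[of of_int] if_distrib[of "\<lambda>t. t * _"] cong: if_cong)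

lemma dotu_row: "dotu (B $ a) = (cmat B *v u) $ a"
  by (simp add: dotu_def matrix_vector_mult_def)

lemma matpow_u: "cmat (matpow A k) *v u = lam ^ k *s u"
proof (induction k)
  case 0
  then show ?case by (simp add: cmat_mat_1)
next
  case (Suc k)
  have "cmat (matpow A (Suc k)) *v u = cmat A *v (lam ^ k *s u)"
    by (simp only: matpow.simps cmat_mult matrix_vector_mul_assoc[symmetric] Suc)
  also have "\<dots> = lam ^ k *s (cmat A *v u)"
    by (simp add: vec_eq_iff matrix_vector_mult_def sum_distrib_left mult_ac)
  finally show ?case by (simp add: Au vec_eq_iff mult_ac)
qed

lemma lam_power_u: "(\<Sum>b\<in>UNIV. of_int (matpow A k $ a $ b) * u $ b) = lam ^ k * u $ a"
  using matpow_u[of k] by (simp add: vec_eq_iff matrix_vector_mult_def)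

text \<open>Because A u = lam u, acting on the row \<open>c\<close> by \<open>A\<close> from the
  right is multiplication by \<open>lam\<close>; this is how an element of \<open>Y\<close> is
  rewritten at a higher level \<open>k\<close>.\<close>

lemma dotu_matpow: "dotu (c v* matpow A k) = lam ^ k * dotu c"
proof -
  have "dotu (c v* matpow A k) = (\<Sum>b\<in>UNIV. \<Sum>a\<in>UNIV. of_int (c $ a) * (of_int (matpow A k $ a $ b) * u $ b))"
    by (simp add: dotu_def vector_matrix_mult_def sum_distrib_left sum_distrib_right mult_ac)
  also have "\<dots> = (\<Sum>a\<in>UNIV. \<Sum>b\<in>UNIV. of_int (c $ a) * (of_int (matpow A k $ a $ b) * u $ b))"
    by (rule sum.swap)
  also have "\<dots> = lam ^ k * dotu c"
    by (simp only: sum_distrib_left[symmetric] lam_power_u) (simp add: dotu_def sum_distrib_left mult_ac)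
  finally show ?thesis .
qed

lemma charpoly_lam: "poly (map_poly of_int (charpoly A)) lam = 0"
  by (simp add: lam_eq charpoly_root)

lemma lam_nz: "lam \<noteq> 0"
proof
  assume "lam = 0"
  hence "coeff (map_poly complex_of_int (charpoly A)) 0 = 0" using charpoly_lam by (simp add: poly_0_coeff_0)
  thus False using nonsing by (simp add: coeff_map_poly coeff_0_charpoly)
qed

lemma lam_power_shift: "inverse lam ^ k * y = inverse lam ^ (k + l) * (lam ^ l * y)"
  using lam_nz by (simp add: power_add field_simps)

lemma lam_cancel: "lam ^ k * (inverse lam ^ k * y) = y"
  using lam_nz by (simp add: field_simps)

text \<open>Given as an ascending union, so that each element comes with a level \<open>k\<close>
  and an integer vector \<open>c\<close>; \<open>eigen_module_eq\<close> identifies it with the span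
  over the Laurent ring.\<close>

definition Y :: "complex set" where
  "Y = {inverse lam ^ k * dotu c | k c. True}"

lemma YI: "inverse lam ^ k * dotu c \<in> Y"
  by (auto simp: Y_def)

lemma YE: "y \<in> Y \<Longrightarrow> (\<And>k c. y = inverse lam ^ k * dotu c \<Longrightarrow> thesis) \<Longrightarrow> thesis"
  unfolding Y_def by blast

lemma Y_add: assumes "x \<in> Y" "y \<in> Y" shows "x + y \<in> Y"
proof -
  obtain k c l d where xy: "x = inverse lam ^ k * dotu c" "y = inverse lam ^ l * dotu d"
    using assms by (metis YE)
  have "x + y = inverse lam ^ (k + l) * (lam ^ l * dotu c) + inverse lam ^ (l + k) * (lam ^ k * dotu d)"
    unfolding xy by (simp only: lam_power_shift[symmetric])
  also have "\<dots> = inverse lam ^ (k + l) * dotu (c v* matpow A l + d v* matpow A k)"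
    by (simp add: dotu_add dotu_matpow distrib_left add.commute)
  finally show ?thesis using YI by simp
qed

lemma Y_minus: "x \<in> Y \<Longrightarrow> - x \<in> Y"
  by (erule YE) (metis YI dotu_minus mult_minus_right)

lemma Y_lam: assumes "x \<in> Y" shows "lam * x \<in> Y"
proof -
  obtain k c where "x = inverse lam ^ k * dotu c" using assms by (rule YE)
  hence "lam * x = inverse lam ^ k * dotu (c v* matpow A 1)"
    by (simp only: dotu_matpow) (simp add: mult_ac)
  thus ?thesis using YI by simp
qed

lemma Y_inverse_lam: assumes "x \<in> Y" shows "inverse lam * x \<in> Y"
proof -
  obtain k c where "x = inverse lam ^ k * dotu c" using assms by (rule YE)
  hence "inverse lam * x = inverse lam ^ Suc k * dotu c" by simp
  thus ?thesis using YI[of "Suc k" c] by (simp only:)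
qed

lemma Y_0: "0 \<in> Y"
  using YI[of 0 0] by (simp add: dotu_def)

lemma Y_sum: "(\<And>i. i \<in> I \<Longrightarrow> g i \<in> Y) \<Longrightarrow> sum g I \<in> Y"
  by (induction I rule: infinite_finite_induct) (auto intro: Y_0 Y_add)

lemma Y_adjoin_mult: "r \<in> int_adjoin {lam, inverse lam} \<Longrightarrow> y \<in> Y \<Longrightarrow> r * y \<in> Y"
proof (induction r arbitrary: y rule: int_adjoin_induct)
  case (incl h)
  then show ?case using Y_lam Y_inverse_lam by auto
next
  case (minus h)
  then show ?case using Y_minus by fastforce
next
  case (add h k)
  then show ?case by (simp add: distrib_right Y_add)
next
  case (mult h k)
  then show ?case by (simp add: mult.assoc)
qed simp

lemma u_in_Y: "inverse lam ^ k * u $ a \<in> Y"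
  using YI[of k "axis a 1"] by (simp add: dotu_axis)

lemma eigen_module_eq: "eigen_module lam u = Y"
proof (intro subset_antisym subsetI)
  fix y assume "y \<in> eigen_module lam u"
  then obtain c where c: "y = (\<Sum>i\<in>UNIV. c i * u $ i)" "\<And>i. c i \<in> int_adjoin {lam, inverse lam}"
    unfolding eigen_module_def span_over_def by blast
  show "y \<in> Y" unfolding c(1)
    using u_in_Y[of 0] by (intro Y_sum Y_adjoin_mult c(2)) simp
next
  fix y assume "y \<in> Y"
  then obtain k c where y: "y = inverse lam ^ k * dotu c" by (rule YE)
  have "y = (\<Sum>i\<in>UNIV. (inverse lam ^ k * of_int (c $ i)) * u $ i)"
    by (simp add: y dotu_def sum_distrib_left mult_ac)
  moreover have "inverse lam ^ k * of_int (c $ i) \<in> int_adjoin {lam, inverse lam}" for i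
    by (intro int_adjoin_mult int_adjoin_power int_adjoin_of_int int_adjoin_incl) simp
  ultimately show "y \<in> eigen_module lam u" unfolding eigen_module_def span_over_def
    by (intro CollectI exI[of _ "\<lambda>i. inverse lam ^ k * of_int (c $ i)"]) auto
qed

lemma cmat_A_ker: "cmat (matpow A k) *v x = 0 \<Longrightarrow> x = 0"
proof (induction k)
  case 0
  then show ?case by (simp add: cmat_mat_1)
next
  case (Suc k)
  have "det (cmat A) = of_int (det A)"
    using unital_ring_hom.f_det[OF unital_ring_hom_of_int[where 'b = complex], of A] by simp
  hence "invertible (cmat A)" using nonsing by (simp add: invertible_det_nz)
  hence ker: "\<And>x. cmat A *v x = 0 \<Longrightarrow> x = 0"
    using matrix_left_invertible_ker[of "cmat A"] unfolding invertible_def by blast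
  show ?case
    using Suc ker by (simp only: matpow.simps cmat_mult matrix_vector_mul_assoc[symmetric])
qed

text \<open>The lattices ascend, so finitely many elements of \<open>Y\<close> lie in a common one;
  the sum of their levels is a common upper bound.\<close>

lemma uniform_representation:
  assumes "\<And>a. g a \<in> Y"
  obtains m B where "\<And>a. g a = inverse lam ^ m * (cmat B *v u) $ (a :: 'n)"
proof -
  have "\<exists>k c. g a = inverse lam ^ k * dotu c" for a using assms[of a] by (auto simp: Y_def)
  then obtain k c where kc: "\<And>a. g a = inverse lam ^ k a * dotu (c a)" by metis
  define m where "m = (\<Sum>a\<in>UNIV. k a)"
  have km: "k a \<le> m" for a unfolding m_def by (rule member_le_sum) auto
  define B where "B = (\<chi> a. c a v* matpow A (m - k a))"
  have "g a = inverse lam ^ m * (cmat B *v u) $ a" for a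
  proof -
    have "g a = inverse lam ^ (k a + (m - k a)) * (lam ^ (m - k a) * dotu (c a))"
      by (simp only: kc lam_power_shift[symmetric])
    also have "\<dots> = inverse lam ^ m * dotu (B $ a)"
      using km[of a] by (simp add: dotu_matpow B_def)
    finally show ?thesis by (simp only: dotu_row)
  qed
  thus thesis by (rule that)
qed

text \<open>The values at the \<open>u $ a\<close> give an integer matrix \<open>B\<close> up to a
  power of \<open>lam\<close>. It is stable, hence diagonal in the eigenbasis, so \<open>u\<close>
  is an eigenvector of \<open>B\<close>, whose eigenvalue is an algebraic integer in the field
  generated by \<open>lam\<close>.\<close>

lemma endomorphism_is_multiplication:
  fixes f :: "complex \<Rightarrow> complex" and p :: nat
  assumes p: "Factorial_Ring.prime p" "gcd CARD('n) (zero_mult A p) = 1"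
    and fY: "\<And>y. y \<in> Y \<Longrightarrow> f y \<in> Y" and f_add: "\<And>x y. x \<in> Y \<Longrightarrow> y \<in> Y \<Longrightarrow> f (x + y) = f x + f y"
  obtains x where "x \<in> S_integers lam" "\<And>y. y \<in> Y \<Longrightarrow> f y = x * y"
proof -
  have f0: "f 0 = 0" using f_add[OF Y_0 Y_0] by simp
  have fminus: "f (- y) = - f y" if "y \<in> Y" for y
    using f_add[OF that Y_minus[OF that]] f0 by (simp add: add_eq_0_iff)
  have Y_nat: "of_nat m * y \<in> Y" if "y \<in> Y" for y m
    by (induction m) (auto simp: distrib_right intro: Y_0 Y_add that)
  have Y_int: "of_int m * y \<in> Y" if "y \<in> Y" for y m
    by (cases m rule: int_cases2) (auto intro: Y_minus Y_nat that)
  have fnat: "f (of_nat m * y) = of_nat m * f y" if "y \<in> Y" for y m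
    by (induction m) (auto simp: distrib_right f0 f_add that Y_nat)
  have fint: "f (of_int m * y) = of_int m * f y" if "y \<in> Y" for y m
    by (cases m rule: int_cases2) (auto simp: fnat fminus that Y_nat)
  have fsum: "f (\<Sum>a\<in>X. of_int (c a) * g a) = (\<Sum>a\<in>X. of_int (c a) * f (g a))"
    if "finite X" "\<And>a. g a \<in> Y" for c :: "'n \<Rightarrow> int" and g X
    using that(1) by (induction X rule: finite_induct) (auto simp: f0 f_add fint that Y_sum Y_int)
  \<comment> \<open>Each \<open>u $ a\<close> is an integer combination of the
    \<open>inverse lam ^ k * u $ b\<close> with coefficients from A^k; additivity carries this over
    to the values of \<open>f\<close>.\<close>
  have fu: "f (u $ a) = (\<Sum>b\<in>UNIV. of_int (matpow A k $ a $ b) * f (inverse lam ^ k * u $ b))" for a k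
  proof -
    have "u $ a = inverse lam ^ k * (lam ^ k * u $ a)"
      using lam_nz by (simp add: field_simps)
    also have "\<dots> = inverse lam ^ k * (\<Sum>b\<in>UNIV. of_int (matpow A k $ a $ b) * u $ b)"
      by (simp only: lam_power_u)
    also have "\<dots> = (\<Sum>b\<in>UNIV. of_int (matpow A k $ a $ b) * (inverse lam ^ k * u $ b))"
      by (simp add: sum_distrib_left mult_ac)
    finally have "f (u $ a) = f (\<Sum>b\<in>UNIV. of_int (matpow A k $ a $ b) * (inverse lam ^ k * u $ b))"
      by simp
    thus ?thesis by (simp only: fsum[OF finite u_in_Y])
  qed
  obtain m B where B: "\<And>a. f (u $ a) = inverse lam ^ m * (cmat B *v u) $ a"
    using uniform_representation[of "\<lambda>a. f (u $ a)"] fY u_in_Y[of 0] by auto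
  have "B \<in> stable_mats" unfolding stable_mats_def
  proof (intro CollectI allI)
    fix k
    obtain l C where C: "\<And>a. f (inverse lam ^ k * u $ a) = inverse lam ^ l * (cmat C *v u) $ a"
      using uniform_representation[of "\<lambda>a. f (inverse lam ^ k * u $ a)"] fY u_in_Y by auto
    have vec_scale: "cmat M *v (s *s x) = s *s (cmat M *v x)" for M :: "int ^ 'n ^ 'n" and s x
      by (simp add: vec_eq_iff matrix_vector_mult_def sum_distrib_left mult_ac)
    \<comment> \<open>Comparing two expressions for \<open>f (u $ a)\<close> and clearing the powers
      of \<open>lam\<close> leads, by injectivity of \<open>dotu\<close>, to B A^l = A^k C
      A^m.\<close>
    have "inverse lam ^ m * (cmat B *v u) $ a = inverse lam ^ l * (cmat (matpow A k ** C) *v u) $ a" for a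
    proof -
      have "inverse lam ^ m * (cmat B *v u) $ a = (\<Sum>b\<in>UNIV. of_int (matpow A k $ a $ b) * (inverse lam ^ l * (cmat C *v u) $ b))"
        using fu[of a k] by (simp only: B C)
      also have "\<dots> = inverse lam ^ l * (cmat (matpow A k) *v (cmat C *v u)) $ a"
        by (simp add: matrix_vector_mult_def[of "cmat (matpow A k)"] sum_distrib_left mult_ac)
      finally show ?thesis by (simp only: cmat_mult matrix_vector_mul_assoc)
    qed
    hence "lam ^ m * (lam ^ l * (inverse lam ^ m * (cmat B *v u) $ a)) =
      lam ^ m * (lam ^ l * (inverse lam ^ l * (cmat (matpow A k ** C) *v u) $ a))" for a by simp
    hence e: "lam ^ l * (cmat B *v u) $ a = lam ^ m * (cmat (matpow A k ** C) *v u) $ a" for a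
      by (simp only: lam_cancel mult.left_commute[of "lam ^ m" "lam ^ l"])
    have "dotu ((B ** matpow A l) $ a) = dotu ((matpow A k ** (C ** matpow A m)) $ a)" for a
    proof -
      have "dotu ((B ** matpow A l) $ a) = lam ^ l * (cmat B *v u) $ a"
        by (simp only: dotu_row cmat_mult matrix_vector_mul_assoc[symmetric] matpow_u vec_scale vector_smult_component)
      also have "\<dots> = lam ^ m * (cmat (matpow A k ** C) *v u) $ a" by (rule e)
      also have "\<dots> = dotu (((matpow A k ** C) ** matpow A m) $ a)"
        unfolding dotu_row cmat_mult[of _ "matpow A m"]
        by (simp only: matrix_vector_mul_assoc[symmetric] matpow_u vec_scale vector_smult_component)
      finally show ?thesis by (simp only: matrix_mul_assoc)
    qed
    hence "B ** matpow A l = matpow A k ** (C ** matpow A m)"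
      by (subst vec_eq_iff) (blast dest: dotu_inj)
    thus "\<exists>m B'. B ** matpow A m = matpow A k ** B'" by blast
  qed
  hence diag: "\<And>i j. i \<noteq> j \<Longrightarrow> T B $ i $ j = 0" using stable_mats_diagonal[OF p] by blast
  define x' where "x' = T B $ i0 $ i0"
  have Bu: "cmat B *v u = x' *s u"
    unfolding x'_def using diagonal_eigenvector[OF diag, of u i0] Au lam_eq by simp
  have "x' \<in> integers_of (rat_adjoin_field lam)"
    unfolding integers_of_def
    using diagonal_imp_rat_poly[OF diag, of i0] algebraic_int_eigenvalue[OF u_nz Bu] by (simp add: x'_def lam_eq)
  define x where "x = inverse lam ^ m * x'"
  have xS: "x \<in> S_integers lam"
    unfolding x_def S_integers_def
    using \<open>x' \<in> _\<close> by (intro int_adjoin_mult int_adjoin_power int_adjoin_incl) auto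
  have fu': "f (u $ a) = x * u $ a" for a by (simp add: B Bu x_def)
  \<comment> \<open>So far multiplication by \<open>x\<close> is known at level 0 only. The
    deviation \<open>z\<close> at level \<open>k\<close> is annihilated by A^k, which is
    injective.\<close>
  have fk: "f (inverse lam ^ k * u $ a) = x * (inverse lam ^ k * u $ a)" for k a
  proof -
    define z where "z = (\<chi> b. f (inverse lam ^ k * u $ b) - x * (inverse lam ^ k * u $ b))"
    have "(cmat (matpow A k) *v z) $ a = 0" for a
    proof -
      have "(cmat (matpow A k) *v z) $ a = (\<Sum>b\<in>UNIV. of_int (matpow A k $ a $ b) * f (inverse lam ^ k * u $ b))
         - (\<Sum>b\<in>UNIV. of_int (matpow A k $ a $ b) * (x * (inverse lam ^ k * u $ b)))"
        by (simp add: matrix_vector_mult_def z_def right_diff_distrib sum_subtractf)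
      also have "(\<Sum>b\<in>UNIV. of_int (matpow A k $ a $ b) * (x * (inverse lam ^ k * u $ b)))
         = x * (inverse lam ^ k * (\<Sum>b\<in>UNIV. of_int (matpow A k $ a $ b) * u $ b))"
        by (simp add: sum_distrib_left mult_ac)
      also have "\<dots> = x * u $ a"
        unfolding lam_power_u using lam_nz by (simp add: field_simps)
      finally show ?thesis by (simp only: fu[symmetric] fu') simp
    qed
    hence "cmat (matpow A k) *v z = 0" by (subst vec_eq_iff) simp
    hence "z = 0" by (rule cmat_A_ker)
    hence "z $ a = 0" by simp
    thus ?thesis by (simp add: z_def)
  qed
  have "f y = x * y" if y_in: "y \<in> Y" for y
  proof -
    obtain k c where y: "y = inverse lam ^ k * dotu c" using y_in by (rule YE)
    have y': "y = (\<Sum>a\<in>UNIV. of_int (c $ a) * (inverse lam ^ k * u $ a))"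
      by (simp add: y dotu_def sum_distrib_left mult_ac)
    have "f y = (\<Sum>a\<in>UNIV. of_int (c $ a) * (x * (inverse lam ^ k * u $ a)))"
      unfolding y' by (simp only: fsum[OF finite u_in_Y] fk)
    also have "\<dots> = x * y" unfolding y' by (simp add: sum_distrib_left mult_ac)
    finally show ?thesis .
  qed
  thus thesis using that xS by blast
qed

lemma Y_subset_S_integers:
  assumes "\<And>i. u $ i \<in> integers_of (rat_adjoin_field lam)"
  shows "Y \<subseteq> S_integers lam"
proof
  fix y assume "y \<in> Y"
  then obtain k c where y: "y = inverse lam ^ k * dotu c" by (rule YE)
  show "y \<in> S_integers lam" unfolding S_integers_def y dotu_def
    by (intro int_adjoin_mult int_adjoin_power int_adjoin_sum int_adjoin_of_int)
      (auto intro: int_adjoin_incl assms)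
qed

lemma span_Ints_subset_Y: "span_over \<int> u \<subseteq> Y"
proof
  fix y assume "y \<in> span_over \<int> u"
  then obtain c where c: "y = (\<Sum>i\<in>UNIV. c i * u $ i)" "\<And>i. c i \<in> \<int>" by (auto simp: span_over_def)
  have "\<exists>d. c i = of_int d" for i using c(2)[of i] by (auto elim: Ints_cases)
  then obtain d where "\<And>i. c i = of_int (d i)" by metis
  hence "y = inverse lam ^ 0 * dotu (\<chi> i. d i)" by (simp add: c(1) dotu_def)
  thus "y \<in> Y" using YI by metis
qed

text \<open>By the characteristic equation \<open>inverse lam\<close> is, up to sign, an integer
  polynomial in \<open>lam\<close> divided by det A, so the span over the larger ring is closed
  under \<open>inverse lam\<close>.\<close>

lemma Y_subset_span_det: "Y \<subseteq> span_over (int_adjoin {1 / of_int (det A)}) u"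
proof -
  define R where "R = int_adjoin {1 / of_int (det A)}"
  define X where "X = span_over R u"
  have XI: "(\<Sum>i\<in>UNIV. c i * u $ i) \<in> X" if "\<And>i. c i \<in> R" for c
    using that by (auto simp: X_def span_over_def)
  have XE: "\<exists>c. y = (\<Sum>i\<in>UNIV. c i * u $ i) \<and> (\<forall>i. c i \<in> R)" if "y \<in> X" for y
    using that by (auto simp: X_def span_over_def)
  have X_add: "x + y \<in> X" if xX: "x \<in> X" and yX: "y \<in> X" for x y
  proof -
    obtain c d where cd: "x = (\<Sum>i\<in>UNIV. c i * u $ i)" "y = (\<Sum>i\<in>UNIV. d i * u $ i)"
      "\<And>i. c i \<in> R" "\<And>i. d i \<in> R" using XE[OF xX] XE[OF yX] by blast
    have "x + y = (\<Sum>i\<in>UNIV. (c i + d i) * u $ i)" by (simp add: cd distrib_right sum.distrib)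
    also have "\<dots> \<in> X" by (intro XI) (use cd in \<open>auto simp: R_def intro: int_adjoin_add\<close>)
    finally show ?thesis .
  qed
  have X_mult: "r * x \<in> X" if xX: "x \<in> X" and rR: "r \<in> R" for x r
  proof -
    obtain c where c: "x = (\<Sum>i\<in>UNIV. c i * u $ i)" "\<And>i. c i \<in> R" using XE[OF xX] by blast
    have "r * x = (\<Sum>i\<in>UNIV. (r * c i) * u $ i)" by (simp add: c sum_distrib_left mult_ac)
    also have "\<dots> \<in> X" by (intro XI) (use c rR in \<open>auto simp: R_def intro: int_adjoin_mult\<close>)
    finally show ?thesis .
  qed
  have X_lam: "lam * x \<in> X" if xX: "x \<in> X" for x
  proof -
    obtain c where c: "x = (\<Sum>i\<in>UNIV. c i * u $ i)" "\<And>i. c i \<in> R" using XE[OF xX] by blast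
    have lu: "lam * u $ i = (\<Sum>j\<in>UNIV. of_int (A $ i $ j) * u $ j)" for i
      using Au by (simp add: vec_eq_iff matrix_vector_mult_def)
    have "lam * x = (\<Sum>i\<in>UNIV. c i * (lam * u $ i))" by (simp add: c sum_distrib_left mult_ac)
    also have "\<dots> = (\<Sum>i\<in>UNIV. \<Sum>j\<in>UNIV. (c i * of_int (A $ i $ j)) * u $ j)"
      unfolding lu by (simp add: sum_distrib_left mult_ac)
    also have "\<dots> = (\<Sum>j\<in>UNIV. (\<Sum>i\<in>UNIV. c i * of_int (A $ i $ j)) * u $ j)"
      by (subst sum.swap) (simp add: sum_distrib_right)
    also have "\<dots> \<in> X"
      by (intro XI) (use c in \<open>auto simp: R_def intro!: int_adjoin_sum int_adjoin_mult int_adjoin_of_int\<close>)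
    finally show ?thesis .
  qed
  have X_0: "0 \<in> X" using XI[of "\<lambda>_. 0"] by (simp add: R_def int_adjoin_0)
  have X_poly: "poly (map_poly of_int g) lam * x \<in> X" if x: "x \<in> X" for g x
  proof (induction g)
    case 0
    then show ?case by (simp add: X_0)
  next
    case (pCons c g)
    have "poly (map_poly of_int (pCons c g)) lam * x = of_int c * x + lam * (poly (map_poly of_int g) lam * x)"
      using pCons(1) by (simp add: map_poly_pCons algebra_simps)
    also have "\<dots> \<in> X" by (intro X_add X_mult X_lam pCons x) (simp add: R_def int_adjoin_of_int)
    finally show ?case .
  qed
  have X_inv: "inverse lam * x \<in> X" if x: "x \<in> X" for x
  proof -
    obtain c g where g: "charpoly A = pCons c g" by (cases "charpoly A")
    define e :: complex where "e = (- 1) ^ CARD('n)"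
    have ee: "e * e = 1" by (simp add: e_def power_mult_distrib[symmetric])
    have "c = (- 1) ^ CARD('n) * det A" using coeff_0_charpoly[of A] by (simp add: g)
    hence c: "of_int c = e * of_int (det A)" by (simp add: e_def)
    have "of_int c + lam * poly (map_poly of_int g) lam = 0"
      using charpoly_lam by (simp add: g map_poly_pCons)
    hence "e * (of_int c + lam * poly (map_poly of_int g) lam) = 0" by simp
    hence "of_int (det A) + e * (lam * poly (map_poly of_int g) lam) = 0"
      using ee by (simp add: c distrib_left mult.assoc[symmetric])
    hence d: "- (e * (lam * poly (map_poly of_int g) lam)) = of_int (det A)"
      by (simp add: add_eq_0_iff)
    have "(- e * (1 / of_int (det A))) * (poly (map_poly of_int g) lam * x)
      = inverse lam * x * (- (e * (lam * poly (map_poly of_int g) lam)) / of_int (det A))"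
      using lam_nz by (simp add: field_simps)
    also have "\<dots> = inverse lam * x" unfolding d using nonsing by simp
    finally have "inverse lam * x = (- e * (1 / of_int (det A))) * (poly (map_poly of_int g) lam * x)"
      by (rule sym)
    moreover have "e = of_int ((- 1) ^ CARD('n))" by (simp add: e_def)
    hence "- e * (1 / of_int (det A)) \<in> R"
      unfolding R_def by (metis int_adjoin_mult int_adjoin_minus int_adjoin_of_int int_adjoin_incl singletonI)
    ultimately show ?thesis using X_mult[OF X_poly[OF x, of g], of "- e * (1 / of_int (det A))"] by (simp only:)
  qed
  have "inverse lam ^ k * x \<in> X" if "x \<in> X" for k x
    by (induction k) (auto simp: that mult.assoc X_inv)
  moreover have "dotu c \<in> X" for c
    unfolding dotu_def by (intro XI) (simp add: R_def int_adjoin_of_int)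
  ultimately show ?thesis unfolding Y_def X_def R_def by blast
qed

end

section \<open>Torus and solenoid\<close>

abbreviation (input) rmat :: "int ^ 'm ^ 'n \<Rightarrow> real ^ 'm ^ 'n" where
  "rmat \<equiv> map_matrix real_of_int"

lemma rmat_mult: "rmat (B ** C) = rmat B ** rmat C"
  by (simp add: vec_eq_iff matrix_matrix_mult_def)

lemma rmat_mat_1: "rmat (mat 1) = mat 1"
  by (simp add: vec_eq_iff mat_def)

section \<open>Characters of the real line and small subgroups of the circle\<close>

lemma cis_2pi_eq_iff: "cis (2 * pi * s) = cis (2 * pi * t) \<longleftrightarrow> s - t \<in> \<int>"
proof
  assume eq: "cis (2 * pi * s) = cis (2 * pi * t)"
  have "cis (2 * pi * (s - t)) = cis (2 * pi * s) / cis (2 * pi * t)"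
    by (simp add: cis_divide right_diff_distrib)
  also have "\<dots> = 1" by (simp add: eq)
  finally have "cos (2 * pi * (s - t)) = 1" by (metis cis.simps(1) one_complex.simps(1))
  then obtain n :: int where "2 * pi * (s - t) = of_int n * 2 * pi" unfolding cos_one_2pi_int by blast
  hence "s - t = of_int n" by simp
  thus "s - t \<in> \<int>" by simp
next
  assume "s - t \<in> \<int>"
  hence "cis (2 * pi * (s - t)) = 1" by simp
  hence "cis (2 * pi * (s - t)) * cis (2 * pi * t) = cis (2 * pi * t)" by simp
  thus "cis (2 * pi * s) = cis (2 * pi * t)" by (simp add: cis_mult right_diff_distrib)
qed

lemma continuous_additive_real:
  fixes G :: "real \<Rightarrow> real"
  assumes cont: "continuous_on UNIV G" and add: "\<And>s t. G (s + t) = G s + G t"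
  shows "G t = t * G 1"
proof -
  have 0: "G 0 = 0" using add[of 0 0] by simp
  have minus: "G (- t) = - G t" for t using add[of t "- t"] 0 by simp
  have nat: "G (of_nat n * t) = of_nat n * G t" for n t
    by (induction n) (auto simp: distrib_right add 0)
  have int: "G (of_int k * t) = of_int k * G t" for k t
    by (cases k rule: int_cases2) (auto simp: nat minus)
  have "closed {t. G t = t * G 1}"
    using cont by (intro closed_Collect_eq continuous_intros)
  moreover have "\<rat> \<subseteq> {t. G t = t * G 1}"
  proof
    fix q :: real assume "q \<in> \<rat>"
    then obtain a b :: int where q: "q = of_int a / of_int b" "b \<noteq> 0"
      by (metis Rats_cases' less_numeral_extra(3))
    have "of_int b * G q = G (of_int a * 1)" using q by (simp only: int[symmetric]) simp
    also have "\<dots> = of_int a * G 1" by (rule int)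
    finally have "G q = of_int a * G 1 / of_int b" using q(2) by (simp add: field_simps)
    thus "q \<in> {t. G t = t * G 1}" using q(1) by simp
  qed
  ultimately have "closure \<rat> \<subseteq> {t. G t = t * G 1}" by (rule closure_minimal[rotated])
  thus ?thesis by (auto simp: Rats_closure_real)
qed

text \<open>The line is contractible, so \<open>f\<close> has a continuous logarithm. Its phase is
  additive up to a continuous defect in the integer multiples of 2 pi, which is constant and
  vanishes at 0.\<close>

lemma continuous_real_character:
  fixes f :: "real \<Rightarrow> complex"
  assumes cont: "continuous_on UNIV f" and norm: "\<And>t. cmod (f t) = 1" and mult: "\<And>s t. f (s + t) = f s * f t"
  obtains c where "\<And>t. f t = cis (2 * pi * (c * t))"
proof -
  have nz: "f t \<noteq> 0" for t using norm[of t] by auto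
  obtain g where g: "continuous_on UNIV g" "\<And>t. f t = exp (g t)"
    using continuous_logarithm_on_contractible[OF cont _ nz] by (metis UNIV_I contractible_UNIV)
  have re: "Re (g t) = 0" for t using norm[of t] by (simp add: g norm_exp_eq_Re)
  define G where "G t = Im (g t) - Im (g 0)" for t
  have contG: "continuous_on UNIV G" unfolding G_def by (intro continuous_intros g)
  have fG: "f t = f 0 * cis (G t)" for t
  proof -
    have "exp (g s) = cis (Im (g s))" for s by (simp add: exp_eq_polar re)
    thus ?thesis by (simp add: g G_def cis_mult)
  qed
  have f0: "f 0 = 1" using mult[of 0 0] nz[of 0] by simp
  have G_add: "G (s + t) = G s + G t" for s t
  proof -
    define k where "k t = (G (s + t) - G s - G t) / (2 * pi)" for t
    have ck: "continuous_on UNIV k" unfolding k_def G_def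
      by (intro continuous_intros continuous_on_compose2[OF g(1)]) auto
    have k_int: "k t \<in> \<int>" for t
    proof -
      have "cis (2 * pi * k t) = cis (G (s + t)) / (cis (G s) * cis (G t))"
        by (simp add: k_def cis_divide cis_mult diff_diff_eq)
      also have "\<dots> = 1" using mult[of s t] fG[of s] fG[of t] fG[of "s + t"] f0 by (simp add: field_simps)
      finally show ?thesis using cis_2pi_eq_iff[of "k t" 0] by simp
    qed
    have "k constant_on UNIV"
    proof (rule continuous_discrete_range_constant[OF connected_UNIV ck])
      fix x
      have "1 \<le> norm (k y - k x)" if "k y \<noteq> k x" for y
        using that Ints_nonzero_abs_ge1[OF Ints_diff[OF k_int[of y] k_int[of x]]] by simp
      thus "\<exists>e>0. \<forall>y. y \<in> UNIV \<and> k y \<noteq> k x \<longrightarrow> e \<le> norm (k y - k x)"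
        by (intro exI[of _ 1]) auto
    qed
    hence "k t = k 0" unfolding constant_on_def by auto
    thus ?thesis by (simp add: k_def G_def)
  qed
  have "f t = cis (2 * pi * (G 1 / (2 * pi) * t))" for t
    using fG[of t] f0 continuous_additive_real[of G t, OF contG G_add] by (simp add: mult.commute)
  thus thesis by (rule that)
qed

text \<open>On the right half of the unit circle, squaring at least doubles \<open>1 - Re w\<close>.
  Iterated squares of a point other than 1 would therefore leave that half.\<close>

lemma no_small_subgroup:
  fixes N :: "complex set"
  assumes N: "\<And>w. w \<in> N \<Longrightarrow> cmod w = 1 \<and> Re w > 0 \<and> w * w \<in> N" and w: "w \<in> N"
  shows "w = 1"
proof -
  have ind: "\<exists>v\<in>N. 1 - Re v \<ge> 2 ^ m * (1 - Re w)" for m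
  proof (induction m)
    case 0
    then show ?case using w by auto
  next
    case (Suc m)
    then obtain v where v: "v \<in> N" "1 - Re v \<ge> 2 ^ m * (1 - Re w)" by blast
    have n: "(Re v)\<^sup>2 + (Im v)\<^sup>2 = 1" using N[OF v(1)] by (metis cmod_power2 power_one)
    have "Re (v * v) = 2 * (Re v)\<^sup>2 - 1" using n by (simp add: power2_eq_square)
    moreover have "(Re v)\<^sup>2 \<le> Re v"
    proof -
      have "Re v \<le> 1" using N[OF v(1)] complex_Re_le_cmod[of v] by simp
      thus ?thesis using N[OF v(1)] by (simp add: power2_eq_square mult_left_le)
    qed
    ultimately have "1 - Re (v * v) \<ge> 2 * (1 - Re v)" by simp
    hence "1 - Re (v * v) \<ge> 2 ^ Suc m * (1 - Re w)" using v(2) by simp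
    thus ?case using N[OF v(1)] by blast
  qed
  have le: "Re w \<le> 1" using N[OF w] complex_Re_le_cmod[of w] by simp
  have "Re w = 1"
  proof (rule ccontr)
    assume "Re w \<noteq> 1"
    hence pos: "1 - Re w > 0" using le by simp
    obtain m where "1 / (1 - Re w) < 2 ^ m" using real_arch_pow[of 2 "1 / (1 - Re w)"] by auto
    hence "1 < 2 ^ m * (1 - Re w)" using pos by (simp add: field_simps)
    moreover obtain v where "v \<in> N" "1 - Re v \<ge> 2 ^ m * (1 - Re w)" using ind by blast
    ultimately show False using N[of v] by auto
  qed
  moreover have "Im w = 0" using N[OF w] \<open>Re w = 1\<close> by (metis add_cancel_right_right cmod_power2 power_one zero_eq_power2)
  ultimately show ?thesis by (simp add: complex_eq_iff)
qed

section \<open>Characters and topology of the torus\<close>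

definition rdot :: "int ^ 'n \<Rightarrow> real ^ 'n \<Rightarrow> real" where
  "rdot c x = (\<Sum>a\<in>UNIV. of_int (c $ a) * x $ a)"

definition torus_char :: "int ^ 'n \<Rightarrow> real ^ 'n \<Rightarrow> complex" where
  "torus_char c x = cis (2 * pi * rdot c x)"

lemma norm_torus_char: "cmod (torus_char c x) = 1"
  by (simp add: torus_char_def)

lemma torus_char_add_left: "torus_char (c + d) x = torus_char c x * torus_char d x"
  by (simp add: torus_char_def rdot_def cis_mult distrib_left distrib_right sum.distrib)

lemma torus_char_add_right: "torus_char c (x + y) = torus_char c x * torus_char c y"
  by (simp add: torus_char_def rdot_def cis_mult distrib_left sum.distrib)

lemma rdot_vector_matrix: "rdot (c v* B) x = rdot c (rmat B *v x)"
proof -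
  have "rdot (c v* B) x = (\<Sum>b\<in>UNIV. \<Sum>a\<in>UNIV. of_int (c $ a) * (of_int (B $ a $ b) * x $ b))"
    by (simp add: rdot_def vector_matrix_mult_def sum_distrib_left sum_distrib_right mult_ac)
  also have "\<dots> = (\<Sum>a\<in>UNIV. \<Sum>b\<in>UNIV. of_int (c $ a) * (of_int (B $ a $ b) * x $ b))"
    by (rule sum.swap)
  also have "\<dots> = rdot c (rmat B *v x)"
    by (simp add: rdot_def matrix_vector_mult_def sum_distrib_left)
  finally show ?thesis .
qed

lemma rdot_axis: "rdot (axis a 1) x = x $ a"
  by (simp add: rdot_def axis_def if_distrib[of of_int] if_distrib[of "\<lambda>t. t * _"] cong: if_cong)

lemma rdot_row: "rdot (B $ a) x = (rmat B *v x) $ a"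
  by (simp add: rdot_def matrix_vector_mult_def)

lemma torus_char_cong: assumes "torus_class x = torus_class y" shows "torus_char c x = torus_char c y"
proof -
  have "\<And>a. x $ a - y $ a \<in> \<int>"
    using assms by (simp add: torus_class_eq_iff int_lattice_def)
  moreover have "rdot c x - rdot c y = (\<Sum>a\<in>UNIV. of_int (c $ a) * (x $ a - y $ a))"
    by (simp add: rdot_def right_diff_distrib sum_subtractf)
  ultimately show ?thesis
    unfolding torus_char_def cis_2pi_eq_iff by (simp add: Ints_sum Ints_mult)
qed

lemma torus_class_eqI:
  assumes "\<And>a. torus_char (axis a 1) x = torus_char (axis a 1) y"
  shows "torus_class x = torus_class y"
  using assms by (simp add: torus_char_def rdot_axis cis_2pi_eq_iff torus_class_eq_iff int_lattice_def)

lemma torus_mult: "torus_class x \<otimes>\<^bsub>torus\<^esub> torus_class y = torus_class (x + y)"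
proof -
  have "w \<in> torus_class x \<otimes>\<^bsub>torus\<^esub> torus_class y \<longleftrightarrow> w \<in> torus_class (x + y)" for w
  proof -
    have "w \<in> torus_class x \<otimes>\<^bsub>torus\<^esub> torus_class y \<longleftrightarrow> (\<exists>a\<in>torus_class x. \<exists>b\<in>torus_class y. w = a + b)"
      by (auto simp: torus_def FactGroup_def set_mult_def additive_group_def)
    also have "\<dots> \<longleftrightarrow> w - (x + y) \<in> int_lattice"
    proof
      assume "\<exists>a\<in>torus_class x. \<exists>b\<in>torus_class y. w = a + b"
      then obtain a b where ab: "a - x \<in> int_lattice" "b - y \<in> int_lattice" "w = a + b"
        by (auto simp: torus_class_eq)
      have "w - (x + y) = (a - x) + (b - y)" by (simp add: ab)
      thus "w - (x + y) \<in> int_lattice" using int_lattice_add[OF ab(1,2)] by (simp only:)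
    next
      assume w: "w - (x + y) \<in> int_lattice"
      have "w - y \<in> torus_class x" using w by (simp add: torus_class_eq algebra_simps)
      moreover have "y \<in> torus_class y" by (simp add: torus_class_eq int_lattice_def)
      ultimately show "\<exists>a\<in>torus_class x. \<exists>b\<in>torus_class y. w = a + b" by (metis diff_add_cancel)
    qed
    finally show ?thesis by (simp add: torus_class_eq)
  qed
  thus ?thesis by blast
qed

definition torus_char_class :: "int ^ 'n \<Rightarrow> (real ^ 'n) set \<Rightarrow> complex" where
  "torus_char_class c w = torus_char c (SOME x. torus_class x = w)"

lemma torus_char_class_class: "torus_char_class c (torus_class x) = torus_char c x"
  unfolding torus_char_class_def by (rule torus_char_cong) (rule someI[of "\<lambda>y. torus_class y = torus_class x"], rule refl)

lemma continuous_on_torus_char: "continuous_on UNIV (torus_char c)"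
  unfolding torus_char_def rdot_def by (intro continuous_intros)

lemma topspace_torus: "topspace (torus_topology :: (real ^ 'n) set topology) = carrier torus"
  using quotient_imp_surjective_map[OF quotient_map_torus_class, symmetric] by (simp add: carrier_torus)

lemma continuous_map_from_torus:
  "continuous_map torus_topology X g \<longleftrightarrow> continuous_map euclidean X (\<lambda>x. g (torus_class x))"
  using continuous_compose_quotient_map_eq[OF quotient_map_torus_class, of X g] by (simp add: o_def)

lemma continuous_map_torus_class: "continuous_map euclidean torus_topology torus_class"
  by (rule quotient_imp_continuous_map[OF quotient_map_torus_class])

lemma continuous_map_torus_char_class: "continuous_map torus_topology (top_of_set (sphere 0 1)) (torus_char_class c)"
  unfolding continuous_map_from_torus torus_char_class_class
  by (simp add: continuous_map_in_subtopology continuous_on_torus_char norm_torus_char)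

lemma continuous_map_torus_map: "continuous_map torus_topology torus_topology (torus_map A)"
  unfolding continuous_map_from_torus torus_map_class
  by (rule continuous_map_compose[OF _ continuous_map_torus_class, unfolded o_def])
    (simp add: matrix_vector_mult_linear_continuous_on)

text \<open>The coordinate characters map the torus continuously and injectively into
  \<complex>^n.\<close>

lemma Hausdorff_torus: "Hausdorff_space (torus_topology :: (real ^ 'n) set topology)"
proof (rule Hausdorff_space_injective_preimage)
  let ?f = "\<lambda>w. \<chi> a. torus_char_class (axis a 1) w :: complex ^ 'n"
  show "Hausdorff_space (euclidean :: (complex ^ 'n) topology)" by (rule Hausdorff_space_euclidean)
  show "continuous_map torus_topology euclidean ?f"
    unfolding continuous_map_from_torus torus_char_class_class
    by (simp add: continuous_on_vec_lambda continuous_on_torus_char)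
  show "inj_on ?f (topspace torus_topology)"
    unfolding topspace_torus carrier_torus
    by (rule inj_onI) (auto simp: torus_char_class_class vec_eq_iff intro!: torus_class_eqI)
qed

lemma compact_torus: "compact_space (torus_topology :: (real ^ 'n) set topology)"
proof -
  have "torus_class ` cbox 0 1 = (carrier torus :: (real ^ 'n) set set)"
    unfolding carrier_torus
  proof (intro subset_antisym subsetI)
    fix w :: "(real ^ 'n) set" assume "w \<in> range torus_class"
    then obtain x where w: "w = torus_class x" by blast
    have "torus_class x = torus_class (\<chi> a. frac (x $ a))"
      by (simp add: torus_class_eq_iff int_lattice_def frac_def)
    moreover have "(\<chi> a. frac (x $ a)) \<in> cbox 0 1"
      by (auto simp: mem_box_cart frac_lt_1 less_imp_le)
    ultimately show "w \<in> torus_class ` cbox 0 1" unfolding w by (rule image_eqI)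
  qed auto
  moreover have "compactin torus_topology (torus_class ` (cbox 0 1 :: (real ^ 'n) set))"
    by (rule image_compactin[OF _ continuous_map_torus_class]) (simp add: compact_cbox)
  ultimately show ?thesis by (simp add: compact_space_def topspace_torus)
qed

section \<open>Points, compactness and group law of the solenoid\<close>

lemma solenoid_class:
  assumes "z \<in> solenoid A" "j \<ge> 1"
  obtains x where "z j = torus_class x"
  using assms unfolding solenoid_def carrier_torus PiE_def Pi_def by auto

lemma solenoid_reps:
  assumes "z \<in> solenoid A"
  shows "\<exists>x. \<forall>j\<ge>1. z j = torus_class (x j)"
proof -
  have "\<forall>j. \<exists>x. j \<ge> 1 \<longrightarrow> z j = torus_class x" using solenoid_class[OF assms] by metis
  thus ?thesis by (rule choice)
qed

lemma solenoid_step: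
  assumes "z \<in> solenoid A" "j \<ge> 1" "z (j + l) = torus_class x"
  shows "z j = torus_class (rmat (matpow A l) *v x)"
  using assms(3)
proof (induction l arbitrary: x)
  case 0
  then show ?case by (simp add: rmat_mat_1)
next
  case (Suc l)
  have "torus_map A (z (j + l + 1)) = z (j + l)"
    using assms(1,2) unfolding solenoid_def by simp
  hence "z (j + l) = torus_class (rmat A *v x)" using Suc(2) by (simp add: torus_map_class)
  from Suc(1)[OF this] show ?case
    by (simp only: matpow_Suc_right rmat_mult matrix_vector_mul_assoc)
qed

lemma topspace_product_torus:
  "topspace (product_topology (\<lambda>_. torus_topology) {1..}) = (\<Pi>\<^sub>E j\<in>{1..}. carrier torus)"
  by (simp add: topspace_torus)

lemma solenoid_subset_topspace: "solenoid A \<subseteq> topspace (product_topology (\<lambda>_. torus_topology) {1..})"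
  unfolding topspace_product_torus solenoid_def by blast

lemma topspace_solenoid: "topspace (solenoid_topology A) = solenoid A"
  unfolding solenoid_topology_def topspace_subtopology using solenoid_subset_topspace by blast

lemma continuous_map_solenoid_proj:
  "j \<ge> 1 \<Longrightarrow> continuous_map (solenoid_topology A) torus_topology (\<lambda>z. z j)"
  unfolding solenoid_topology_def
  by (intro continuous_map_from_subtopology continuous_map_product_projection) simp

text \<open>A closed subset of a compact product: each defining equation cuts out the coincidence
  set of two continuous maps into a Hausdorff space.\<close>

lemma compact_solenoid: "compact_space (solenoid_topology A)"
proof -
  let ?X = "product_topology (\<lambda>_. torus_topology) {1..}"
  have "closedin ?X {z \<in> topspace ?X. torus_map A (z (j + 1)) = z j}" if "j \<in> {1..}" for j :: nat
  proof (rule closedin_continuous_maps_eq[OF Hausdorff_torus])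
    show "continuous_map ?X torus_topology (\<lambda>z. z j)"
      using that by (intro continuous_map_product_projection)
    show "continuous_map ?X torus_topology (\<lambda>z. torus_map A (z (j + 1)))"
      using continuous_map_compose[OF continuous_map_product_projection[of "j + 1" "{1..}" "\<lambda>_. torus_topology"]
          continuous_map_torus_map[of A]] by (simp add: o_def)
  qed
  hence "closedin ?X (\<Inter>j\<in>{1::nat..}. {z \<in> topspace ?X. torus_map A (z (j + 1)) = z j})"
    by (intro closedin_Inter) auto
  also have "(\<Inter>j\<in>{1::nat..}. {z \<in> topspace ?X. torus_map A (z (j + 1)) = z j}) = solenoid A"
    unfolding topspace_product_torus solenoid_def by auto
  finally have "closedin ?X (solenoid A)" .
  moreover have "compact_space ?X" by (simp add: compact_space_product_topology compact_torus)
  ultimately show ?thesis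
    unfolding solenoid_topology_def by (intro compact_space_subtopology closedin_compact_space)
qed

lemma carrier_solenoid_group: "carrier (solenoid_group A) = solenoid A"
  by (simp add: solenoid_group_def)

lemma mult_solenoid_group: "z \<otimes>\<^bsub>solenoid_group A\<^esub> w = (\<lambda>j\<in>{1..}. z j \<otimes>\<^bsub>torus\<^esub> w j)"
  by (simp add: solenoid_group_def product_group_def)

lemma mult_solenoid_class:
  assumes "j \<ge> 1" "z j = torus_class x" "w j = torus_class y"
  shows "(z \<otimes>\<^bsub>solenoid_group A\<^esub> w) j = torus_class (x + y)"
  using assms by (simp add: mult_solenoid_group torus_mult)

lemma solenoidI:
  assumes "\<And>j. j \<ge> 1 \<Longrightarrow> z j = torus_class (x j)" "\<And>j. j \<ge> 1 \<Longrightarrow> torus_class (rmat A *v x (Suc j)) = torus_class (x j)"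
    "z \<in> extensional {1..}"
  shows "z \<in> solenoid A"
  unfolding solenoid_def
proof (intro CollectI conjI allI impI)
  show "z \<in> (\<Pi>\<^sub>E j\<in>{1..}. carrier torus)"
    using assms(1,3) by (auto simp: PiE_def carrier_torus)
  fix j :: nat assume "j \<ge> 1"
  thus "torus_map A (z (j + 1)) = z j"
    using assms(1)[of j] assms(1)[of "Suc j"] assms(2)[of j] by (simp add: torus_map_class)
qed

lemma mult_in_solenoid:
  assumes "z \<in> solenoid A" "w \<in> solenoid A"
  shows "z \<otimes>\<^bsub>solenoid_group A\<^esub> w \<in> solenoid A"
proof -
  obtain x where x: "\<And>j. j \<ge> 1 \<Longrightarrow> z j = torus_class (x j)" using solenoid_reps[OF assms(1)] by blast
  obtain y where y: "\<And>j. j \<ge> 1 \<Longrightarrow> w j = torus_class (y j)" using solenoid_reps[OF assms(2)] by blast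
  have st: "torus_class (rmat A *v x (Suc j)) = torus_class (x j)" "torus_class (rmat A *v y (Suc j)) = torus_class (y j)"
    if "j \<ge> 1" for j
    using solenoid_step[OF assms(1) that, of 1 "x (Suc j)"] solenoid_step[OF assms(2) that, of 1 "y (Suc j)"]
      x[of "Suc j"] y[of "Suc j"] x[OF that] y[OF that] by simp_all
  show ?thesis
  proof (rule solenoidI[where x = "\<lambda>j. x j + y j"])
    fix j :: nat assume j: "j \<ge> 1"
    show "(z \<otimes>\<^bsub>solenoid_group A\<^esub> w) j = torus_class (x j + y j)"
      using mult_solenoid_class[of j z "x j" w "y j"] j x y by blast
    show "torus_class (rmat A *v (x (Suc j) + y (Suc j))) = torus_class (x j + y j)"
      using st[OF j] by (simp only: matrix_vector_right_distrib torus_mult[symmetric])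
  qed (simp add: mult_solenoid_group)
qed

section \<open>Duality\<close>

text \<open>The vectors on which the two homomorphisms agree form a subgroup of \<int>^n that
  contains the standard basis.\<close>

lemma int_vec_hom_eqI:
  fixes F G :: "int ^ 'n \<Rightarrow> complex"
  assumes F: "\<And>c d. F (c + d) = F c * F d" "F 0 = 1" and G: "\<And>c d. G (c + d) = G c * G d" "G 0 = 1"
    and ax: "\<And>a. F (axis a 1) = G (axis a 1)"
  shows "F c = G c"
proof -
  define H where "H = {c. F c = G c}"
  have add: "c + d \<in> H" if "c \<in> H" "d \<in> H" for c d using that by (simp add: H_def F G)
  have zero: "0 \<in> H" by (simp add: H_def F G)
  have minus: "- c \<in> H" if "c \<in> H" for c
  proof -
    have "F c * F (- c) = 1" "G c * G (- c) = 1" using F(1)[of c "- c"] G(1)[of c "- c"] F(2) G(2) by simp_all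
    moreover have "F c = G c" using that by (simp add: H_def)
    ultimately have "F (- c) = G (- c)" by (metis mult_cancel_left zero_neq_one mult_zero_left)
    thus ?thesis by (simp add: H_def)
  qed
  have nat: "axis a (of_nat m) \<in> H" for a m
  proof (induction m)
    case (Suc m)
    have "axis a (of_nat (Suc m)) = axis a (of_nat m) + (axis a 1 :: int ^ 'n)"
      by (simp add: axis_def vec_eq_iff)
    thus ?case using add[OF Suc, of "axis a 1"] ax by (simp add: H_def)
  next
    case 0
    have e0: "axis a (of_nat 0) = (0 :: int ^ 'n)" by (simp add: axis_def vec_eq_iff)
    show ?case unfolding e0 by (rule zero)
  qed
  have int: "axis a k \<in> H" for a k
  proof (cases k rule: int_cases2)
    case (nonneg m)
    then show ?thesis using nat by simp
  next
    case (nonpos m)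
    have "axis a k = - axis a (of_nat m)" by (simp add: nonpos axis_def vec_eq_iff)
    then show ?thesis using minus[OF nat] by simp
  qed
  have "sum (\<lambda>a. axis a (c $ a)) X \<in> H" for X
    by (induction X rule: infinite_finite_induct) (auto intro: zero add int)
  moreover have "c = (\<Sum>a\<in>UNIV. axis a (c $ a))"
    by (simp add: vec_eq_iff axis_def)
  ultimately have "c \<in> H" by metis
  thus ?thesis by (simp add: H_def)
qed

section \<open>The compact-open topology on the dual\<close>

lemma topspace_dual: "topspace (dual_topology G X) = characters G X"
proof -
  \<comment> \<open>With \<open>C\<close> and \<open>U\<close> empty the condition is vacuous, so
    the whole dual is one of the generating sets.\<close>
  have "characters G X = {\<phi> \<in> characters G X. \<phi> ` {} \<subseteq> {}}" by auto
  thus ?thesis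
    unfolding dual_topology_def topology_generated_by_topspace
    by (auto intro!: exI[of _ "{}"])
qed

lemma dual_topology_openin:
  assumes "compactin X C" "openin (top_of_set (sphere 0 1)) U"
  shows "openin (dual_topology G X) {\<phi> \<in> characters G X. \<phi> ` C \<subseteq> U}"
  unfolding dual_topology_def by (rule topology_generated_by_Basis) (use assms in blast)

text \<open>Points are compact in the discrete topology, so evaluation at a point where two
  characters differ separates them.\<close>

lemma Hausdorff_dual_discrete:
  "Hausdorff_space (dual_topology (additive_group S) (discrete_topology S))"
  unfolding Hausdorff_space_def topspace_dual
proof (intro allI impI, elim conjE)
  let ?C = "characters (additive_group S) (discrete_topology S)"
  fix \<phi> \<psi> assume \<phi>: "\<phi> \<in> ?C" and \<psi>: "\<psi> \<in> ?C" and ne: "\<phi> \<noteq> \<psi>"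
  have ext: "\<phi> \<in> extensional S" "\<psi> \<in> extensional S" using \<phi> \<psi> by (auto simp: characters_def additive_group_def)
  obtain y where y: "y \<in> S" "\<phi> y \<noteq> \<psi> y" using ne extensionalityI[OF ext] by blast
  have sph: "\<phi> y \<in> sphere 0 1" "\<psi> y \<in> sphere 0 1"
    using \<phi> \<psi> y(1) by (auto simp: characters_def Pi_iff)
  obtain U V where UV: "open U" "open V" "\<phi> y \<in> U" "\<psi> y \<in> V" "U \<inter> V = {}"
    using hausdorff[OF y(2)] by blast
  let ?B = "\<lambda>U. {\<phi> \<in> ?C. \<phi> ` {y} \<subseteq> sphere 0 1 \<inter> U}"
  have op: "openin (dual_topology (additive_group S) (discrete_topology S)) (?B U)" if "open U" for U
    by (rule dual_topology_openin) (simp_all add: compactin_discrete_topology y openin_open_Int that)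
  show "\<exists>U V. openin (dual_topology (additive_group S) (discrete_topology S)) U \<and>
    openin (dual_topology (additive_group S) (discrete_topology S)) V \<and> \<phi> \<in> U \<and> \<psi> \<in> V \<and> disjnt U V"
  proof (intro exI conjI)
    show "openin (dual_topology (additive_group S) (discrete_topology S)) (?B U)" by (rule op[OF UV(1)])
    show "openin (dual_topology (additive_group S) (discrete_topology S)) (?B V)" by (rule op[OF UV(2)])
    show "\<phi> \<in> ?B U" "\<psi> \<in> ?B V" using \<phi> \<psi> sph UV by auto
    show "disjnt (?B U) (?B V)" using UV by (auto simp: disjnt_def)
  qed
qed

section \<open>The pairing between the solenoid and the module\<close>

context solenoid_eigenvector
begin

text \<open>Raising the level from \<open>k\<close> to \<open>l\<close> multiplies the row
  \<open>c\<close> by A^(l-k), while passing back from coordinate \<open>Suc l\<close> to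
  \<open>Suc k\<close> applies the same matrix to the point. The two changes cancel in the pairing,
  and by injectivity of \<open>dotu\<close> no other ambiguity exists.\<close>

lemma Phi_well_defined:
  assumes z: "z \<in> solenoid A" and eq: "inverse lam ^ k * dotu c = inverse lam ^ l * dotu d"
    and x: "z (Suc k) = torus_class x" and y: "z (Suc l) = torus_class y"
  shows "torus_char c x = torus_char d y"
proof -
  have *: "torus_char c x = torus_char d y"
    if le: "k \<le> l" and eq: "inverse lam ^ k * dotu c = inverse lam ^ l * dotu d"
      and x: "z (Suc k) = torus_class x" and y: "z (Suc l) = torus_class y" for k l c d x y
  proof -
    have "inverse lam ^ l * (lam ^ (l - k) * dotu c) = inverse lam ^ l * dotu d"
      using lam_power_shift[of k "dotu c" "l - k"] le eq by (simp only: le_add_diff_inverse)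
    hence "dotu (c v* matpow A (l - k)) = dotu d" using lam_nz by (simp add: dotu_matpow)
    hence d: "d = c v* matpow A (l - k)" by (simp add: dotu_inj)
    have "z (Suc k) = torus_class (rmat (matpow A (l - k)) *v y)"
      using solenoid_step[OF z, of "Suc k" "l - k" y] le y by simp
    hence "torus_char c x = torus_char c (rmat (matpow A (l - k)) *v y)" using x by (intro torus_char_cong) simp
    also have "\<dots> = torus_char d y" by (simp add: d torus_char_def rdot_vector_matrix)
    finally show ?thesis .
  qed
  show ?thesis
  proof (cases "k \<le> l")
    case True
    then show ?thesis using * eq x y by blast
  next
    case False
    then show ?thesis using *[of l k d c y x] eq x y by simp
  qed
qed

text \<open>Level \<open>k\<close> is read off at coordinate \<open>Suc k\<close>, as coordinates
  start at 1. The restriction to \<open>Y\<close> makes the value an extensional character.\<close>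

definition Phi :: "(nat \<Rightarrow> (real ^ 'n) set) \<Rightarrow> complex \<Rightarrow> complex" where
  "Phi z = (\<lambda>y\<in>Y. THE w. \<exists>k c x. y = inverse lam ^ k * dotu c \<and> z (Suc k) = torus_class x \<and> w = torus_char c x)"

lemma Phi_eq:
  assumes z: "z \<in> solenoid A" and x: "z (Suc k) = torus_class x"
  shows "Phi z (inverse lam ^ k * dotu c) = torus_char c x"
proof -
  have "(THE w. \<exists>l d y. inverse lam ^ k * dotu c = inverse lam ^ l * dotu d \<and> z (Suc l) = torus_class y \<and> w = torus_char d y) = torus_char c x"
  proof (rule the_equality)
    show "\<exists>l d y. inverse lam ^ k * dotu c = inverse lam ^ l * dotu d \<and> z (Suc l) = torus_class y \<and> torus_char c x = torus_char d y"
      using x by blast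
    fix w assume "\<exists>l d y. inverse lam ^ k * dotu c = inverse lam ^ l * dotu d \<and> z (Suc l) = torus_class y \<and> w = torus_char d y"
    thus "w = torus_char c x" using Phi_well_defined[OF z _ x] by metis
  qed
  thus ?thesis unfolding Phi_def using YI by simp
qed

lemma Phi_torus_char_class: "z \<in> solenoid A \<Longrightarrow> Phi z (inverse lam ^ k * dotu c) = torus_char_class c (z (Suc k))"
  using solenoid_class[of z A "Suc k"] Phi_eq[of z k _ c] torus_char_class_class[of c] by (metis le_add1 plus_1_eq_Suc)

lemma Phi_add:
  assumes z: "z \<in> solenoid A" and y: "y1 \<in> Y" "y2 \<in> Y"
  shows "Phi z (y1 + y2) = Phi z y1 * Phi z y2"
proof -
  obtain k c where yk: "y1 = inverse lam ^ k * dotu c" using y(1) by (rule YE)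
  obtain l d where yl: "y2 = inverse lam ^ l * dotu d" using y(2) by (rule YE)
  have y1: "y1 = inverse lam ^ (k + l) * dotu (c v* matpow A l)"
    using lam_power_shift[of k "dotu c" l] by (simp only: yk dotu_matpow)
  have y2: "y2 = inverse lam ^ (k + l) * dotu (d v* matpow A k)"
    using lam_power_shift[of l "dotu d" k] by (simp only: yl dotu_matpow add.commute)
  have y3: "y1 + y2 = inverse lam ^ (k + l) * dotu (c v* matpow A l + d v* matpow A k)"
    by (simp only: y1 y2 dotu_add distrib_left)
  obtain x where x: "z (Suc (k + l)) = torus_class x" using solenoid_class[OF z, of "Suc (k + l)"] by auto
  show ?thesis unfolding y3 unfolding y1 y2 by (simp only: Phi_eq[OF z x] torus_char_add_left)
qed

lemma Phi_norm: "z \<in> solenoid A \<Longrightarrow> y \<in> Y \<Longrightarrow> cmod (Phi z y) = 1"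
  by (erule YE) (metis Phi_eq norm_torus_char solenoid_class[of z A "Suc _"] le_add1 plus_1_eq_Suc)

lemma Phi_mult:
  assumes z: "z \<in> solenoid A" and w: "w \<in> solenoid A" and y: "y \<in> Y"
  shows "Phi (z \<otimes>\<^bsub>solenoid_group A\<^esub> w) y = Phi z y * Phi w y"
proof -
  obtain k c where yk: "y = inverse lam ^ k * dotu c" using y by (rule YE)
  obtain x where x: "z (Suc k) = torus_class x" using solenoid_class[OF z, of "Suc k"] by auto
  obtain x' where x': "w (Suc k) = torus_class x'" using solenoid_class[OF w, of "Suc k"] by auto
  have "(z \<otimes>\<^bsub>solenoid_group A\<^esub> w) (Suc k) = torus_class (x + x')"
    using mult_solenoid_class[of "Suc k" z x w x'] x x' by simp
  thus ?thesis unfolding yk using Phi_eq[OF mult_in_solenoid[OF z w]] Phi_eq[OF z x] Phi_eq[OF w x']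
    by (simp add: torus_char_add_right)
qed

abbreviation "YG \<equiv> additive_group Y"
abbreviation "YT \<equiv> discrete_topology Y"

lemma characters_Y:
  "\<phi> \<in> characters YG YT \<longleftrightarrow> \<phi> \<in> extensional Y \<and> (\<forall>y\<in>Y. cmod (\<phi> y) = 1) \<and>
     (\<forall>x\<in>Y. \<forall>y\<in>Y. \<phi> (x + y) = \<phi> x * \<phi> y)"
  unfolding characters_def hom_def circle_group_def additive_group_def
  by (auto simp: Pi_iff)

lemma Phi_character: "z \<in> solenoid A \<Longrightarrow> Phi z \<in> characters YG YT"
  unfolding characters_Y using Phi_norm Phi_add by (auto simp: Phi_def)

lemma Phi_inj: "inj_on Phi (solenoid A)"
proof (rule inj_onI)
  fix z w assume z: "z \<in> solenoid A" and w: "w \<in> solenoid A" and eq: "Phi z = Phi w"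
  have ext: "z \<in> extensional {1..}" "w \<in> extensional {1..}" using z w by (auto simp: solenoid_def PiE_def)
  show "z = w"
  proof (rule extensionalityI[OF ext])
    fix j :: nat assume "j \<in> {1..}"
    then obtain k where k: "j = Suc k" by (cases j) auto
    obtain x where x: "z (Suc k) = torus_class x" using solenoid_class[OF z, of "Suc k"] by auto
    obtain y where y: "w (Suc k) = torus_class y" using solenoid_class[OF w, of "Suc k"] by auto
    have "torus_class x = torus_class y"
      by (rule torus_class_eqI) (metis Phi_eq[OF z x] Phi_eq[OF w y] eq)
    thus "z j = w j" by (simp add: k x y)
  qed
qed

text \<open>The phases of \<phi> at the elements \<open>inverse lam ^ k * u $ a\<close> form a
  representative of coordinate \<open>Suc k\<close>; the relation A u = lam u makes the resulting
  sequence compatible.\<close>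

lemma Phi_surj:
  assumes \<phi>: "\<phi> \<in> characters YG YT"
  shows "\<exists>z\<in>solenoid A. Phi z = \<phi>"
proof -
  have ph: "\<phi> \<in> extensional Y" "\<And>y. y \<in> Y \<Longrightarrow> cmod (\<phi> y) = 1"
    "\<And>x y. x \<in> Y \<Longrightarrow> y \<in> Y \<Longrightarrow> \<phi> (x + y) = \<phi> x * \<phi> y" using \<phi> unfolding characters_Y by auto
  have "\<exists>s. \<phi> (inverse lam ^ k * u $ a) = cis (2 * pi * s)" for k a
  proof -
    have "cmod (\<phi> (inverse lam ^ k * u $ a)) = 1" by (rule ph(2)[OF u_in_Y])
    hence "\<phi> (inverse lam ^ k * u $ a) = cis (Arg (\<phi> (inverse lam ^ k * u $ a)))"
      using rcis_cmod_Arg[of "\<phi> (inverse lam ^ k * u $ a)"] by (simp add: rcis_def)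
    thus ?thesis by (intro exI[of _ "Arg (\<phi> (inverse lam ^ k * u $ a)) / (2 * pi)"]) simp
  qed
  then obtain s where s: "\<And>k a. \<phi> (inverse lam ^ k * u $ a) = cis (2 * pi * s k a)" by metis
  define x where "x k = (\<chi> a. s k a)" for k
  have \<phi>0: "\<phi> 0 = 1" using ph(3)[OF Y_0 Y_0] ph(2)[OF Y_0] by auto
  have val: "\<phi> (inverse lam ^ k * dotu c) = torus_char c (x k)" for k c
  proof (rule int_vec_hom_eqI[where c = c and F = "\<lambda>c. \<phi> (inverse lam ^ k * dotu c)" and G = "\<lambda>c. torus_char c (x k)"])
    show "\<phi> (inverse lam ^ k * dotu (axis a 1)) = torus_char (axis a 1) (x k)" for a
      by (simp add: dotu_axis s torus_char_def rdot_axis x_def)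
  qed (simp_all add: dotu_add distrib_left ph(3) YI torus_char_add_left, simp_all add: dotu_def \<phi>0 torus_char_def rdot_def)
  define z where "z = (\<lambda>j\<in>{1..}. torus_class (x (j - 1)))"
  have z: "z \<in> solenoid A"
  proof (rule solenoidI[where x = "\<lambda>j. x (j - 1)"])
    fix j :: nat assume j: "j \<ge> 1"
    show "z j = torus_class (x (j - 1))" using j by (simp add: z_def)
    show "torus_class (rmat A *v x (Suc j - 1)) = torus_class (x (j - 1))"
    proof (rule torus_class_eqI)
      fix a
      have "torus_char (axis a 1) (rmat A *v x (Suc j - 1)) = torus_char (A $ a) (x j)"
        by (simp add: torus_char_def rdot_axis rdot_row)
      also have "\<dots> = \<phi> (inverse lam ^ j * dotu (A $ a))" by (simp only: val)
      also have "inverse lam ^ j * dotu (A $ a) = inverse lam ^ (j - 1) * dotu (axis a 1)"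
        unfolding dotu_row dotu_axis Au using lam_power_shift[of "j - 1" "u $ a" 1, symmetric] j by simp
      also have "\<phi> \<dots> = torus_char (axis a 1) (x (j - 1))" by (rule val)
      finally show "torus_char (axis a 1) (rmat A *v x (Suc j - 1)) = torus_char (axis a 1) (x (j - 1))" .
    qed
  qed (simp add: z_def)
  have "Phi z = \<phi>"
  proof (rule extensionalityI[where A = Y])
    show "Phi z \<in> extensional Y" by (simp add: Phi_def)
    fix y assume "y \<in> Y"
    then obtain k c where y: "y = inverse lam ^ k * dotu c" by (rule YE)
    have "z (Suc k) = torus_class (x k)" by (simp add: z_def)
    from Phi_eq[OF z this] show "Phi z y = \<phi> y" by (simp add: y val)
  qed (rule ph)
  thus ?thesis using z by blast
qed

lemma continuous_map_Phi_at:
  assumes "y \<in> Y"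
  shows "continuous_map (solenoid_topology A) (top_of_set (sphere 0 1)) (\<lambda>z. Phi z y)"
proof -
  obtain k c where y: "y = inverse lam ^ k * dotu c" using assms by (rule YE)
  have "continuous_map (solenoid_topology A) (top_of_set (sphere 0 1)) (\<lambda>z. torus_char_class c (z (Suc k)))"
    using continuous_map_compose[OF continuous_map_solenoid_proj[of "Suc k" A] continuous_map_torus_char_class[of c]]
    by (simp add: o_def)
  thus ?thesis
    by (rule continuous_map_eq) (simp add: y Phi_torus_char_class topspace_solenoid)
qed

text \<open>Compact subsets of a discrete space are finite, so the preimage of a generating open set
  is a finite intersection of open conditions on single values \<open>Phi z y\<close>.\<close>

lemma continuous_map_Phi: "continuous_map (solenoid_topology A) (dual_topology YG YT) Phi"
  unfolding dual_topology_def
proof (rule continuous_on_generated_topo)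
  fix V assume "V \<in> {{\<phi> \<in> characters YG YT. \<phi> ` C \<subseteq> U} |C U. compactin YT C \<and> openin (top_of_set (sphere 0 1)) U}"
  then obtain C U where V: "V = {\<phi> \<in> characters YG YT. \<phi> ` C \<subseteq> U}" and C: "compactin YT C"
    and U: "openin (top_of_set (sphere 0 1)) U" by blast
  have fin: "finite C" and sub: "C \<subseteq> Y" using C by (auto simp: compactin_discrete_topology)
  have op: "openin (solenoid_topology A) {z \<in> solenoid A. Phi z y \<in> U}" if "y \<in> C" for y
    using openin_continuous_map_preimage[OF continuous_map_Phi_at U, of y] that sub by (auto simp: topspace_solenoid)
  have "Phi -` V \<inter> topspace (solenoid_topology A) = topspace (solenoid_topology A) \<inter> (\<Inter>y\<in>C. {z \<in> solenoid A. Phi z y \<in> U})"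
    using Phi_character by (auto simp: V topspace_solenoid)
  also have "openin (solenoid_topology A) \<dots>"
  proof (cases "C = {}")
    case False
    then show ?thesis by (intro openin_Int openin_topspace openin_INT2 fin op)
  qed simp
  finally show "openin (solenoid_topology A) (Phi -` V \<inter> topspace (solenoid_topology A))" .
next
  show "Phi ` topspace (solenoid_topology A) \<subseteq>
    \<Union> {{\<phi> \<in> characters YG YT. \<phi> ` C \<subseteq> U} |C U. compactin YT C \<and> openin (top_of_set (sphere 0 1)) U}"
    using topspace_dual[of YG YT] Phi_character
    unfolding dual_topology_def topology_generated_by_topspace topspace_solenoid by blast
qed

lemma Phi_image: "Phi ` solenoid A = characters YG YT"
  using Phi_character Phi_surj by blast

text \<open>A continuous bijection from a compact space to a Hausdorff space is a
  homeomorphism.\<close>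

lemma Phi_top_group_iso:
  "top_group_iso (solenoid_group A) (solenoid_topology A) (dual_group YG YT) (dual_topology YG YT) Phi"
  unfolding top_group_iso_def
proof
  have "Phi \<in> hom (solenoid_group A) (dual_group YG YT)"
  proof (rule homI)
    fix z assume "z \<in> carrier (solenoid_group A)"
    thus "Phi z \<in> carrier (dual_group YG YT)" by (simp add: dual_group_def carrier_solenoid_group Phi_character)
  next
    fix z w assume "z \<in> carrier (solenoid_group A)" "w \<in> carrier (solenoid_group A)"
    hence zw: "z \<in> solenoid A" "w \<in> solenoid A" by (simp_all add: carrier_solenoid_group)
    show "Phi (z \<otimes>\<^bsub>solenoid_group A\<^esub> w) = Phi z \<otimes>\<^bsub>dual_group YG YT\<^esub> Phi w"
    proof (rule extensionalityI[where A = Y])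
      fix y assume y: "y \<in> Y"
      show "Phi (z \<otimes>\<^bsub>solenoid_group A\<^esub> w) y = (Phi z \<otimes>\<^bsub>dual_group YG YT\<^esub> Phi w) y"
        using Phi_mult[OF zw y] y by (simp add: dual_group_def additive_group_def)
    qed (simp_all add: dual_group_def additive_group_def Phi_def)
  qed
  moreover have "bij_betw Phi (solenoid A) (characters YG YT)"
    using Phi_inj Phi_image by (simp add: bij_betw_def)
  ultimately show "Phi \<in> iso (solenoid_group A) (dual_group YG YT)"
    by (simp add: iso_def carrier_solenoid_group dual_group_def)
  show "homeomorphic_map (solenoid_topology A) (dual_topology YG YT) Phi"
    by (rule continuous_imp_homeomorphic_map[OF continuous_map_Phi compact_solenoid Hausdorff_dual_discrete])
      (simp_all add: topspace_solenoid topspace_dual Phi_image Phi_inj)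
qed

section \<open>Continuous characters and endomorphisms of the solenoid\<close>

lemma real_inverse:
  obtains R where "rmat A ** R = mat 1" "R ** rmat A = mat 1"
proof -
  have "det (rmat A) = of_int (det A)"
    using unital_ring_hom.f_det[OF unital_ring_hom_of_int[where 'b = real], of A] by simp
  hence "invertible (rmat A)" using nonsing by (simp add: invertible_det_nz)
  thus thesis using that unfolding invertible_def by blast
qed

text \<open>Restricting a character of the solenoid along this lift gives a character of \<open>\<real>\<^sup>n\<close> without
  having to know that the coordinate projection is a quotient map.\<close>

lemma real_lift:
  obtains \<iota> :: "real ^ 'n \<Rightarrow> nat \<Rightarrow> (real ^ 'n) set" where
    "\<And>x. \<iota> x \<in> solenoid A" "\<And>x. \<iota> x (Suc K) = torus_class x"
    "\<And>x y. \<iota> (x + y) = \<iota> x \<otimes>\<^bsub>solenoid_group A\<^esub> \<iota> y"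
    "continuous_map euclidean (solenoid_topology A) \<iota>"
proof -
  obtain R where R: "rmat A ** R = mat 1" "R ** rmat A = mat 1" by (rule real_inverse)
  \<comment> \<open>In effect \<open>M j\<close> is the power K + 1 - j of \<open>A\<close>, with
    \<open>R\<close> as the inverse of \<open>A\<close>, so it is the identity at coordinate
    \<open>Suc K\<close>.\<close>
  define M where "M j = matpow R (j - 1) ** rmat (matpow A K)" for j
  define \<iota> where "\<iota> x = (\<lambda>j\<in>{1..}. torus_class (M j *v x))" for x
  have MA: "rmat A ** M (Suc j) = M j" if j1: "j \<ge> 1" for j
  proof -
    obtain i where j: "j = Suc i" using j1 by (cases j) auto
    have "rmat A ** M (Suc j) = (rmat A ** R) ** (matpow R i ** rmat (matpow A K))"
      by (simp add: M_def j matrix_mul_assoc)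
    thus ?thesis by (simp add: R M_def j)
  qed
  have MK: "M (Suc K) = mat 1"
  proof -
    have "matpow R k ** rmat (matpow A k) = mat 1" for k
    proof (induction k)
      case 0
      then show ?case by (simp add: rmat_mat_1)
    next
      case (Suc k)
      have "matpow R (Suc k) ** rmat (matpow A (Suc k)) = matpow R k ** (R ** rmat A) ** rmat (matpow A k)"
        by (simp only: matpow_Suc_right[of R] matpow.simps(2)[of A] rmat_mult matrix_mul_assoc)
      thus ?case using Suc by (simp add: R)
    qed
    thus ?thesis by (simp add: M_def)
  qed
  have sol: "\<iota> x \<in> solenoid A" for x
  proof (rule solenoidI[where x = "\<lambda>j. M j *v x"])
    fix j :: nat assume j: "j \<ge> 1"
    show "\<iota> x j = torus_class (M j *v x)" using j by (simp add: \<iota>_def)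
    show "torus_class (rmat A *v (M (Suc j) *v x)) = torus_class (M j *v x)"
      using MA[OF j] by (simp add: matrix_vector_mul_assoc)
  qed (simp add: \<iota>_def)
  show thesis
  proof (rule that[of \<iota>])
    show "\<iota> x \<in> solenoid A" for x by (rule sol)
    show "\<iota> x (Suc K) = torus_class x" for x by (simp add: \<iota>_def MK)
    show "\<iota> (x + y) = \<iota> x \<otimes>\<^bsub>solenoid_group A\<^esub> \<iota> y" for x y
      by (rule ext) (simp add: \<iota>_def mult_solenoid_group torus_mult matrix_vector_right_distrib)
    show "continuous_map euclidean (solenoid_topology A) \<iota>"
      unfolding solenoid_topology_def continuous_map_in_subtopology continuous_map_componentwise
    proof (intro conjI ballI)
      show "\<iota> ` topspace euclidean \<subseteq> extensional {1..}" by (auto simp: \<iota>_def)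
      show "\<iota> \<in> topspace euclidean \<rightarrow> solenoid A" using sol by auto
      fix j :: nat assume j: "j \<in> {1..}"
      have "continuous_map euclidean torus_topology (\<lambda>x. torus_class (M j *v x))"
        by (rule continuous_map_compose[OF _ continuous_map_torus_class, unfolded o_def])
          (simp add: matrix_vector_mult_linear_continuous_on)
      thus "continuous_map euclidean torus_topology (\<lambda>x. \<iota> x j)" using j by (simp add: \<iota>_def)
    qed
  qed
qed

text \<open>By continuity the character maps the kernel of some coordinate projection into the right
  half of the circle, hence to 1. It therefore depends on that coordinate alone, where it is a
  character of \<real>^n trivial on \<int>^n, that is, an integer vector.\<close>

lemma character_of_solenoid:
  assumes cont: "continuous_map (solenoid_topology A) (top_of_set (sphere 0 1)) \<kappa>"
    and mult: "\<And>z w. z \<in> solenoid A \<Longrightarrow> w \<in> solenoid A \<Longrightarrow> \<kappa> (z \<otimes>\<^bsub>solenoid_group A\<^esub> w) = \<kappa> z * \<kappa> w"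
  shows "\<exists>y\<in>Y. \<forall>z\<in>solenoid A. \<kappa> z = Phi z y"
proof -
  have norm: "cmod (\<kappa> z) = 1" if "z \<in> solenoid A" for z
    using continuous_map_image_subset_topspace[OF cont] that by (auto simp: topspace_solenoid)
  define e :: "nat \<Rightarrow> (real ^ 'n) set" where "e = (\<lambda>j\<in>{1..}. torus_class 0)"
  have e: "e \<in> solenoid A"
    by (rule solenoidI[where x = "\<lambda>_. 0"]) (auto simp: e_def)
  have "e \<otimes>\<^bsub>solenoid_group A\<^esub> e = e"
    by (rule ext) (simp add: e_def mult_solenoid_group torus_mult)
  hence "\<kappa> e * \<kappa> e = \<kappa> e" using mult[OF e e] by simp
  hence \<kappa>e: "\<kappa> e = 1" using norm[OF e] by auto
  define V where "V = {z \<in> solenoid A. \<kappa> z \<in> sphere 0 1 \<inter> {w. Re w > 0}}"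
  have "open {w. Re w > 0}" by (rule open_halfspace_Re_gt)
  hence "openin (top_of_set (sphere 0 1)) (sphere 0 1 \<inter> {w. Re w > 0})" by (rule openin_open_Int)
  hence "openin (solenoid_topology A) V"
    using openin_continuous_map_preimage[OF cont] unfolding V_def topspace_solenoid by blast
  then obtain V' where V': "openin (product_topology (\<lambda>_. torus_topology) {1..}) V'" "V = V' \<inter> solenoid A"
    unfolding solenoid_topology_def openin_subtopology by blast
  have "e \<in> V" unfolding V_def using e \<kappa>e by simp
  hence eV': "e \<in> V'" using V'(2) by blast
  from V'(1)[unfolded openin_product_topology_alt, THEN bspec, OF eV'] obtain U where U: "finite {j \<in> {1::nat..}. U j \<noteq> topspace torus_topology}"
    "e \<in> Pi\<^sub>E {1..} U" "Pi\<^sub>E {1..} U \<subseteq> V'"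
    by (elim exE conjE)
  \<comment> \<open>\<open>K\<close> bounds the finitely many coordinates constrained by the basic
    neighbourhood; the inserted 0 covers the case that there are none.\<close>
  define K where "K = Max (insert 0 {j \<in> {1::nat..}. U j \<noteq> topspace torus_topology})"
  have K: "j \<le> K" if "j \<ge> 1" "U j \<noteq> topspace torus_topology" for j
    unfolding K_def using U(1) that by (intro Max_ge) auto
  \<comment> \<open>A trivial coordinate \<open>Suc K\<close> makes all earlier coordinates trivial,
    so \<open>N\<close> lies inside the basic neighbourhood.\<close>
  define N where "N = {z \<in> solenoid A. z (Suc K) = torus_class 0}"
  have N_V: "z \<in> V" if "z \<in> N" for z
  proof -
    have z: "z \<in> solenoid A" "z (Suc K) = torus_class 0" using that by (auto simp: N_def)
    have "z \<in> Pi\<^sub>E {1..} U"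
    proof (rule PiE_I)
      fix j :: nat assume j: "j \<in> {1..}"
      show "z j \<in> U j"
      proof (cases "U j = topspace torus_topology")
        case True
        then show ?thesis using z(1) j by (auto simp: topspace_torus solenoid_def)
      next
        case False
        hence "j \<le> K" using K j by simp
        hence "z j = torus_class (rmat (matpow A (Suc K - j)) *v 0)"
          using solenoid_step[OF z(1), of j "Suc K - j" 0] j z(2) by simp
        hence "z j = e j" using j by (simp add: e_def)
        then show ?thesis using U(2) j by auto
      qed
    qed (use z(1) in \<open>auto simp: solenoid_def PiE_def extensional_def\<close>)
    thus ?thesis using U(3) V'(2) z(1) by blast
  qed
  have N_1: "\<kappa> z = 1" if "z \<in> N" for z
  proof (rule no_small_subgroup[of "\<kappa> ` N"])
    fix w assume "w \<in> \<kappa> ` N"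
    then obtain z where z: "z \<in> N" "w = \<kappa> z" by blast
    have zs: "z \<in> solenoid A" using z(1) by (simp add: N_def)
    have "z \<otimes>\<^bsub>solenoid_group A\<^esub> z \<in> N"
      using z(1) mult_in_solenoid[OF zs zs] mult_solenoid_class[of "Suc K" z 0 z 0 A] by (simp add: N_def)
    moreover have "\<kappa> (z \<otimes>\<^bsub>solenoid_group A\<^esub> z) = w * w" using mult[OF zs zs] by (simp add: z(2))
    ultimately have "w * w \<in> \<kappa> ` N" by (metis imageI)
    thus "cmod w = 1 \<and> 0 < Re w \<and> w * w \<in> \<kappa> ` N"
      using N_V[OF z(1)] by (simp add: V_def z(2))
  qed (use that in blast)
  obtain \<iota> :: "real ^ 'n \<Rightarrow> nat \<Rightarrow> (real ^ 'n) set" where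
    \<iota>: "\<And>x. \<iota> x \<in> solenoid A" "\<And>x. \<iota> x (Suc K) = torus_class x"
    "\<And>x y. \<iota> (x + y) = \<iota> x \<otimes>\<^bsub>solenoid_group A\<^esub> \<iota> y"
    and \<iota>_cont: "continuous_map euclidean (solenoid_topology A) \<iota>"
    using real_lift[of K] by blast
  define \<psi> where "\<psi> x = \<kappa> (\<iota> x)" for x
  have \<psi>_cont: "continuous_on UNIV \<psi>"
    using continuous_map_compose[OF \<iota>_cont cont] unfolding \<psi>_def
    by (simp add: o_def continuous_map_in_subtopology)
  have \<psi>_add: "\<psi> (x + y) = \<psi> x * \<psi> y" for x y by (simp add: \<psi>_def \<iota> mult)
  have \<psi>_norm: "cmod (\<psi> x) = 1" for x by (simp add: \<psi>_def \<iota> norm)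
  have \<psi>_0: "\<psi> 0 = 1" using \<psi>_add[of 0 0] \<psi>_norm[of 0] by auto
  have "\<exists>c. \<forall>t. \<psi> (t *\<^sub>R axis a 1) = cis (2 * pi * (c * t))" for a
  proof -
    have "continuous_on UNIV (\<lambda>t. \<psi> (t *\<^sub>R axis a 1))"
      by (intro continuous_on_compose2[OF \<psi>_cont] continuous_intros) auto
    moreover have "\<psi> ((s + t) *\<^sub>R axis a 1) = \<psi> (s *\<^sub>R axis a 1) * \<psi> (t *\<^sub>R axis a 1)" for s t
      by (simp add: \<psi>_add[symmetric] scaleR_left_distrib)
    ultimately show ?thesis
      using continuous_real_character[of "\<lambda>t. \<psi> (t *\<^sub>R axis a 1)"] \<psi>_norm by metis
  qed
  then obtain c where c: "\<And>a t. \<psi> (t *\<^sub>R axis a 1) = cis (2 * pi * (c a * t))" by metis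
  \<comment> \<open>A basis vector is an integer vector, so its lift lies in \<open>N\<close> and
    has value 1; this makes the frequency \<open>c a\<close> an integer.\<close>
  have "c a \<in> \<int>" for a
  proof -
    have "torus_class (axis a 1) = torus_class (0 :: real ^ 'n)"
      by (simp add: torus_class_eq_iff int_lattice_def axis_def)
    hence "\<iota> (axis a 1) \<in> N" by (simp add: N_def \<iota>)
    hence "\<psi> (axis a 1) = 1" by (simp add: \<psi>_def N_1)
    hence "cis (2 * pi * c a) = cis (2 * pi * 0)" using c[of 1 a] by simp
    thus ?thesis unfolding cis_2pi_eq_iff by simp
  qed
  hence "\<exists>d. c a = of_int d" for a by (meson Ints_cases)
  then obtain d where d: "\<And>a. c a = of_int (d a)" by metis
  define dv where "dv = (\<chi> a. d a)"
  have \<psi>_torus_char: "\<psi> x = torus_char dv x" for x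
  proof -
    have sum: "\<psi> (\<Sum>a\<in>X. x $ a *\<^sub>R axis a 1) = cis (2 * pi * (\<Sum>a\<in>X. c a * x $ a))" for X
      by (induction X rule: infinite_finite_induct) (simp_all add: \<psi>_0 \<psi>_add c cis_mult distrib_left)
    have "(\<Sum>a\<in>UNIV. x $ a *\<^sub>R axis a 1) = x"
      by (simp add: vec_eq_iff axis_def if_distrib[of "\<lambda>t. _ * t"] cong: if_cong)
    thus ?thesis using sum[of UNIV] by (simp add: torus_char_def rdot_def dv_def d)
  qed
  have "\<kappa> z = Phi z (inverse lam ^ K * dotu dv)" if z: "z \<in> solenoid A" for z
  proof -
    obtain x where x: "z (Suc K) = torus_class x" using solenoid_class[OF z, of "Suc K"] by auto
    \<comment> \<open>Subtracting the lift of a representative moves \<open>z\<close> into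
      \<open>N\<close>, so the value at \<open>z\<close> is that at the lift.\<close>
    have zN: "z \<otimes>\<^bsub>solenoid_group A\<^esub> \<iota> (- x) \<in> N"
      using mult_in_solenoid[OF z \<iota>(1)] mult_solenoid_class[of "Suc K" z x "\<iota> (- x)" "- x" A] x \<iota>(2)
      by (simp add: N_def)
    have "\<kappa> z * \<psi> (- x) = 1" unfolding \<psi>_def mult[OF z \<iota>(1), symmetric] by (rule N_1[OF zN])
    moreover have "\<psi> x * \<psi> (- x) = 1" using \<psi>_add[of x "- x"] \<psi>_0 by simp
    ultimately have "\<kappa> z = \<psi> x" by (metis mult_cancel_right mult_zero_right zero_neq_one)
    thus ?thesis using Phi_eq[OF z x] \<psi>_torus_char by simp
  qed
  thus ?thesis using YI by blast
qed

text \<open>If a nonzero vector \<open>c\<close> represented the difference, its character on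
  \<real>^n would be trivial, although it takes the value -1 at a multiple of a basis
  vector.\<close>

lemma Phi_separates:
  assumes y: "y \<in> Y" "y' \<in> Y" and eq: "\<And>z. z \<in> solenoid A \<Longrightarrow> Phi z y = Phi z y'"
  shows "y = y'"
proof -
  have "y + - y' \<in> Y" using y by (intro Y_add Y_minus)
  then obtain k c where kc: "y + - y' = inverse lam ^ k * dotu c" by (rule YE)
  have one: "Phi z (y + - y') = 1" if z: "z \<in> solenoid A" for z
  proof -
    have "Phi z (y + - y') = Phi z (y' + - y')"
      by (simp only: Phi_add[OF z y(1) Y_minus[OF y(2)]] Phi_add[OF z y(2) Y_minus[OF y(2)]] eq[OF z])
    also have "\<dots> = Phi z 0" by simp
    also have "\<dots> = 1"
    proof -
      have "Phi z (0 + 0) = Phi z 0 * Phi z 0" by (rule Phi_add[OF z Y_0 Y_0])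
      thus ?thesis using Phi_norm[OF z Y_0] by auto
    qed
    finally show ?thesis .
  qed
  obtain \<iota> :: "real ^ 'n \<Rightarrow> nat \<Rightarrow> (real ^ 'n) set" where
    \<iota>: "\<And>x. \<iota> x \<in> solenoid A" "\<And>x. \<iota> x (Suc k) = torus_class x"
    using real_lift[of k] by metis
  have ch1: "torus_char c x = 1" for x using one[OF \<iota>(1)[of x]] Phi_eq[OF \<iota>, of x c] kc by simp
  have "c $ a = 0" for a
  proof (rule ccontr)
    assume nz: "c $ a \<noteq> 0"
    \<comment> \<open>Chosen so that \<open>rdot c x\<close> is 1/2.\<close>
    define x where "x = (1 / (2 * real_of_int (c $ a))) *\<^sub>R (axis a 1 :: real ^ 'n)"
    have rd: "rdot c x = 1 / 2"
      using nz by (simp add: rdot_def x_def axis_def if_distrib[of "\<lambda>t. _ * t"] cong: if_cong)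
    have "torus_char c x = cis (2 * pi * (1 / 2))" by (simp only: torus_char_def rd)
    thus False using ch1[of x] by simp
  qed
  hence "c = 0" by (simp add: vec_eq_iff)
  thus ?thesis using kc by (simp add: dotu_def)
qed

text \<open>For fixed \<open>y\<close>, sending \<open>z\<close> to
  \<open>Phi (\<alpha> z) y\<close> is a continuous character of the solenoid, hence evaluation at a
  point \<open>f y\<close>. This point is unique by \<open>Phi_separates\<close>, which makes
  \<open>f\<close> additive, so that \<open>endomorphism_is_multiplication\<close> applies.\<close>

lemma endomorphism_dual:
  fixes p :: nat
  assumes p: "Factorial_Ring.prime p" "gcd CARD('n) (zero_mult A p) = 1"
    and \<alpha>: "\<alpha> \<in> hom (solenoid_group A) (solenoid_group A)"
    and cont: "continuous_map (solenoid_topology A) (solenoid_topology A) \<alpha>"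
  shows "\<exists>x \<in> S_integers lam. (\<lambda>y. x * y) \<in> hom YG YG \<and>
    (\<forall>z \<in> solenoid A. Phi (\<alpha> z) = dual_hom YG (\<lambda>y. x * y) (Phi z))"
proof -
  have \<alpha>s: "\<alpha> z \<in> solenoid A" if "z \<in> solenoid A" for z
    using \<alpha> that by (auto simp: hom_def Pi_iff carrier_solenoid_group)
  have \<alpha>m: "\<alpha> (z \<otimes>\<^bsub>solenoid_group A\<^esub> w) = \<alpha> z \<otimes>\<^bsub>solenoid_group A\<^esub> \<alpha> w"
    if "z \<in> solenoid A" "w \<in> solenoid A" for z w
    using \<alpha> that by (simp add: hom_def carrier_solenoid_group)
  have "\<exists>y'\<in>Y. \<forall>z\<in>solenoid A. Phi (\<alpha> z) y = Phi z y'" if y: "y \<in> Y" for y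
  proof (rule character_of_solenoid)
    show "continuous_map (solenoid_topology A) (top_of_set (sphere 0 1)) (\<lambda>z. Phi (\<alpha> z) y)"
      using continuous_map_compose[OF cont continuous_map_Phi_at[OF y]] by (simp add: o_def)
    show "Phi (\<alpha> (z \<otimes>\<^bsub>solenoid_group A\<^esub> w)) y = Phi (\<alpha> z) y * Phi (\<alpha> w) y"
      if "z \<in> solenoid A" "w \<in> solenoid A" for z w
      using \<alpha>m[OF that] Phi_mult[OF \<alpha>s \<alpha>s y] that by simp
  qed
  then obtain f where f: "\<And>y. y \<in> Y \<Longrightarrow> f y \<in> Y"
    "\<And>y z. y \<in> Y \<Longrightarrow> z \<in> solenoid A \<Longrightarrow> Phi (\<alpha> z) y = Phi z (f y)" by metis
  have f_add: "f (x + y) = f x + f y" if xy: "x \<in> Y" "y \<in> Y" for x y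
  proof (rule Phi_separates)
    show "f (x + y) \<in> Y" "f x + f y \<in> Y" using xy f Y_add by auto
    fix z assume z: "z \<in> solenoid A"
    show "Phi z (f (x + y)) = Phi z (f x + f y)"
      using f(2)[OF Y_add[OF xy] z] f(2)[OF xy(1) z] f(2)[OF xy(2) z] Phi_add[OF \<alpha>s[OF z] xy]
        Phi_add[OF z f(1)[OF xy(1)] f(1)[OF xy(2)]] by simp
  qed
  obtain x where x: "x \<in> S_integers lam" "\<And>y. y \<in> Y \<Longrightarrow> f y = x * y"
    using endomorphism_is_multiplication[OF p f(1) f_add] by blast
  have xY: "x * y \<in> Y" if "y \<in> Y" for y using f(1)[OF that] x(2)[OF that] by simp
  have "(\<lambda>y. x * y) \<in> hom YG YG"
    using xY by (auto simp: hom_def additive_group_def distrib_left)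
  moreover have "Phi (\<alpha> z) = dual_hom YG (\<lambda>y. x * y) (Phi z)" if z: "z \<in> solenoid A" for z
  proof (rule extensionalityI[where A = Y])
    fix y assume y: "y \<in> Y"
    show "Phi (\<alpha> z) y = dual_hom YG (\<lambda>y. x * y) (Phi z) y"
      using f(2)[OF y z] x(2)[OF y] y by (simp add: dual_hom_def additive_group_def)
  qed (simp_all add: Phi_def dual_hom_def additive_group_def)
  ultimately show ?thesis using x(1) by blast
qed

end

section \<open>The duality, the dual endomorphisms and the inclusions combined\<close>

theorem theorem6p3:
  fixes A :: "int ^ 'n ^ 'n" and lam :: complex and u :: "complex ^ 'n"
  assumes nonsing: "det A \<noteq> 0"
    and irred: "Factorial_Ring.irreducible (map_poly rat_of_int (charpoly A))"
    and primes: "det_primes' A \<noteq> {}"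
    and tp: "\<exists>p::nat. Factorial_Ring.prime p \<and> gcd CARD('n) (zero_mult A p) = 1"
    and lam_alg: "algebraic lam"
    and u_alg: "\<And>i. algebraic (u $ i)"
    and eigen: "u \<noteq> 0" "map_matrix of_int A *v u = lam *s u"
  shows "(\<exists>\<Phi>. top_group_iso (solenoid_group A) (solenoid_topology A)
              (dual_group (additive_group (eigen_module lam u)) (discrete_topology (eigen_module lam u)))
              (dual_topology (additive_group (eigen_module lam u)) (discrete_topology (eigen_module lam u))) \<Phi> \<and>
            (\<forall>\<alpha>. \<alpha> \<in> hom (solenoid_group A) (solenoid_group A) \<and>
                 continuous_map (solenoid_topology A) (solenoid_topology A) \<alpha> \<longrightarrow>
               (\<exists>x \<in> S_integers lam.
                  (\<lambda>y. x * y) \<in> hom (additive_group (eigen_module lam u)) (additive_group (eigen_module lam u)) \<and>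
                  (\<forall>z \<in> solenoid A. \<Phi> (\<alpha> z) = dual_hom (additive_group (eigen_module lam u)) (\<lambda>y. x * y) (\<Phi> z)))))
       \<and> ((\<forall>i. u $ i \<in> integers_of (rat_adjoin_field lam)) \<longrightarrow>
            eigen_module lam u \<subseteq> S_integers lam \<and>
            span_over \<int> u \<subseteq> eigen_module lam u \<and>
            eigen_module lam u \<subseteq> span_over (int_adjoin {1 / of_int (det A)}) u)"
proof -
  obtain lm P W where "diagonalized A lm P W" using diagonalized_exists[OF irred] .
  then interpret D: diagonalized A lm P W .
  \<comment> \<open>\<open>lam\<close> is a root of the characteristic polynomial, so it is one of
    the enumerated eigenvalues.\<close>
  obtain i0 where i0: "lam = lm i0"
  proof -
    have "poly (map_poly of_int (charpoly A)) lam = 0"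
      by (rule eigenvalue_charpoly_root[OF eigen])
    hence "(\<Prod>i\<in>UNIV. lam - lm i) = 0" unfolding D.charpoly_prod by (simp add: poly_prod)
    thus thesis using that by auto
  qed
  interpret solenoid_eigenvector A lm P W lam u i0
    by unfold_locales (use nonsing eigen i0 in auto)
  obtain p :: nat where p: "Factorial_Ring.prime p" "gcd CARD('n) (zero_mult A p) = 1" using tp by (elim exE conjE)
  show ?thesis
    unfolding eigen_module_eq
  proof (intro conjI impI exI[of _ Phi] allI)
    show "top_group_iso (solenoid_group A) (solenoid_topology A) (dual_group YG YT) (dual_topology YG YT) Phi"
      by (rule Phi_top_group_iso)
    show "\<exists>x \<in> S_integers lam. (\<lambda>y. x * y) \<in> hom YG YG \<and>
        (\<forall>z \<in> solenoid A. Phi (\<alpha> z) = dual_hom YG (\<lambda>y. x * y) (Phi z))"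
      if "\<alpha> \<in> hom (solenoid_group A) (solenoid_group A) \<and>
        continuous_map (solenoid_topology A) (solenoid_topology A) \<alpha>" for \<alpha>
      by (rule endomorphism_dual[OF p]) (use that in blast)+
    show "Y \<subseteq> S_integers lam" if "\<forall>i. u $ i \<in> integers_of (rat_adjoin_field lam)"
      by (rule Y_subset_S_integers) (use that in blast)
    show "span_over \<int> u \<subseteq> Y" by (rule span_Ints_subset_Y)
    show "Y \<subseteq> span_over (int_adjoin {1 / of_int (det A)}) u" by (rule Y_subset_span_det)
  qed
qed

end
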